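(* Let $k>2$ be an integer, let $X$ be the $k$-regular tree, and let $G=\mathrm{Aut}(X)$ be its automorphism group, a locally compact group for the topology of pointwise convergence. Then $G$ contains a lattice $\Gamma$ for which the unitary representation $\rho_{\Gamma\backslash G}$ of $G$ on $L^2(\Gamma\backslash G)$ given by right translations has no spectral gap.
   Context: A lattice $\Gamma$ in a locally compact group $G$ is a discrete subgroup such that there exists a finite (nonzero) $G$-invariant regular Borel measure $\mu$ on $\Gamma\backslash G$. A unitary representation $\pi$ of $G$ on a Hilbert space $\mathcal{H}$ has almost invariant vectors if, for every compact subset $Q$ of $G$ and every $\varepsilon>0$, there exists a unit vector $\xi\in\mathcal{H}$ with $\sup_{x\in Q}\Vert\pi(x)\xi-\xi\Vert<\varepsilon$. For a lattice $\Gamma$ in $G$, $\rho_{\Gamma\backslash G}$ denotes the unitary representation of $G$ by right translations on $L^2(\Gamma\backslash G,\mu)$. The subspace $L^2_0(\Gamma\backslash G)=\{\xi\in L^2(\Gamma\backslash G): \int_{\Gamma\backslash G}\xi\,d\mu=0\}$ is invariant; let $\rho^0_{\Gamma\backslash G}$ be the restriction of $\rho_{\Gamma\backslash G}$ to it. One says that $\rho_{\Gamma\backslash G}$ has a spectral gap if $\rho^0_{\Gamma\backslash G}$ has no almost invariant vectors. The $k$-regular tree is the infinite tree in which every vertex has degree $k$; stabilizers of vertices in $\mathrm{Aut}(X)$ are compact open subgroups. *)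

theory Defs
  imports "HOL-Analysis.Analysis" "HOL-Algebra.Bij" "HOL-Algebra.Coset"
begin

section \<open>Regular trees\<close>

text \<open>A simple graph is a vertex set together with a symmetric, irreflexive relation on it.\<close>

definition simple_graph :: "'v set \<Rightarrow> ('v \<times> 'v) set \<Rightarrow> bool" where
  "simple_graph V E \<longleftrightarrow> E \<subseteq> V \<times> V \<and> sym E \<and> irrefl E"

definition graph_connected :: "'v set \<Rightarrow> ('v \<times> 'v) set \<Rightarrow> bool" where
  "graph_connected V E \<longleftrightarrow> V \<noteq> {} \<and> (\<forall>u\<in>V. \<forall>v\<in>V. (u, v) \<in> E\<^sup>*)"

definition graph_cycle :: "('v \<times> 'v) set \<Rightarrow> 'v list \<Rightarrow> bool" where
  "graph_cycle E xs \<longleftrightarrow>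
     length xs \<ge> 3 \<and> distinct xs \<and> successively (\<lambda>u v. (u, v) \<in> E) xs \<and> (last xs, hd xs) \<in> E"

definition is_tree :: "'v set \<Rightarrow> ('v \<times> 'v) set \<Rightarrow> bool" where
  "is_tree V E \<longleftrightarrow> simple_graph V E \<and> graph_connected V E \<and> (\<nexists>xs. graph_cycle E xs)"

definition regular_tree :: "nat \<Rightarrow> 'v set \<Rightarrow> ('v \<times> 'v) set \<Rightarrow> bool" where
  "regular_tree k V E \<longleftrightarrow>
     is_tree V E \<and> infinite V \<and> (\<forall>v\<in>V. finite {w. (v, w) \<in> E} \<and> card {w. (v, w) \<in> E} = k)"


section \<open>The automorphism group with the topology of pointwise convergence\<close>

text \<open>The elements of \<^term>\<open>BijGroup V\<close> are extensional functions, so that an automorphism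
  is determined by its values on \<^term>\<open>V\<close>.\<close>

definition aut_group :: "'v set \<Rightarrow> ('v \<times> 'v) set \<Rightarrow> ('v \<Rightarrow> 'v) monoid" where
  "aut_group V E =
     BijGroup V \<lparr>carrier := {f \<in> Bij V. \<forall>u\<in>V. \<forall>v\<in>V. (f u, f v) \<in> E \<longleftrightarrow> (u, v) \<in> E}\<rparr>"

definition aut_topology :: "'v set \<Rightarrow> ('v \<times> 'v) set \<Rightarrow> ('v \<Rightarrow> 'v) topology" where
  "aut_topology V E =
     subtopology (product_topology (\<lambda>_. discrete_topology V) V) (carrier (aut_group V E))"


section \<open>Lattices in locally compact groups\<close>

definition locally_compact_group :: "('a, 'b) monoid_scheme \<Rightarrow> 'a topology \<Rightarrow> bool" where
  "locally_compact_group G T \<longleftrightarrow>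
     group G \<and> topspace T = carrier G \<and>
     continuous_map (prod_topology T T) T (\<lambda>(x, y). x \<otimes>\<^bsub>G\<^esub> y) \<and>
     continuous_map T T (\<lambda>x. inv\<^bsub>G\<^esub> x) \<and>
     Hausdorff_space T \<and> locally_compact_space T"

text \<open>The points of \<open>\<Gamma>\G\<close> are the right cosets \<open>\<Gamma>g\<close>; the group \<open>G\<close> acts on them by
  right translation \<open>\<Gamma>x \<mapsto> \<Gamma>xg\<close>.\<close>

definition coset_topology ::
    "('a, 'b) monoid_scheme \<Rightarrow> 'a topology \<Rightarrow> 'a set \<Rightarrow> 'a set topology" where
  "coset_topology G T \<Gamma> =
     topology (\<lambda>U. U \<subseteq> rcosets\<^bsub>G\<^esub> \<Gamma> \<and> openin T {g \<in> carrier G. \<Gamma> #>\<^bsub>G\<^esub> g \<in> U})"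

lemma openin_coset_topology:
  "openin (coset_topology G T \<Gamma>) U \<longleftrightarrow>
     U \<subseteq> rcosets\<^bsub>G\<^esub> \<Gamma> \<and> openin T {g \<in> carrier G. \<Gamma> #>\<^bsub>G\<^esub> g \<in> U}"
proof -
  let ?P = "\<lambda>U. {g \<in> carrier G. \<Gamma> #>\<^bsub>G\<^esub> g \<in> U}"
  have Int: "?P (U \<inter> W) = ?P U \<inter> ?P W" for U W by auto
  have Un: "?P (\<Union>\<K>) = \<Union>(?P ` \<K>)" for \<K> by auto
  have "istopology (\<lambda>U. U \<subseteq> rcosets\<^bsub>G\<^esub> \<Gamma> \<and> openin T (?P U))"
    unfolding istopology_def Int Un by blast
  then show ?thesis
    by (simp add: coset_topology_def)
qed

lemma quotient_map_coset_topology: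
  assumes "topspace T = carrier G"
  shows "quotient_map T (coset_topology G T \<Gamma>) (\<lambda>g. \<Gamma> #>\<^bsub>G\<^esub> g)"
proof -
  have "{g \<in> carrier G. \<Gamma> #>\<^bsub>G\<^esub> g \<in> rcosets\<^bsub>G\<^esub> \<Gamma>} = topspace T"
    using assms by (auto simp: RCOSETS_def)
  then have "openin (coset_topology G T \<Gamma>) (rcosets\<^bsub>G\<^esub> \<Gamma>)"
    by (simp add: openin_coset_topology)
  then have "topspace (coset_topology G T \<Gamma>) = rcosets\<^bsub>G\<^esub> \<Gamma>"
    by (meson openin_coset_topology openin_subset openin_topspace subset_antisym)
  then show ?thesis
    using assms by (auto simp: quotient_map_def openin_coset_topology RCOSETS_def)
qed

definition borel_sets_of :: "'x topology \<Rightarrow> 'x set set" where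
  "borel_sets_of X = sigma_sets (topspace X) {U. openin X U}"

definition regular_borel_measure :: "'x topology \<Rightarrow> 'x measure \<Rightarrow> bool" where
  "regular_borel_measure X \<mu> \<longleftrightarrow>
     space \<mu> = topspace X \<and> sets \<mu> = borel_sets_of X \<and>
     (\<forall>A\<in>sets \<mu>.
        emeasure \<mu> A = (SUP K\<in>{K. compactin X K \<and> K \<subseteq> A}. emeasure \<mu> K) \<and>
        emeasure \<mu> A = (INF U\<in>{U. openin X U \<and> A \<subseteq> U}. emeasure \<mu> U))"

definition finite_invariant_measure ::
    "('a, 'b) monoid_scheme \<Rightarrow> 'a topology \<Rightarrow> 'a set \<Rightarrow> 'a set measure \<Rightarrow> bool" where
  "finite_invariant_measure G T \<Gamma> \<mu> \<longleftrightarrow>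
     regular_borel_measure (coset_topology G T \<Gamma>) \<mu> \<and>
     finite_measure \<mu> \<and> emeasure \<mu> (space \<mu>) \<noteq> 0 \<and>
     (\<forall>g\<in>carrier G. \<forall>A\<in>sets \<mu>. emeasure \<mu> ((\<lambda>C. C #>\<^bsub>G\<^esub> g) ` A) = emeasure \<mu> A)"

definition is_lattice :: "('a, 'b) monoid_scheme \<Rightarrow> 'a topology \<Rightarrow> 'a set \<Rightarrow> bool" where
  "is_lattice G T \<Gamma> \<longleftrightarrow>
     locally_compact_group G T \<and> subgroup \<Gamma> G \<and>
     subtopology T \<Gamma> = discrete_topology \<Gamma> \<and>
     (\<exists>\<mu>. finite_invariant_measure G T \<Gamma> \<mu>)"


section \<open>The translation representation and spectral gap\<close>

text \<open>Vectors of \<open>L\<^sup>2\<close> are represented by square-integrable functions, functions that agree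
  almost everywhere being identified. Everything below depends only on the \<open>L\<^sup>2\<close>-seminorm and
  the integral, hence only on the class of the function, and right translations respect the
  identification when the measure is invariant.\<close>

definition L2_space :: "'x measure \<Rightarrow> ('x \<Rightarrow> complex) set" where
  "L2_space M = {f \<in> borel_measurable M. integrable M (\<lambda>x. (cmod (f x))\<^sup>2)}"

definition L2_seminorm :: "'x measure \<Rightarrow> ('x \<Rightarrow> complex) \<Rightarrow> real" where
  "L2_seminorm M f = sqrt (LINT x|M. (cmod (f x))\<^sup>2)"

definition L2_zero_space :: "'x measure \<Rightarrow> ('x \<Rightarrow> complex) set" where
  "L2_zero_space M = {f \<in> L2_space M. (LINT x|M. f x) = 0}"

definition right_translation ::
    "('a, 'b) monoid_scheme \<Rightarrow> 'a \<Rightarrow> ('a set \<Rightarrow> complex) \<Rightarrow> ('a set \<Rightarrow> complex)" where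
  "right_translation G g \<xi> = (\<lambda>C. \<xi> (C #>\<^bsub>G\<^esub> g))"

text \<open>The supremum is taken in \<^typ>\<open>ennreal\<close>, where it always exists and is \<open>0\<close> for
  \<open>Q = {}\<close>.\<close>

definition almost_invariant_vectors ::
    "'g topology \<Rightarrow> 'h set \<Rightarrow> ('h \<Rightarrow> real) \<Rightarrow> ('g \<Rightarrow> 'h \<Rightarrow> 'h::minus) \<Rightarrow> bool" where
  "almost_invariant_vectors T H nrm \<pi> \<longleftrightarrow>
     (\<forall>Q \<epsilon>. compactin T Q \<and> \<epsilon> > 0 \<longrightarrow>
        (\<exists>\<xi>\<in>H. nrm \<xi> = 1 \<and> (SUP x\<in>Q. ennreal (nrm (\<pi> x \<xi> - \<xi>))) < ennreal \<epsilon>))"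

definition spectral_gap ::
    "('a, 'b) monoid_scheme \<Rightarrow> 'a topology \<Rightarrow> 'a set measure \<Rightarrow> bool" where
  "spectral_gap G T \<mu> \<longleftrightarrow>
     \<not> almost_invariant_vectors T (L2_zero_space \<mu>) (L2_seminorm \<mu>) (right_translation G)"

end

theory Submission
  imports Defs "HOL-Library.Discrete_Functions" "HOL-Library.Nat_Bijection"
begin

text \<open>The lattice is the fundamental group of a graph of groups over the line \<open>\<int>\<close>, whose edge
  groups are powers of \<open>\<int>/(k - 1)\<close> with exponents that change by one at each vertex. It is
  realized as the group of automorphisms that preserve a level function \<open>l\<close> on the vertices and
  whose local actions are rotations of labelled neighbours. A vertex of level \<open>i\<close> then carries
  covolume proportional to \<open>(k - 1)\<^sup>-\<^sup>T\<close>, where \<open>T\<close> is the larger of the exponents at the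
  two edges at \<open>i\<close>. If the exponents grow like the square root of \<open>\<bar>i\<bar>\<close>, the covolume is finite,
  while the weights are constant on intervals of unbounded length. Differences of indicator
  functions of such intervals are almost invariant, since an element that moves the base vertex by
  \<open>n\<close> changes the level by at most \<open>n\<close>.

  For an arbitrary invariant measure, the masses of the levels are determined by detailed balance:
  the automorphism group is transitive on oriented edges, so the mass of the pairs of levels
  \<open>(i, j)\<close> at the ends of an edge is symmetric.\<close>

section \<open>Distance in a tree\<close>

text \<open>At a vertex the edge groups have index 1 and \<open>k - 1\<close> in the vertex group,
  matching the degree \<open>k\<close>; hence the exponents cannot stay constant along the line. An
  oscillation between \<open>r\<close> and \<open>r + 1\<close> is the substitute for a flat
  stretch: it keeps the vertex exponent at \<open>r + 1\<close>. Two demands compete. Finite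
  covolume forces the exponents to infinity, while almost invariance needs stretches whose ends
  carry little of their mass. With \<open>2 * r\<close> levels of weight
  \<open>(k - 1)^-(r + 1)\<close> on either side, the total is comparable to the sum of
  \<open>r * (k - 1)^-r\<close>, and the ends carry a fraction of order \<open>1 / r\<close>. The
  heights are even in the level, so a stretch and its mirror image balance to integral zero.
  Elements of \<open>\<Gamma>\<close> arise by extending the image and the germ of one vertex along
  the given tree, and stabilizers are finite because these data determine the element. The same
  extension result gives arc transitivity of the full group. One invariant measure is obtained by
  weighting an explicit Haar measure; the estimate for an arbitrary one sees it only through the
  masses of the levels.\<close>

lemma rtrancl_distinct_walk:
  assumes "(a, b) \<in> R\<^sup>*"
  shows "\<exists>xs. xs \<noteq> [] \<and> hd xs = a \<and> last xs = b \<and> distinct xs \<and> successively (\<lambda>u v. (u, v) \<in> R) xs"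
  using assms
proof (induction rule: converse_rtrancl_induct)
  case base
  show ?case by (rule exI[of _ "[b]"]) simp
next
  case (step a c)
  then obtain xs where xs: "xs \<noteq> []" "hd xs = c" "last xs = b" "distinct xs"
    "successively (\<lambda>u v. (u, v) \<in> R) xs" by blast
  show ?case
  proof (cases "a \<in> set xs")
    case True
    \<comment> \<open>Loop erasure: \<open>a\<close> already occurs, so the walk is restarted at
      that occurrence.\<close>
    then obtain ys zs where "xs = ys @ a # zs" by (meson split_list)
    then show ?thesis
      using xs by (intro exI[of _ "a # zs"]) (auto simp: successively_append_iff)
  next
    case False
    then show ?thesis
      using xs step.hyps(1) by (intro exI[of _ "a # xs"]) (auto simp: successively_Cons)
  qed
qed

locale regular_tree_graph =
  fixes k :: nat and V :: "'v set" and E :: "('v \<times> 'v) set"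
  assumes k_gt_2: "k > 2" and regular: "regular_tree k V E"
begin

definition nbrs :: "'v \<Rightarrow> 'v set" where
  "nbrs v = {w. (v, w) \<in> E}"

definition gdist :: "'v \<Rightarrow> 'v \<Rightarrow> nat" where
  "gdist r v = (LEAST n. (r, v) \<in> E ^^ n)"

lemma tree: "is_tree V E"
  using regular by (simp add: regular_tree_def)

lemma edge_sym: "(v, w) \<in> E \<Longrightarrow> (w, v) \<in> E"
  using tree by (auto simp: is_tree_def simple_graph_def sym_def)

lemma edge_in_V: "(v, w) \<in> E \<Longrightarrow> v \<in> V \<and> w \<in> V"
  using tree by (auto simp: is_tree_def simple_graph_def)

lemma edge_irrefl: "(v, v) \<notin> E"
  using tree by (auto simp: is_tree_def simple_graph_def irrefl_def)

lemma nbrs_sym: "w \<in> nbrs v \<longleftrightarrow> v \<in> nbrs w"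
  by (auto simp: nbrs_def dest: edge_sym)

lemma nbrs_in_V: "w \<in> nbrs v \<Longrightarrow> w \<in> V" "w \<in> nbrs v \<Longrightarrow> v \<in> V"
  by (auto simp: nbrs_def dest: edge_in_V)

lemma nbrs_irrefl: "v \<notin> nbrs v"
  by (simp add: nbrs_def edge_irrefl)

lemma finite_nbrs: "v \<in> V \<Longrightarrow> finite (nbrs v)"
  and card_nbrs: "v \<in> V \<Longrightarrow> card (nbrs v) = k"
  using regular by (auto simp: regular_tree_def nbrs_def)

lemma V_nonempty: "V \<noteq> {}"
  using tree by (simp add: is_tree_def graph_connected_def)

lemma reachable: "u \<in> V \<Longrightarrow> v \<in> V \<Longrightarrow> (u, v) \<in> E\<^sup>*"
  using tree by (simp add: is_tree_def graph_connected_def)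

lemma gdist_walk: "u \<in> V \<Longrightarrow> v \<in> V \<Longrightarrow> (u, v) \<in> E ^^ gdist u v"
  unfolding gdist_def using reachable rtrancl_imp_UN_relpow by (metis (mono_tags, lifting) LeastI UN_E)

lemma gdist_le: "(u, v) \<in> E ^^ n \<Longrightarrow> gdist u v \<le> n"
  unfolding gdist_def by (rule Least_le)

lemma gdist_self [simp]: "gdist v v = 0"
  using gdist_le[of v v 0] by simp

lemma gdist_eq_0: "u \<in> V \<Longrightarrow> v \<in> V \<Longrightarrow> gdist u v = 0 \<longleftrightarrow> u = v"
  using gdist_walk[of u v] by auto

lemma gdist_nbr_le:
  assumes "r \<in> V" "w \<in> nbrs v"
  shows "gdist r w \<le> Suc (gdist r v)"
proof -
  have "(r, v) \<in> E ^^ gdist r v" using assms nbrs_in_V gdist_walk by blast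
  then have "(r, w) \<in> E ^^ Suc (gdist r v)"
    using assms(2) by (auto simp: nbrs_def)
  then show ?thesis by (rule gdist_le)
qed

lemma gdist_nbr_le':
  assumes "r \<in> V" "w \<in> nbrs v"
  shows "gdist r v \<le> Suc (gdist r w)"
  using assms gdist_nbr_le nbrs_sym by blast

lemma gdist_eq_1:
  assumes "r \<in> V" "v \<in> V"
  shows "gdist r v = 1 \<longleftrightarrow> v \<in> nbrs r"
proof
  assume "gdist r v = 1"
  then show "v \<in> nbrs r" using gdist_walk[OF assms] by (simp add: nbrs_def)
next
  assume v: "v \<in> nbrs r"
  then have "gdist r v \<le> 1" using gdist_nbr_le[OF assms(1) v] by simp
  moreover have "gdist r v \<noteq> 0" using gdist_eq_0[OF assms] v nbrs_irrefl by auto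
  ultimately show "gdist r v = 1" by simp
qed

lemma closer_nbr_exists:
  assumes "r \<in> V" "v \<in> V" "v \<noteq> r"
  shows "\<exists>p\<in>nbrs v. Suc (gdist r p) = gdist r v"
proof -
  obtain n where n: "gdist r v = Suc n"
    using gdist_eq_0[OF assms(1,2)] assms(3) by (cases "gdist r v") auto
  then obtain p where p: "(r, p) \<in> E ^^ n" "(p, v) \<in> E"
    using gdist_walk[OF assms(1,2)] by auto
  have "p \<in> nbrs v" using p(2) edge_sym by (simp add: nbrs_def)
  moreover have "gdist r p = n"
    using gdist_le[OF p(1)] gdist_nbr_le'[OF assms(1) \<open>p \<in> nbrs v\<close>] n by simp
  ultimately show ?thesis using n by auto
qed

text \<open>A geodesic from \<open>p\<close> to \<open>r\<close> gets strictly closer to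
  \<open>r\<close> at each step, so it stays clear of \<open>v\<close>, which is no closer than
  \<open>p\<close>.\<close>

lemma walk_avoiding:
  assumes "r \<in> V" "v \<in> V" "p \<in> V" "p \<noteq> v" "gdist r p \<le> gdist r v"
  shows "(p, r) \<in> (E \<inter> (- {v}) \<times> (- {v}))\<^sup>*"
  using assms(3-5)
proof (induction "gdist r p" arbitrary: p)
  case 0
  then show ?case using gdist_eq_0[OF assms(1)] by auto
next
  case (Suc n)
  then have "p \<noteq> r" by auto
  then obtain p' where p': "p' \<in> nbrs p" "Suc (gdist r p') = gdist r p"
    using closer_nbr_exists assms(1) Suc.prems by blast
  then have "p' \<noteq> v" using Suc.prems by auto
  have "(p', r) \<in> (E \<inter> (- {v}) \<times> (- {v}))\<^sup>*"
    using Suc.hyps p' \<open>p' \<noteq> v\<close> Suc.prems nbrs_in_V by auto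
  moreover have "(p, p') \<in> E \<inter> (- {v}) \<times> (- {v})"
    using p' Suc.prems \<open>p' \<noteq> v\<close> by (simp add: nbrs_def)
  ultimately show ?case by (meson converse_rtrancl_into_rtrancl)
qed

text \<open>This is where acyclicity enters. Both neighbours reach \<open>r\<close> without passing
  through \<open>v\<close>; a simple path joining them off \<open>v\<close> closes up through
  \<open>v\<close> to a cycle. Allowing equality in the bounds also excludes edges between vertices
  at equal distance from \<open>r\<close>.\<close>

lemma nearer_nbr_unique:
  assumes "r \<in> V" and p: "p \<in> nbrs v" "gdist r p \<le> gdist r v"
    and p': "p' \<in> nbrs v" "gdist r p' \<le> gdist r v"
  shows "p = p'"
proof (rule ccontr)
  assume "p \<noteq> p'"
  let ?R = "E \<inter> (- {v}) \<times> (- {v})"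
  have v: "v \<in> V" "p \<in> V" "p' \<in> V" "p \<noteq> v" "p' \<noteq> v"
    using nbrs_in_V p p' nbrs_irrefl by auto
  have "sym ?R" using edge_sym by (auto simp: sym_def)
  then have "(p, p') \<in> ?R\<^sup>*"
    using walk_avoiding[of r v p] walk_avoiding[of r v p'] assms v
    by (meson rtrancl_trans sym_rtrancl symD)
  then obtain xs where xs: "xs \<noteq> []" "hd xs = p" "last xs = p'" "distinct xs"
    "successively (\<lambda>u v. (u, v) \<in> ?R) xs"
    using rtrancl_distinct_walk by metis
  obtain ys where ys: "xs = p # ys" using xs by (cases xs) auto
  then have "ys \<noteq> []" using xs \<open>p \<noteq> p'\<close> by auto
  have "v \<notin> set zs" if "successively (\<lambda>u v. (u, v) \<in> ?R) zs" "zs \<noteq> []" "hd zs \<noteq> v" for zs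
    using that by (induction zs) (fastforce simp: successively_Cons)+
  then have "v \<notin> set xs" using xs v by blast
  moreover have "successively (\<lambda>u v. (u, v) \<in> E) xs"
    using xs(5) by (rule successively_mono) auto
  ultimately have "graph_cycle E (v # xs)"
    using xs p p' \<open>ys \<noteq> []\<close> ys edge_sym
    by (cases ys) (auto simp: graph_cycle_def successively_Cons nbrs_def)
  then show False using tree by (auto simp: is_tree_def)
qed

section \<open>The tree as a rooted tree\<close>

definition parent :: "'v \<Rightarrow> 'v \<Rightarrow> 'v" where
  "parent r v = (SOME p. p \<in> nbrs v \<and> Suc (gdist r p) = gdist r v)"

lemma parent:
  assumes "r \<in> V" "v \<in> V" "v \<noteq> r"
  shows "parent r v \<in> nbrs v" "Suc (gdist r (parent r v)) = gdist r v"
  using someI_ex[of "\<lambda>p. p \<in> nbrs v \<and> Suc (gdist r p) = gdist r v"] closer_nbr_exists[OF assms]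
  unfolding parent_def by auto

lemma parent_unique:
  assumes "r \<in> V" "p \<in> nbrs v" "gdist r p \<le> gdist r v" "v \<noteq> r"
  shows "p = parent r v"
  using nearer_nbr_unique[OF assms(1-3)] parent[OF assms(1) _ assms(4)] nbrs_in_V assms(2)
  by (metis le_add2 plus_1_eq_Suc)

lemma nbr_cases:
  assumes "r \<in> V" "w \<in> nbrs v"
  shows "(v \<noteq> r \<and> w = parent r v \<and> gdist r v = Suc (gdist r w)) \<or>
         (w \<noteq> r \<and> v = parent r w \<and> gdist r w = Suc (gdist r v))"
proof (cases "gdist r w \<le> gdist r v")
  case True
  have "v \<noteq> r"
    using True assms gdist_eq_0 nbrs_in_V nbrs_irrefl by fastforce
  then show ?thesis
    using parent_unique[OF assms True] parent[OF assms(1) _ \<open>v \<noteq> r\<close>] nbrs_in_V assms by metis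
next
  case False
  then have "gdist r w = Suc (gdist r v)" using gdist_nbr_le[OF assms] by simp
  moreover have "w \<noteq> r" using False by auto
  moreover have "v = parent r w"
    using parent_unique[of r v w] assms nbrs_sym False \<open>w \<noteq> r\<close> by auto
  ultimately show ?thesis by simp
qed

lemma dist_induct [consumes 2, case_names root step]:
  assumes "r \<in> V" "v \<in> V" "P r"
    and "\<And>v. v \<in> V \<Longrightarrow> v \<noteq> r \<Longrightarrow> parent r v \<in> V \<Longrightarrow> parent r v \<in> nbrs v \<Longrightarrow> P (parent r v) \<Longrightarrow> P v"
  shows "P v"
  using assms(2)
proof (induction "gdist r v" arbitrary: v)
  case 0
  then show ?case using gdist_eq_0 assms by auto
next
  case (Suc n)
  then have "v \<noteq> r" by auto
  then show ?case
    using parent[OF assms(1) Suc.prems] assms(4)[OF Suc.prems] Suc nbrs_in_V by auto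
qed

text \<open>Primitive recursion on the distance from \<open>r\<close> stands in for well-founded
  recursion along \<open>parent\<close>: \<open>F' n v\<close> follows \<open>n\<close> parent
  steps.\<close>

lemma tree_recursion:
  fixes a :: 'b and f :: "'v \<Rightarrow> 'b \<Rightarrow> 'b"
  assumes "r \<in> V"
  obtains F where "F r = a" "\<And>v. v \<in> V \<Longrightarrow> v \<noteq> r \<Longrightarrow> F v = f v (F (parent r v))"
proof -
  define F' where "F' = rec_nat (\<lambda>_. a) (\<lambda>_ F v. f v (F (parent r v)))"
  define F where "F = (\<lambda>v. F' (gdist r v) v)"
  have "F r = a" by (simp add: F_def F'_def)
  moreover have "F v = f v (F (parent r v))" if "v \<in> V" "v \<noteq> r" for v
    using parent(2)[OF assms that, symmetric] by (simp add: F_def F'_def)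
  ultimately show ?thesis using that by blast
qed

lemma finite_ball:
  assumes "r \<in> V"
  shows "finite {v \<in> V. gdist r v \<le> n}"
proof (induction n)
  case 0
  have "{v \<in> V. gdist r v \<le> 0} \<subseteq> {r}" using gdist_eq_0 assms by auto
  then show ?case using finite_subset by blast
next
  case (Suc n)
  have "v \<in> (\<Union>w\<in>{v \<in> V. gdist r v \<le> n}. nbrs w) \<union> {r}"
    if "v \<in> V" "gdist r v \<le> Suc n" for v
  proof (cases "v = r")
    case False
    then have "parent r v \<in> {v \<in> V. gdist r v \<le> n}" "v \<in> nbrs (parent r v)"
      using parent[OF assms that(1) False] that nbrs_in_V nbrs_sym by auto
    then show ?thesis by blast
  qed simp
  then have "{v \<in> V. gdist r v \<le> Suc n} \<subseteq> (\<Union>w\<in>{v \<in> V. gdist r v \<le> n}. nbrs w) \<union> {r}"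
    by blast
  moreover have "finite \<dots>" using Suc finite_nbrs by auto
  ultimately show ?case by (rule finite_subset)
qed

lemma countable_V: "countable V"
proof -
  obtain r where r: "r \<in> V" using V_nonempty by blast
  have "V = (\<Union>n. {v \<in> V. gdist r v \<le> n})" by auto
  moreover have "countable (\<Union>n. {v \<in> V. gdist r v \<le> n})"
    by (rule countable_UN) (auto intro!: countable_finite finite_ball[OF r])
  ultimately show ?thesis by simp
qed

text \<open>Injectivity on stars means that the image of a geodesic never backtracks, and in a tree
  a walk without backtracking is a geodesic.\<close>

lemma local_bijection_dist:
  assumes g: "\<And>v. v \<in> V \<Longrightarrow> g v \<in> V" "\<And>v. v \<in> V \<Longrightarrow> bij_betw g (nbrs v) (nbrs (g v))"
    and a: "a \<in> V"
  shows "b \<in> V \<Longrightarrow> gdist (g a) (g b) = gdist a b"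
proof (induction "gdist a b" arbitrary: b rule: less_induct)
  case less
  show ?case
  proof (cases "b = a")
    case False
    define p where "p = parent a b"
    have p: "p \<in> nbrs b" "b \<in> nbrs p" "Suc (gdist a p) = gdist a b" "p \<in> V"
      using parent[OF a less.prems False] nbrs_sym nbrs_in_V unfolding p_def by auto
    have IH: "gdist (g a) (g p) = gdist a p" using less.hyps p by auto
    have gb: "g b \<in> nbrs (g p)" using g(2)[OF p(4)] p(2) by (auto simp: bij_betw_def)
    have "gdist (g a) (g b) = Suc (gdist (g a) (g p))"
    proof (cases "p = a")
      case True
      then show ?thesis using gb gdist_eq_1[of "g a" "g b"] g(1) less.prems a by auto
    next
      case pa: False
      define o' where "o' = parent a p"
      have o': "o' \<in> nbrs p" "Suc (gdist a o') = gdist a p" "o' \<in> V"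
        using parent[OF a p(4) pa] nbrs_in_V unfolding o'_def by auto
      have o2: "gdist (g a) (g o') = gdist a o'" "g o' \<in> nbrs (g p)"
        using less.hyps[of o'] o' p g(2)[OF p(4)] by (auto simp: bij_betw_def)
      \<comment> \<open>\<open>g o'\<close> is the one neighbour of \<open>g p\<close> nearer to
        \<open>g a\<close>; as \<open>g b\<close> differs from it, \<open>g b\<close> must be
        farther away.\<close>
      have "g b \<noteq> g o'"
      proof
        assume "g b = g o'"
        then have "b = o'" using g(2)[OF p(4)] p(2) o'(1) by (auto simp: bij_betw_def inj_on_def)
        then show False using p o' by auto
      qed
      then have "\<not> gdist (g a) (g b) \<le> gdist (g a) (g p)"
        using nearer_nbr_unique[OF g(1)[OF a] gb _ o2(2)] o2(1) o'(2) IH by auto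
      then show ?thesis using gdist_nbr_le[OF g(1)[OF a] gb] by simp
    qed
    then show ?thesis using IH p by simp
  qed simp
qed

text \<open>Injectivity comes from preserved distances; the image is everything because it is
  nonempty and closed under taking neighbours.\<close>

lemma local_bijection_bij:
  assumes g: "\<And>v. v \<in> V \<Longrightarrow> g v \<in> V" "\<And>v. v \<in> V \<Longrightarrow> bij_betw g (nbrs v) (nbrs (g v))"
  shows "bij_betw g V V"
  unfolding bij_betw_def
proof
  show "inj_on g V"
    using local_bijection_dist[of g, OF g] gdist_eq_0 g(1) by (metis inj_onI)
  obtain r where r: "r \<in> V" using V_nonempty by blast
  have "v \<in> g ` V" if "v \<in> V" for v
    using g(1)[OF r] that
  proof (induction rule: dist_induct)
    case (step v)
    then obtain u where u: "u \<in> V" "parent (g r) v = g u" by auto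
    then have "v \<in> nbrs (g u)" using step nbrs_sym by metis
    then obtain w where "w \<in> nbrs u" "v = g w" using g(2)[OF u(1)] by (auto simp: bij_betw_def)
    then show ?case using nbrs_in_V by blast
  qed (use r in auto)
  then show "g ` V = V" using g(1) by auto
qed

lemma local_bijection_edge_iff:
  assumes g: "\<And>v. v \<in> V \<Longrightarrow> g v \<in> V" "\<And>v. v \<in> V \<Longrightarrow> bij_betw g (nbrs v) (nbrs (g v))"
    and "u \<in> V" "v \<in> V"
  shows "(g u, g v) \<in> E \<longleftrightarrow> (u, v) \<in> E"
proof -
  have "gdist (g u) (g v) = gdist u v" using local_bijection_dist[of g, OF g] assms by blast
  then show ?thesis using gdist_eq_1[of "g u" "g v"] gdist_eq_1[of u v] g(1) assms(3,4)
    by (simp add: nbrs_def)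
qed

end

section \<open>Leveled trees and their isomorphisms\<close>

lemma bij_betw_shift_mod:
  fixes q :: int
  assumes "q > 0"
  shows "bij_betw (\<lambda>x. (x + c) mod q) {0..<q} {0..<q}"
  by (rule bij_betw_byWitness[where f' = "\<lambda>x. (x - c) mod q"])
     (use assms in \<open>auto simp: mod_simps\<close>)

text \<open>The vertices are spread over the levels \<open>\<int>\<close>; an edge between the levels \<open>i\<close> and \<open>i + 1\<close>
  has height \<open>e i\<close>. The stabilizer of such an edge in the lattice to be constructed will be a power
  of \<open>\<int>/(k - 1)\<close> with exponent \<open>e i\<close>. A vertex has one neighbour across the higher of the two
  kinds of edges at its level, and \<open>k - 1\<close> neighbours across the lower.\<close>

locale leveled_tree = regular_tree_graph k V E for k :: nat and V :: "'v set" and E +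
  fixes e :: "int \<Rightarrow> nat"
  assumes e_step: "e (i + 1) = Suc (e i) \<or> e i = Suc (e (i + 1))"
begin

abbreviation q :: int where "q \<equiv> int k - 1"

definition maj :: "int \<Rightarrow> int" where "maj i = (if e (i - 1) < e i then i + 1 else i - 1)"
definition mnr :: "int \<Rightarrow> int" where "mnr i = (if e (i - 1) < e i then i - 1 else i + 1)"
text \<open>The vertex group at level \<open>i\<close> has exponent \<open>Suc (low i)\<close>: it
  coincides with the group of the edge to the major level and contains that of an edge to the minor
  level with index \<open>k - 1\<close>.\<close>

definition low :: "int \<Rightarrow> nat" where "low i = min (e (i - 1)) (e i)"
definition ht :: "int \<Rightarrow> int \<Rightarrow> nat" where "ht i j = e (min i j)"

lemma q_pos: "q > 0"
  using k_gt_2 by simp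

lemma e_step': "e i = Suc (e (i - 1)) \<or> e (i - 1) = Suc (e i)"
  using e_step[of "i - 1"] by simp

lemma ht_sym: "ht i j = ht j i"
  by (simp add: ht_def min.commute)

lemma ht_maj: "ht i (maj i) = Suc (low i)"
  using e_step'[of i] by (auto simp: ht_def maj_def low_def min_def)

lemma ht_mnr: "ht i (mnr i) = low i"
  using e_step'[of i] by (auto simp: ht_def mnr_def low_def min_def)

lemma maj_neq_mnr: "maj i \<noteq> mnr i"
  by (simp add: maj_def mnr_def)

lemma maj_or_mnr_iff: "j = maj i \<or> j = mnr i \<longleftrightarrow> \<bar>i - j\<bar> = 1"
  by (auto simp: maj_def mnr_def)

definition minor :: "('v \<Rightarrow> int) \<Rightarrow> 'v \<Rightarrow> 'v set" where
  "minor l v = {w \<in> nbrs v. l w = mnr (l v)}"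

text \<open>Only the minor neighbours are labelled, by the residues modulo \<open>q\<close>; the
  major neighbour is recognized by its level.\<close>

definition leveling :: "('v \<Rightarrow> int) \<Rightarrow> ('v \<Rightarrow> 'v \<Rightarrow> int) \<Rightarrow> bool" where
  "leveling l idx \<longleftrightarrow>
     (\<forall>v\<in>V. (\<forall>w\<in>nbrs v. l w = maj (l v) \<or> l w = mnr (l v)) \<and>
            (\<exists>!w. w \<in> nbrs v \<and> l w = maj (l v)) \<and>
            bij_betw (idx v) (minor l v) {0..<q})"

lemma levelingD:
  assumes "leveling l idx"
  shows "w \<in> nbrs v \<Longrightarrow> l w = maj (l v) \<or> l w = mnr (l v)"
    and "v \<in> V \<Longrightarrow> \<exists>!w. w \<in> nbrs v \<and> l w = maj (l v)"
    and "v \<in> V \<Longrightarrow> bij_betw (idx v) (minor l v) {0..<q}"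
  using assms nbrs_in_V unfolding leveling_def by blast+

lemma leveling_step: "leveling l idx \<Longrightarrow> w \<in> nbrs v \<Longrightarrow> \<bar>l v - l w\<bar> = 1"
  using levelingD(1) maj_or_mnr_iff by blast

lemma idx_cong_imp_eq:
  assumes "leveling l idx" "v \<in> V" "w \<in> minor l v" "w' \<in> minor l v" "idx v w mod q = idx v w' mod q"
  shows "w = w'"
proof -
  have "idx v w \<in> {0..<q}" "idx v w' \<in> {0..<q}"
    using levelingD(3)[OF assms(1,2)] assms(3,4) by (auto simp: bij_betw_def)
  then have "idx v w = idx v w'" using assms(5) by auto
  then show ?thesis
    using levelingD(3)[OF assms(1,2)] assms(3,4) by (auto simp: bij_betw_def inj_on_def)
qed

text \<open>The germ \<open>h v\<close> of \<open>g\<close> at \<open>v\<close> is an element of the vertex group of \<open>v\<close>: only its entries below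
  \<open>Suc (low (l v))\<close>, taken modulo \<open>q\<close>, are relevant. The germs at the ends of an edge agree on the
  entries below the height of the edge, and the top entry at \<open>v\<close> rotates the minor neighbours.\<close>

definition leveled_iso ::
    "('v \<Rightarrow> int) \<Rightarrow> ('v \<Rightarrow> 'v \<Rightarrow> int) \<Rightarrow> ('v \<Rightarrow> int) \<Rightarrow> ('v \<Rightarrow> 'v \<Rightarrow> int) \<Rightarrow>
     ('v \<Rightarrow> 'v) \<Rightarrow> ('v \<Rightarrow> nat \<Rightarrow> int) \<Rightarrow> bool" where
  "leveled_iso l idx l' idx' g h \<longleftrightarrow>
     (\<forall>v\<in>V. l' (g v) = l v) \<and>
     (\<forall>v. \<forall>w\<in>nbrs v. \<forall>x<ht (l v) (l w). h v x mod q = h w x mod q) \<and>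
     (\<forall>v. \<forall>w\<in>minor l v. idx' (g v) (g w) mod q = (idx v w + h v (low (l v))) mod q)"

text \<open>The only candidate for the image of a neighbour \<open>w\<close> of \<open>v\<close>
  under a leveled isomorphism that takes \<open>v\<close> to \<open>v'\<close> with germ
  \<open>h\<close>: a minor neighbour is rotated by the top germ entry, the major one is singled out
  by its level.\<close>

definition step_map ::
    "('v \<Rightarrow> int) \<Rightarrow> ('v \<Rightarrow> 'v \<Rightarrow> int) \<Rightarrow> ('v \<Rightarrow> int) \<Rightarrow> ('v \<Rightarrow> 'v \<Rightarrow> int) \<Rightarrow>
     'v \<Rightarrow> 'v \<Rightarrow> (nat \<Rightarrow> int) \<Rightarrow> 'v \<Rightarrow> 'v" where
  "step_map l idx l' idx' v v' h w =
     (if l w = mnr (l v) then inv_into (minor l' v') (idx' v') ((idx v w + h (low (l v))) mod q)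
      else (THE w'. w' \<in> nbrs v' \<and> l' w' = maj (l' v')))"

section \<open>Extending isomorphisms of leveled trees across edges\<close>

lemma nbrs_split:
  assumes "leveling l idx" "v \<in> V"
  shows "nbrs v = minor l v \<union> {THE w. w \<in> nbrs v \<and> l w = maj (l v)}"
    and "minor l v \<inter> {THE w. w \<in> nbrs v \<and> l w = maj (l v)} = {}"
proof -
  let ?M = "THE w. w \<in> nbrs v \<and> l w = maj (l v)"
  have M: "?M \<in> nbrs v \<and> l ?M = maj (l v)"
    by (rule theI'[OF levelingD(2)[OF assms]])
  moreover have "w = ?M" if "w \<in> nbrs v" "l w = maj (l v)" for w
    using levelingD(2)[OF assms] that M by blast
  ultimately show "nbrs v = minor l v \<union> {?M}" "minor l v \<inter> {?M} = {}"
    using levelingD(1)[OF assms(1), of _ v] maj_neq_mnr[of "l v"] by (auto simp: minor_def)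
qed

lemma step_map_bij:
  assumes S: "leveling l idx" and S': "leveling l' idx'"
    and v: "v \<in> V" "v' \<in> V" "l' v' = l v"
  shows "bij_betw (step_map l idx l' idx' v v' h) (nbrs v) (nbrs v')"
proof -
  let ?f = "step_map l idx l' idx' v v' h"
  let ?M = "THE w. w \<in> nbrs v \<and> l w = maj (l v)"
  let ?M' = "THE w. w \<in> nbrs v' \<and> l' w = maj (l' v')"
  have "bij_betw (inv_into (minor l' v') (idx' v') \<circ> ((\<lambda>x. (x + h (low (l v))) mod q) \<circ> idx v))
          (minor l v) (minor l' v')"
    using levelingD(3)[OF S v(1)] bij_betw_shift_mod[OF q_pos]
      bij_betw_inv_into[OF levelingD(3)[OF S' v(2)]]
    by (blast intro: bij_betw_trans)
  then have "bij_betw ?f (minor l v) (minor l' v')"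
    by (rule bij_betw_cong[THEN iffD1, rotated]) (auto simp: step_map_def minor_def)
  moreover have "l ?M = maj (l v)" using theI'[OF levelingD(2)[OF S v(1)]] by blast
  then have "bij_betw ?f {?M} {?M'}"
    using maj_neq_mnr[of "l v"] by (auto simp: step_map_def bij_betw_def)
  ultimately have "bij_betw ?f (minor l v \<union> {?M}) (minor l' v' \<union> {?M'})"
    using nbrs_split(2)[OF S' v(2)] by (rule bij_betw_combine)
  then show ?thesis using nbrs_split(1)[OF S v(1)] nbrs_split(1)[OF S' v(2)] by simp
qed

lemma step_map_level:
  assumes S: "leveling l idx" and S': "leveling l' idx'"
    and v: "v \<in> V" "v' \<in> V" "l' v' = l v" and w: "w \<in> nbrs v"
  shows "l' (step_map l idx l' idx' v v' h w) = l w"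
proof (cases "l w = mnr (l v)")
  case True
  have "(idx v w + h (low (l v))) mod q \<in> idx' v' ` minor l' v'"
    using levelingD(3)[OF S' v(2)] q_pos by (auto simp: bij_betw_def)
  then have "step_map l idx l' idx' v v' h w \<in> minor l' v'"
    using True inv_into_into[of _ "idx' v'" "minor l' v'"] by (simp add: step_map_def)
  then show ?thesis using True v by (simp add: minor_def)
next
  case False
  then have "l w = maj (l v)" using levelingD(1)[OF S w] by blast
  then show ?thesis using theI'[OF levelingD(2)[OF S' v(2)]] False v by (simp add: step_map_def)
qed

lemma step_map_idx:
  assumes S': "leveling l' idx'" and v': "v' \<in> V" and w: "l w = mnr (l v)"
  shows "idx' v' (step_map l idx l' idx' v v' h w) = (idx v w + h (low (l v))) mod q"
proof -
  have "(idx v w + h (low (l v))) mod q \<in> idx' v' ` minor l' v'"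
    using levelingD(3)[OF S' v'] q_pos by (auto simp: bij_betw_def)
  then show ?thesis using w by (simp add: step_map_def f_inv_into_f)
qed

text \<open>Image and germ at \<open>r\<close> are free because a tree has no cycles around which
  consistency could fail. This freedom is the source of the transitivity statements, both for the
  full automorphism group and for \<open>\<Gamma>\<close>.\<close>

lemma leveled_iso_exists:
  fixes h\<^sub>0 :: "nat \<Rightarrow> int"
  assumes S: "leveling l idx" and S': "leveling l' idx'"
    and r: "r \<in> V" "r' \<in> V" "l' r' = l r"
  obtains g h where "leveled_iso l idx l' idx' g h"
    "\<And>v. v \<in> V \<Longrightarrow> g v \<in> V" "\<And>v. v \<in> V \<Longrightarrow> bij_betw g (nbrs v) (nbrs (g v))" "g r = r'" "h r = h\<^sub>0"
proof -
  let ?step = "step_map l idx l' idx'"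
  (* The germ at u is that of its parent p, except that its entry at the height of the edge is
     forced: if p is a minor neighbour of u, this entry has to rotate p to the image of p. *)
  define f where "f = (\<lambda>u (v', h :: nat \<Rightarrow> int). let p = parent r u; u' = ?step p v' h u in
     (u', h(ht (l p) (l u) := idx' u' v' - idx u p)))"
  obtain F where F: "F r = (r', h\<^sub>0)"
    "\<And>v. v \<in> V \<Longrightarrow> v \<noteq> r \<Longrightarrow> F v = f v (F (parent r v))"
    using tree_recursion[OF r(1)] by metis
  define g where "g = fst \<circ> F"
  define h where "h = snd \<circ> F"
  have g_rec: "g u = ?step (parent r u) (g (parent r u)) (h (parent r u)) u"
    and h_rec: "h u = (h (parent r u))(ht (l (parent r u)) (l u) :=
                   idx' (g u) (g (parent r u)) - idx u (parent r u))"
    if "u \<in> V" "u \<noteq> r" for u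
    using F(2)[OF that] by (auto simp: g_def h_def f_def Let_def split: prod.splits)
  have lev: "g u \<in> V \<and> l' (g u) = l u" if "u \<in> V" for u
    using r(1) that
  proof (induction rule: dist_induct)
    case root
    then show ?case using F(1) r by (simp add: g_def)
  next
    case (step u)
    have u: "u \<in> nbrs (parent r u)" using step nbrs_sym by blast
    have "g u \<in> nbrs (g (parent r u))"
      using step_map_bij[OF S S', of "parent r u" "g (parent r u)"] step u g_rec[of u]
      by (auto simp: bij_betw_def)
    moreover have "l' (g u) = l u"
      using step_map_level[OF S S' _ _ _ u] step g_rec[of u] by simp
    ultimately show ?case using nbrs_in_V by blast
  qed
  \<comment> \<open>From parent to child this is the definition of \<open>g\<close>. From a child
    \<open>v\<close> to its parent \<open>w\<close> it has to be proved: if \<open>w\<close> is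
    minor, the overwritten germ entry is the top one and was chosen for this purpose; if
    \<open>w\<close> is major, its level singles it out, and the overwritten entry lies above the
    relevant ones.\<close>
  have g_step: "g w = ?step v (g v) (h v) w" if vw: "w \<in> nbrs v" for v w
    using nbr_cases[OF r(1) vw]
  proof (elim disjE conjE)
    assume "w \<noteq> r" "v = parent r w"
    then show ?thesis using g_rec nbrs_in_V vw by simp
  next
    assume v: "v \<noteq> r" "w = parent r v"
    have V: "v \<in> V" "w \<in> V" using nbrs_in_V vw by auto
    have wv: "v \<in> nbrs w" using vw nbrs_sym by blast
    have gvw: "g v \<in> nbrs (g w)"
      using step_map_bij[OF S S' V(2), of "g w"] lev V(2) wv g_rec[OF V(1) v(1)] v(2)
      by (auto simp: bij_betw_def)
    have B: "?step v (g v) (h v) w \<in> nbrs (g v)" "l' (?step v (g v) (h v) w) = l w"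
      using step_map_bij[OF S S' V(1), of "g v"] lev V(1) vw step_map_level[OF S S' V(1) _ _ vw]
      by (auto simp: bij_betw_def)
    show ?thesis
    proof (cases "l w = mnr (l v)")
      case True
      have "h v (low (l v)) = idx' (g v) (g w) - idx v w"
        using h_rec[OF V(1) v(1)] v(2) True ht_mnr[of "l v"] ht_sym by simp
      then have "idx' (g v) (?step v (g v) (h v) w) mod q = idx' (g v) (g w) mod q"
        using step_map_idx[OF S' _ True] lev[OF V(1)] by simp
      moreover have "?step v (g v) (h v) w \<in> minor l' (g v)" "g w \<in> minor l' (g v)"
        using B True lev V gvw nbrs_sym by (auto simp: minor_def)
      ultimately show ?thesis
        using idx_cong_imp_eq[OF S', of "g v" "g w" "?step v (g v) (h v) w"] lev[OF V(1)] by simp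
    next
      case False
      then have "l w = maj (l v)" using levelingD(1)[OF S vw] by blast
      moreover have "g w \<in> nbrs (g v)" using gvw nbrs_sym by blast
      ultimately show ?thesis
        using levelingD(2)[OF S', of "g v"] B lev V by (metis (no_types, lifting))
    qed
  qed
  have "bij_betw g (nbrs v) (nbrs (g v))" if "v \<in> V" for v
    using step_map_bij[OF S S' that, of "g v" "h v"] lev[OF that]
      bij_betw_cong[of "nbrs v" g "?step v (g v) (h v)" "nbrs (g v)"] g_step by blast
  moreover have "leveled_iso l idx l' idx' g h"
    unfolding leveled_iso_def
  proof (intro conjI ballI allI impI)
    fix v w x assume vw: "w \<in> nbrs v" and x: "x < ht (l v) (l w)"
    have "h v x = h w x"
      using nbr_cases[OF r(1) vw]
    proof (elim disjE conjE)
      assume "w \<noteq> r" "v = parent r w"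
      then show ?thesis using h_rec[of w] x nbrs_in_V(1)[OF vw] by simp
    next
      assume "v \<noteq> r" "w = parent r v"
      then show ?thesis using h_rec[of v] x nbrs_in_V(2)[OF vw] ht_sym[of "l v"] by simp
    qed
    then show "h v x mod q = h w x mod q" by simp
  next
    fix v w assume w: "w \<in> minor l v"
    then have "v \<in> V" "w \<in> nbrs v" "l w = mnr (l v)" using nbrs_in_V by (auto simp: minor_def)
    then show "idx' (g v) (g w) mod q = (idx v w + h v (low (l v))) mod q"
      using g_step step_map_idx[OF S'] lev by simp
  qed (use lev in auto)
  ultimately show thesis
    using that[of g h] lev F(1) by (auto simp: g_def h_def)
qed

text \<open>Every vertex \<open>v\<close> gets a preferred child \<open>c v\<close>. If the parent
  is not already the major neighbour of \<open>v\<close>, this role goes to \<open>c v\<close>; all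
  remaining neighbours are minor.\<close>

lemma leveling_exists:
  assumes s: "s \<in> nbrs r"
  obtains l idx where "leveling l idx" "l r = 0" "l s = maj 0"
proof -
  have r: "r \<in> V" using s nbrs_in_V by blast
  have "\<exists>c. c \<in> nbrs v \<and> (v \<noteq> r \<longrightarrow> c \<noteq> parent r v) \<and> (v = r \<longrightarrow> c = s)" if "v \<in> V" for v
  proof (cases "v = r")
    case False
    have "\<not> nbrs v \<subseteq> {parent r v}"
      using card_nbrs[OF that] card_mono[of "{parent r v}" "nbrs v"] k_gt_2 by auto
    then show ?thesis using False by auto
  qed (use s in auto)
  then obtain c where c: "\<And>v. v \<in> V \<Longrightarrow> c v \<in> nbrs v"
    "\<And>v. v \<in> V \<Longrightarrow> v \<noteq> r \<Longrightarrow> c v \<noteq> parent r v" "c r = s"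
    using r by metis
  \<comment> \<open>The recursion carries the level of a vertex together with that of its parent,
    since the level of \<open>u\<close> depends on whether the grandparent is the major neighbour of
    the parent.\<close>
  define f where "f = (\<lambda>u (i, j). (if j \<noteq> maj i \<and> u = c (parent r u) then maj i else mnr i, i))"
  \<comment> \<open>\<open>mnr 0\<close> is a fictitious parent level at the root; it leaves the
    major place to \<open>c r = s\<close>.\<close>
  obtain F where F: "F r = (0, mnr 0)"
    "\<And>v. v \<in> V \<Longrightarrow> v \<noteq> r \<Longrightarrow> F v = f v (F (parent r v))"
    using tree_recursion[OF r] by metis
  define l where "l = fst \<circ> F"
  have snd_F: "snd (F v) = l (parent r v)" if "v \<in> V" "v \<noteq> r" for v
    using F(2)[OF that] by (auto simp: l_def f_def split: prod.splits)
  have l_child: "l w = (if (v = r \<or> l (parent r v) \<noteq> maj (l v)) \<and> w = c v then maj (l v) else mnr (l v))"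
    if "w \<in> nbrs v" "w \<noteq> r" "v = parent r w" for v w
  proof (cases "v = r")
    case True
    then show ?thesis
      using F that nbrs_in_V maj_neq_mnr[of 0] by (auto simp: l_def f_def)
  next
    case False
    then show ?thesis
      using F(2)[of w] snd_F[of v] that nbrs_in_V
      by (auto simp: l_def f_def split: prod.splits)
  qed
  have adj: "l w = maj (l v) \<or> l w = mnr (l v)" if wv: "w \<in> nbrs v" for v w
    using nbr_cases[OF r wv]
  proof (elim disjE conjE)
    {
      assume "w \<noteq> r" "v = parent r w"
      then show ?thesis using l_child wv by auto
    next
      assume "v \<noteq> r" "w = parent r v"
      then have "l v = maj (l w) \<or> l v = mnr (l w)" using l_child[of v w] wv nbrs_sym by auto
      then show ?thesis unfolding maj_or_mnr_iff by auto
    }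
  qed
  have uniq: "\<exists>!w. w \<in> nbrs v \<and> l w = maj (l v)" if v: "v \<in> V" for v
  proof (cases "v \<noteq> r \<and> l (parent r v) = maj (l v)")
    case True
    have "l w = mnr (l v)" if "w \<in> nbrs v" "w \<noteq> parent r v" for w
      using nbr_cases[OF r that(1)] that l_child[of w v] True by auto
    then show ?thesis
      using True parent(1)[OF r v] maj_neq_mnr[of "l v"] by metis
  next
    case False
    have cv: "c v \<noteq> r \<and> v = parent r (c v)"
      using nbr_cases[OF r c(1)[OF v]] c(2)[OF v] by blast
    have "w = c v" if w: "w \<in> nbrs v" "l w = maj (l v)" for w
    proof -
      have "\<not> (v \<noteq> r \<and> w = parent r v)" using False w by auto
      then have "w \<noteq> r \<and> v = parent r w" using nbr_cases[OF r w(1)] by blast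
      then have "l w = (if (v = r \<or> l (parent r v) \<noteq> maj (l v)) \<and> w = c v
          then maj (l v) else mnr (l v))" using l_child[OF w(1)] by blast
      then show ?thesis using w(2) maj_neq_mnr[of "l v"] by (simp split: if_splits)
    qed
    moreover have "l (c v) = maj (l v)"
    proof -
      have "l (c v) = (if (v = r \<or> l (parent r v) \<noteq> maj (l v)) \<and> c v = c v
          then maj (l v) else mnr (l v))" using l_child[OF c(1)[OF v]] cv by blast
      then show ?thesis using False by simp
    qed
    ultimately show ?thesis using c(1)[OF v] by blast
  qed
  have "\<exists>f. bij_betw f (minor l v) {0..<q}" if v: "v \<in> V" for v
  proof -
    obtain m where m: "m \<in> nbrs v" "l m = maj (l v)" "\<And>w. w \<in> nbrs v \<Longrightarrow> l w = maj (l v) \<Longrightarrow> w = m"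
      using uniq[OF v] by blast
    have "minor l v = nbrs v - {m}"
    proof (intro equalityI subsetI)
      fix w assume "w \<in> minor l v"
      then show "w \<in> nbrs v - {m}" using m(2) maj_neq_mnr[of "l v"] by (auto simp: minor_def)
    next
      fix w assume "w \<in> nbrs v - {m}"
      then show "w \<in> minor l v" using m(3) adj[of w v] by (auto simp: minor_def)
    qed
    then have "card (minor l v) = k - 1" "finite (minor l v)"
      using card_nbrs[OF v] finite_nbrs[OF v] m(1) by auto
    then show ?thesis using bij_betw_iff_card[of "minor l v" "{0..<q}"] k_gt_2 by auto
  qed
  then obtain idx where "\<And>v. v \<in> V \<Longrightarrow> bij_betw (idx v) (minor l v) {0..<q}" by metis
  then have "leveling l idx" using adj uniq by (simp add: leveling_def)
  moreover have "l r = 0" using F by (simp add: l_def)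
  moreover have "l s = maj 0"
  proof -
    have "s \<noteq> r" using s nbrs_irrefl by auto
    moreover have "r = parent r s"
      using nbr_cases[OF r s] by blast
    ultimately have "l s = (if (r = r \<or> l (parent r r) \<noteq> maj (l r)) \<and> s = c r
          then maj (l r) else mnr (l r))" using l_child[OF s] by blast
    then show ?thesis using c(3) \<open>l r = 0\<close> by simp
  qed
  ultimately show thesis by (rule that)
qed

end

section \<open>The automorphism group of a regular tree\<close>

context regular_tree_graph
begin

abbreviation G :: "('v \<Rightarrow> 'v) monoid" where "G \<equiv> aut_group V E"
abbreviation T :: "('v \<Rightarrow> 'v) topology" where "T \<equiv> aut_topology V E"
abbreviation gmult :: "('v \<Rightarrow> 'v) \<Rightarrow> ('v \<Rightarrow> 'v) \<Rightarrow> 'v \<Rightarrow> 'v" (infixl "\<cdot>" 70)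
  where "g \<cdot> h \<equiv> g \<otimes>\<^bsub>G\<^esub> h"
abbreviation ginv :: "('v \<Rightarrow> 'v) \<Rightarrow> 'v \<Rightarrow> 'v" where "ginv g \<equiv> inv\<^bsub>G\<^esub> g"

lemma carrier_G: "carrier G = {f \<in> Bij V. \<forall>u\<in>V. \<forall>v\<in>V. (f u, f v) \<in> E \<longleftrightarrow> (u, v) \<in> E}"
  by (simp add: aut_group_def)

lemma aut_bij: "g \<in> carrier G \<Longrightarrow> bij_betw g V V"
  and aut_extensional: "g \<in> carrier G \<Longrightarrow> g \<in> extensional V"
  and aut_edge: "g \<in> carrier G \<Longrightarrow> u \<in> V \<Longrightarrow> v \<in> V \<Longrightarrow> (g u, g v) \<in> E \<longleftrightarrow> (u, v) \<in> E"
  by (auto simp: carrier_G Bij_def)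

lemma aut_in_V: "g \<in> carrier G \<Longrightarrow> v \<in> V \<Longrightarrow> g v \<in> V"
  using aut_bij bij_betwE by blast

lemma aut_inj: "g \<in> carrier G \<Longrightarrow> u \<in> V \<Longrightarrow> v \<in> V \<Longrightarrow> g u = g v \<longleftrightarrow> u = v"
  using aut_bij by (auto simp: bij_betw_def inj_on_def)

lemma aut_ext: "g \<in> carrier G \<Longrightarrow> g' \<in> carrier G \<Longrightarrow> (\<And>v. v \<in> V \<Longrightarrow> g v = g' v) \<Longrightarrow> g = g'"
  using aut_extensional extensionalityI by blast

lemma aut_subgroup: "subgroup (carrier G) (BijGroup V)"
proof (rule group.subgroupI[OF group_BijGroup])
  show "carrier G \<subseteq> carrier (BijGroup V)" by (auto simp: carrier_G BijGroup_def)
  have "(\<lambda>v\<in>V. v) \<in> carrier G" by (auto simp: carrier_G id_Bij)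
  then show "carrier G \<noteq> {}" by blast
next
  fix f assume f: "f \<in> carrier G"
  then have "f \<in> Bij V" by (simp add: carrier_G)
  moreover have "(inv_into V f u, inv_into V f v) \<in> E \<longleftrightarrow> (u, v) \<in> E" if "u \<in> V" "v \<in> V" for u v
    using aut_edge[OF f, of "inv_into V f u" "inv_into V f v"] aut_bij[OF f] that
      Bij_inv_into_mem[OF \<open>f \<in> Bij V\<close>]
    by (simp add: bij_betw_def f_inv_into_f)
  ultimately show "inv\<^bsub>BijGroup V\<^esub> f \<in> carrier G"
    by (simp add: inv_BijGroup carrier_G restrict_inv_into_Bij)
next
  fix f g assume fg: "f \<in> carrier G" "g \<in> carrier G"
  then show "f \<otimes>\<^bsub>BijGroup V\<^esub> g \<in> carrier G"
    using aut_in_V[OF fg(2)] aut_edge[OF fg(1)] aut_edge[OF fg(2)]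
    by (simp add: carrier_G BijGroup_def compose_Bij compose_eq)
qed

lemma group_G: "group G"
  using group.subgroup_imp_group[OF group_BijGroup aut_subgroup] by (simp add: aut_group_def)

sublocale G: group G by (rule group_G)

lemma mult_apply:
  "g \<in> carrier G \<Longrightarrow> h \<in> carrier G \<Longrightarrow> v \<in> V \<Longrightarrow> (g \<cdot> h) v = g (h v)"
  by (auto simp: aut_group_def BijGroup_def compose_eq)

lemma one_apply: "v \<in> V \<Longrightarrow> \<one>\<^bsub>G\<^esub> v = v"
  by (simp add: aut_group_def BijGroup_def)

lemma inv_apply: "g \<in> carrier G \<Longrightarrow> v \<in> V \<Longrightarrow> (ginv g) (g v) = v"
  and apply_inv: "g \<in> carrier G \<Longrightarrow> v \<in> V \<Longrightarrow> g ((ginv g) v) = v"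
  using mult_apply[of "ginv g" g v] mult_apply[of g "ginv g" v] one_apply[of v] by simp_all

lemma aut_nbrs: "g \<in> carrier G \<Longrightarrow> v \<in> V \<Longrightarrow> bij_betw g (nbrs v) (nbrs (g v))"
  unfolding bij_betw_def
proof
  assume g: "g \<in> carrier G" and v: "v \<in> V"
  show "inj_on g (nbrs v)" using aut_inj[OF g] nbrs_in_V by (auto simp: inj_on_def)
  have "w \<in> g ` nbrs v" if w: "w \<in> nbrs (g v)" for w
  proof -
    have "w = g ((ginv g) w)" "(ginv g) w \<in> V"
      using apply_inv[OF g] aut_in_V G.inv_closed[OF g] nbrs_in_V(1)[OF w] by simp_all
    then show ?thesis using w aut_edge[OF g v] by (metis image_eqI mem_Collect_eq nbrs_def)
  qed
  moreover have "g w \<in> nbrs (g v)" if "w \<in> nbrs v" for w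
    using that aut_edge[OF g v] nbrs_in_V by (auto simp: nbrs_def)
  ultimately show "g ` nbrs v = nbrs (g v)" by blast
qed

lemma aut_nbr_iff: "g \<in> carrier G \<Longrightarrow> u \<in> V \<Longrightarrow> v \<in> V \<Longrightarrow> g u \<in> nbrs (g v) \<longleftrightarrow> u \<in> nbrs v"
  by (simp add: nbrs_def aut_edge)

lemma aut_dist: "g \<in> carrier G \<Longrightarrow> u \<in> V \<Longrightarrow> v \<in> V \<Longrightarrow> gdist (g u) (g v) = gdist u v"
  using local_bijection_dist[of g] aut_in_V aut_nbrs by blast

lemma local_bijection_aut:
  assumes g: "\<And>v. v \<in> V \<Longrightarrow> g v \<in> V" "\<And>v. v \<in> V \<Longrightarrow> bij_betw g (nbrs v) (nbrs (g v))"
  shows "restrict g V \<in> carrier G"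
  using local_bijection_bij[of g, OF g] local_bijection_edge_iff[of g, OF g]
  by (auto simp: carrier_G Bij_def)

text \<open>Levelings can be chosen so that \<open>w\<close> and \<open>w'\<close> are the major
  neighbours of \<open>v\<close> and \<open>v'\<close>; a leveled isomorphism then matches them. Any
  admissible heights serve, here those alternating between 0 and 1.\<close>

lemma arc_transitive:
  assumes "w \<in> nbrs v" "w' \<in> nbrs v'"
  obtains g where "g \<in> carrier G" "g v = v'" "g w = w'"
proof -
  interpret L: leveled_tree k V E "\<lambda>i. if even i then 0 else 1"
    by unfold_locales auto
  obtain l idx where S: "L.leveling l idx" "l v = 0" "l w = L.maj 0"
    using L.leveling_exists[OF assms(1)] .
  obtain l' idx' where S': "L.leveling l' idx'" "l' v' = 0" "l' w' = L.maj 0"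
    using L.leveling_exists[OF assms(2)] .
  have v: "v \<in> V" "w \<in> V" "v' \<in> V" using assms nbrs_in_V by auto
  have lv: "l' v' = l v" using S(2) S'(2) by simp
  obtain g h where gh: "L.leveled_iso l idx l' idx' g h"
    "\<And>v. v \<in> V \<Longrightarrow> g v \<in> V" "\<And>v. v \<in> V \<Longrightarrow> bij_betw g (nbrs v) (nbrs (g v))" "g v = v'"
    by (rule L.leveled_iso_exists[OF S(1) S'(1) v(1,3) lv, of "\<lambda>_. 0"]) blast
  have "g w \<in> nbrs v'" using gh(3)[OF v(1)] gh(4) assms(1) by (auto simp: bij_betw_def)
  moreover have "l' (g w) = L.maj 0" using gh(1) S(3) v(2) by (simp add: L.leveled_iso_def)
  ultimately have "g w = w'" using L.levelingD(2)[OF S'(1) v(3)] S' assms(2) by metis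
  then show thesis using that[of "restrict g V"] local_bijection_aut[of g] gh v by auto
qed

lemma nbr_exists: "v \<in> V \<Longrightarrow> \<exists>w. w \<in> nbrs v"
  using card_nbrs[of v] k_gt_2 by (metis card.empty equals0I not_less_zero)

lemma vertex_transitive:
  assumes "v \<in> V" "v' \<in> V"
  obtains g where "g \<in> carrier G" "g v = v'"
  using nbr_exists[OF assms(1)] nbr_exists[OF assms(2)] arc_transitive by metis

subsection \<open>The topology of pointwise convergence\<close>

lemma openin_pointwise:
  "openin (product_topology (\<lambda>_. discrete_topology V) V) U \<longleftrightarrow>
     U \<subseteq> PiE V (\<lambda>_. V) \<and> (\<forall>f\<in>U. \<exists>F. finite F \<and> F \<subseteq> V \<and>
        (\<forall>f'\<in>PiE V (\<lambda>_. V). (\<forall>v\<in>F. f' v = f v) \<longrightarrow> f' \<in> U))"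
  (is "?L \<longleftrightarrow> ?R")
proof
  assume L: ?L
  then have "U \<subseteq> PiE V (\<lambda>_. V)" using openin_subset by fastforce
  moreover have "\<exists>F. finite F \<and> F \<subseteq> V \<and> (\<forall>f'\<in>PiE V (\<lambda>_. V). (\<forall>v\<in>F. f' v = f v) \<longrightarrow> f' \<in> U)"
    if "f \<in> U" for f
  proof -
    have "\<exists>W. finite {i \<in> V. W i \<noteq> topspace (discrete_topology V)} \<and>
        (\<forall>i\<in>V. openin (discrete_topology V) (W i)) \<and> f \<in> PiE V W \<and> PiE V W \<subseteq> U"
      using L that unfolding openin_product_topology_alt by blast
    then obtain W where W: "finite {i \<in> V. W i \<noteq> V}" "f \<in> PiE V W" "PiE V W \<subseteq> U"
      by auto
    have "f' \<in> PiE V W" if "f' \<in> PiE V (\<lambda>_. V)" "\<forall>v\<in>{i \<in> V. W i \<noteq> V}. f' v = f v" for f'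
      using that W(2) by (auto simp: PiE_iff)
    then show ?thesis using W by (intro exI[of _ "{i \<in> V. W i \<noteq> V}"]) blast
  qed
  ultimately show ?R by blast
next
  assume R: ?R
  show ?L
    unfolding openin_product_topology_alt
  proof
    fix f assume f: "f \<in> U"
    then obtain F where F: "finite F" "F \<subseteq> V"
      "\<And>f'. f' \<in> PiE V (\<lambda>_. V) \<Longrightarrow> \<forall>v\<in>F. f' v = f v \<Longrightarrow> f' \<in> U"
      using R by metis
    let ?W = "\<lambda>v. if v \<in> F then {f v} else V"
    have "f \<in> PiE V (\<lambda>_. V)" using R f by blast
    then have "f \<in> PiE V ?W" "\<And>i. i \<in> V \<Longrightarrow> ?W i \<subseteq> V" by (auto simp: PiE_iff)
    moreover have "PiE V ?W \<subseteq> U"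
    proof
      fix f' assume f': "f' \<in> PiE V ?W"
      have "\<forall>v\<in>F. f' v = f v" using f' F(2) by (auto simp: PiE_iff split: if_splits)
      moreover have "f' \<in> PiE V (\<lambda>_. V)"
        using f' \<open>\<And>i. i \<in> V \<Longrightarrow> ?W i \<subseteq> V\<close> PiE_mono[of V ?W "\<lambda>_. V"] by blast
      ultimately show "f' \<in> U" using F(3) by blast
    qed
    moreover have "finite {i \<in> V. ?W i \<noteq> topspace (discrete_topology V)}"
      by (rule finite_subset[OF _ F(1)]) auto
    ultimately show "\<exists>W. finite {i \<in> V. W i \<noteq> topspace (discrete_topology V)} \<and>
        (\<forall>i\<in>V. openin (discrete_topology V) (W i)) \<and> f \<in> PiE V W \<and> PiE V W \<subseteq> U"
      by (intro exI[of _ ?W]) simp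
  qed
qed

lemma aut_PiE: "g \<in> carrier G \<Longrightarrow> g \<in> PiE V (\<lambda>_. V)"
  using aut_in_V aut_extensional by (auto simp: PiE_iff)

lemma topspace_T: "topspace T = carrier G"
  using aut_PiE by (auto simp: aut_topology_def)

text \<open>For \<open>F\<close> inside \<open>V\<close> these are the unions of left cosets of the
  pointwise fixer of \<open>F\<close>; they are clopen if \<open>F\<close> is finite.\<close>

definition saturated :: "'v set \<Rightarrow> ('v \<Rightarrow> 'v) set \<Rightarrow> bool" where
  "saturated F U \<longleftrightarrow> U \<subseteq> carrier G \<and> (\<forall>g\<in>U. \<forall>g'\<in>carrier G. (\<forall>v\<in>F. g' v = g v) \<longrightarrow> g' \<in> U)"

lemma openin_T:
  "openin T U \<longleftrightarrow> U \<subseteq> carrier G \<and> (\<forall>g\<in>U. \<exists>F. finite F \<and> F \<subseteq> V \<and>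
     (\<forall>g'\<in>carrier G. (\<forall>v\<in>F. g' v = g v) \<longrightarrow> g' \<in> U))"
  (is "?L \<longleftrightarrow> ?R")
proof
  assume ?L
  then obtain W where W: "openin (product_topology (\<lambda>_. discrete_topology V) V) W"
    "U = W \<inter> carrier G"
    by (auto simp: aut_topology_def openin_subtopology)
  show ?R
  proof (intro conjI ballI)
    fix g assume "g \<in> U"
    then obtain F where "finite F" "F \<subseteq> V" "\<forall>f'\<in>PiE V (\<lambda>_. V). (\<forall>v\<in>F. f' v = g v) \<longrightarrow> f' \<in> W"
      using W unfolding openin_pointwise by blast
    then show "\<exists>F. finite F \<and> F \<subseteq> V \<and> (\<forall>g'\<in>carrier G. (\<forall>v\<in>F. g' v = g v) \<longrightarrow> g' \<in> U)"
      using W(2) aut_PiE by (intro exI[of _ F]) auto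
  qed (use W in auto)
next
  assume R: ?R
  define nice where "nice = (\<lambda>g F. finite F \<and> F \<subseteq> V \<and>
    (\<forall>g'\<in>carrier G. (\<forall>v\<in>F. g' v = g v) \<longrightarrow> g' \<in> U))"
  have niceD: "finite F" "F \<subseteq> V" "g' \<in> carrier G \<Longrightarrow> \<forall>v\<in>F. g' v = g v \<Longrightarrow> g' \<in> U"
    if "nice g F" for g F g'
    using that by (auto simp: nice_def)
  \<comment> \<open>Each \<open>g\<close> in \<open>U\<close> is thickened to a cylinder of the full
    product; the union is open and has trace \<open>U\<close> on the group.\<close>
  define W where "W = {f \<in> PiE V (\<lambda>_. V). \<exists>g\<in>U. \<exists>F. nice g F \<and> (\<forall>v\<in>F. f v = g v)}"
  have "openin (product_topology (\<lambda>_. discrete_topology V) V) W"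
    unfolding openin_pointwise
  proof (intro conjI ballI)
    fix f assume "f \<in> W"
    then obtain g F where g: "g \<in> U" "nice g F" "\<forall>v\<in>F. f v = g v" by (auto simp: W_def)
    then have "\<forall>f'\<in>PiE V (\<lambda>_. V). (\<forall>v\<in>F. f' v = f v) \<longrightarrow> f' \<in> W"
      unfolding W_def by auto
    then show "\<exists>F. finite F \<and> F \<subseteq> V \<and> (\<forall>f'\<in>PiE V (\<lambda>_. V). (\<forall>v\<in>F. f' v = f v) \<longrightarrow> f' \<in> W)"
      using niceD(1,2)[OF g(2)] by blast
  qed (auto simp: W_def)
  moreover have "U = W \<inter> carrier G"
  proof (intro equalityI subsetI)
    fix g assume g: "g \<in> U"
    then obtain F where "nice g F" using R unfolding nice_def by blast
    then show "g \<in> W \<inter> carrier G" using R g aut_PiE unfolding W_def by auto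
  next
    fix g assume "g \<in> W \<inter> carrier G"
    then show "g \<in> U" using niceD(3) unfolding W_def by auto
  qed
  ultimately show ?L by (auto simp: aut_topology_def openin_subtopology)
qed

lemma saturatedD: "saturated F U \<Longrightarrow> g \<in> U \<Longrightarrow> g' \<in> carrier G \<Longrightarrow> (\<And>v. v \<in> F \<Longrightarrow> g' v = g v) \<Longrightarrow> g' \<in> U"
  and saturated_subset: "saturated F U \<Longrightarrow> U \<subseteq> carrier G"
  by (auto simp: saturated_def)

lemma saturated_open: "saturated F U \<Longrightarrow> finite F \<Longrightarrow> F \<subseteq> V \<Longrightarrow> openin T U"
  unfolding openin_T
proof (intro conjI ballI)
  fix g assume "saturated F U" "finite F" "F \<subseteq> V" "g \<in> U"
  then show "\<exists>F. finite F \<and> F \<subseteq> V \<and> (\<forall>g'\<in>carrier G. (\<forall>v\<in>F. g' v = g v) \<longrightarrow> g' \<in> U)"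
    by (intro exI[of _ F]) (auto intro: saturatedD)
qed (rule saturated_subset)

lemma saturated_compl: "saturated F U \<Longrightarrow> saturated F (carrier G - U)"
  unfolding saturated_def by auto

lemma saturated_closed: "saturated F U \<Longrightarrow> finite F \<Longrightarrow> F \<subseteq> V \<Longrightarrow> closedin T U"
  using saturated_open[OF saturated_compl] by (simp add: closedin_def topspace_T saturated_def)

lemma open_vertex_condition: "v \<in> V \<Longrightarrow> openin T {g \<in> carrier G. P (g v)}"
  by (rule saturated_open[of "{v}"]) (auto simp: saturated_def)

lemma continuous_mult: "continuous_map (prod_topology T T) T (\<lambda>(x, y). x \<cdot> y)"
  unfolding continuous_map_def
proof (intro conjI allI impI)
  fix U assume U: "openin T U"
  show "openin (prod_topology T T) {p \<in> topspace (prod_topology T T). (case p of (x, y) \<Rightarrow> x \<cdot> y) \<in> U}"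
    unfolding openin_prod_topology_alt
  proof (intro allI impI)
    fix x y
    assume "(x, y) \<in> {p \<in> topspace (prod_topology T T). (case p of (x, y) \<Rightarrow> x \<cdot> y) \<in> U}"
    then have xy: "x \<in> carrier G" "y \<in> carrier G" "x \<cdot> y \<in> U"
      by (auto simp: topspace_T)
    then obtain F where F: "finite F" "F \<subseteq> V"
      "\<And>g'. g' \<in> carrier G \<Longrightarrow> \<forall>v\<in>F. g' v = (x \<cdot> y) v \<Longrightarrow> g' \<in> U"
      using U unfolding openin_T by metis
    let ?A = "{g \<in> carrier G. \<forall>v\<in>y ` F. g v = x v}" and ?B = "{g \<in> carrier G. \<forall>v\<in>F. g v = y v}"
    have "openin T ?A"
      by (rule saturated_open[of "y ` F"]) (use F xy aut_in_V in \<open>auto simp: saturated_def\<close>)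
    moreover have "openin T ?B"
      by (rule saturated_open[of F]) (use F in \<open>auto simp: saturated_def\<close>)
    moreover have "x' \<cdot> y' \<in> U" if "x' \<in> ?A" "y' \<in> ?B" for x' y'
      using that F(2) xy by (intro F(3)) (auto simp: mult_apply subset_iff)
    ultimately show "\<exists>A B. openin T A \<and> openin T B \<and> x \<in> A \<and> y \<in> B \<and>
        A \<times> B \<subseteq> {p \<in> topspace (prod_topology T T). (case p of (x, y) \<Rightarrow> x \<cdot> y) \<in> U}"
      using xy by (intro exI[of _ ?A] exI[of _ ?B]) (auto simp: topspace_T)
  qed
qed (auto simp: topspace_T)

lemma
  assumes "x \<in> carrier G"
  shows continuous_left_translation: "continuous_map T T (\<lambda>g. x \<cdot> g)"
    and continuous_right_translation: "continuous_map T T (\<lambda>g. g \<cdot> x)"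
proof -
  have "continuous_map T (prod_topology T T) (\<lambda>g. (x, g))"
    "continuous_map T (prod_topology T T) (\<lambda>g. (g, x))"
    using assms by (auto simp: continuous_map_paired topspace_T)
  from this[THEN continuous_map_compose, OF continuous_mult]
  show "continuous_map T T (\<lambda>g. x \<cdot> g)" "continuous_map T T (\<lambda>g. g \<cdot> x)"
    by (simp_all add: o_def)
qed

lemma continuous_inv: "continuous_map T T (\<lambda>x. ginv x)"
  unfolding continuous_map_def
proof (intro conjI allI impI)
  fix U assume U: "openin T U"
  show "openin T {g \<in> topspace T. ginv g \<in> U}"
    unfolding openin_T
  proof (intro conjI ballI)
    fix g assume "g \<in> {g \<in> topspace T. ginv g \<in> U}"
    then have g: "g \<in> carrier G" "ginv g \<in> carrier G" "ginv g \<in> U" by (auto simp: topspace_T)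
    then obtain F where F: "finite F" "F \<subseteq> V"
      "\<And>g'. g' \<in> carrier G \<Longrightarrow> \<forall>v\<in>F. g' v = (ginv g) v \<Longrightarrow> g' \<in> U"
      using U unfolding openin_T by metis
    have "ginv g' \<in> U" if g': "g' \<in> carrier G" "\<forall>v\<in>(ginv g) ` F. g' v = g v" for g'
    proof (rule F(3))
      show "\<forall>v\<in>F. (ginv g') v = (ginv g) v"
      proof
        fix v assume v: "v \<in> F"
        then have "g' ((ginv g) v) = v" using g' apply_inv[OF g(1)] F(2) by auto
        then show "(ginv g') v = (ginv g) v"
          using inv_apply[OF g'(1), of "(ginv g) v"] aut_in_V[OF g(2)] F(2) v by auto
      qed
    qed (use g' in auto)
    then show "\<exists>F. finite F \<and> F \<subseteq> V \<and> (\<forall>g'\<in>carrier G. (\<forall>v\<in>F. g' v = g v) \<longrightarrow>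
        g' \<in> {g \<in> topspace T. ginv g \<in> U})"
      using F aut_in_V[OF g(2)]
      by (intro exI[of _ "(ginv g) ` F"]) (auto simp: topspace_T)
  qed (auto simp: topspace_T)
qed (auto simp: topspace_T)

lemma Hausdorff_T: "Hausdorff_space T"
  unfolding Hausdorff_space_def
proof (intro allI impI)
  fix g g' assume "g \<in> topspace T \<and> g' \<in> topspace T \<and> g \<noteq> g'"
  then have g: "g \<in> carrier G" "g' \<in> carrier G" "g \<noteq> g'" by (auto simp: topspace_T)
  then obtain v where v: "v \<in> V" "g v \<noteq> g' v" using aut_ext by blast
  then show "\<exists>U W. openin T U \<and> openin T W \<and> g \<in> U \<and> g' \<in> W \<and> disjnt U W"
    using g open_vertex_condition[OF v(1), of "\<lambda>w. w = g v"]
      open_vertex_condition[OF v(1), of "\<lambda>w. w = g' v"]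
    by (intro exI[of _ "{h \<in> carrier G. h v = g v}"] exI[of _ "{h \<in> carrier G. h v = g' v}"])
       (auto simp: disjnt_iff)
qed

definition stab :: "'v \<Rightarrow> ('v \<Rightarrow> 'v) set" where
  "stab v = {g \<in> carrier G. g v = v}"

text \<open>Surjectivity is automatic: an injective map that fixes \<open>v\<close> and preserves
  edges sends each finite ball around \<open>v\<close> into itself, hence onto itself. What remains
  are conditions on finitely many coordinates each, which makes the stabilizer closed in the product
  of discrete spaces.\<close>

lemma stab_eq:
  assumes v: "v \<in> V"
  shows "stab v = {f \<in> PiE V (\<lambda>_. V). f v = v \<and>
    (\<forall>u\<in>V. \<forall>w\<in>V. ((f u, f w) \<in> E \<longleftrightarrow> (u, w) \<in> E) \<and> (f u = f w \<longrightarrow> u = w))}" (is "_ = ?R")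
    and "stab v \<subseteq> PiE V (\<lambda>u. {w \<in> V. gdist v w \<le> gdist v u})"
proof -
  show "stab v = ?R"
  proof (intro equalityI subsetI)
    fix f assume "f \<in> stab v"
    then show "f \<in> ?R" using aut_PiE aut_edge aut_inj by (auto simp: stab_def)
  next
    fix f assume "f \<in> ?R"
    then have f: "f \<in> PiE V (\<lambda>_. V)" "f v = v" "inj_on f V"
      "\<And>u w. u \<in> V \<Longrightarrow> w \<in> V \<Longrightarrow> (f u, f w) \<in> E \<longleftrightarrow> (u, w) \<in> E"
      by (auto simp: inj_on_def)
    have fV: "f u \<in> V" if "u \<in> V" for u using f(1) that by (rule PiE_mem)
    have dist: "gdist v (f u) \<le> gdist v u" if "u \<in> V" for u
      using v that
    proof (induction rule: dist_induct)
      case (step u)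
      then have "f u \<in> nbrs (f (parent v u))" using f(4) nbrs_sym by (auto simp: nbrs_def)
      then show ?case
        using gdist_nbr_le[OF v, of "f u" "f (parent v u)"] parent(2)[OF v step(1,2)] step by simp
    qed (simp add: f(2))
    have "f ` V = V"
    proof (intro equalityI subsetI)
      fix w assume w: "w \<in> V"
      let ?B = "{u \<in> V. gdist v u \<le> gdist v w}"
      have "f ` ?B \<subseteq> ?B" using fV dist order_trans by blast
      moreover have "inj_on f ?B" using f(3) by (rule inj_on_subset) auto
      ultimately have "f ` ?B = ?B" using finite_ball[OF v] endo_inj_surj by blast
      then show "w \<in> f ` V" using w by blast
    qed (use fV in auto)
    then show "f \<in> stab v"
      using f by (auto simp: stab_def carrier_G Bij_def bij_betw_def PiE_iff)
  qed
  show "stab v \<subseteq> PiE V (\<lambda>u. {w \<in> V. gdist v w \<le> gdist v u})"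
  proof
    fix g assume "g \<in> stab v"
    then have g: "g \<in> carrier G" "g v = v" by (auto simp: stab_def)
    have "g u \<in> {w \<in> V. gdist v w \<le> gdist v u}" if "u \<in> V" for u
      using aut_dist[OF g(1) v that] aut_in_V[OF g(1) that] g(2) by simp
    then show "g \<in> PiE V (\<lambda>u. {w \<in> V. gdist v w \<le> gdist v u})"
      using aut_extensional[OF g(1)] by (auto simp: PiE_iff)
  qed
qed

text \<open>Tychonoff: the stabilizer is a closed subset of a product of finite balls.\<close>

lemma stab_compact:
  assumes v: "v \<in> V"
  shows "compactin T (stab v)"
proof -
  let ?X = "product_topology (\<lambda>_. discrete_topology V) V"
  let ?P = "PiE V (\<lambda>u. {w \<in> V. gdist v w \<le> gdist v u})"
  have "compactin ?X ?P"
    unfolding compactin_PiE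
    by (intro disjI2 ballI) (auto simp: finite_ball[OF v] compactin_discrete_topology)
  moreover have "closedin ?X (stab v)"
    unfolding closedin_def
  proof
    show "stab v \<subseteq> topspace ?X" using stab_eq(1)[OF v] by auto
    show "openin ?X (topspace ?X - stab v)"
      unfolding openin_pointwise
    proof (intro conjI ballI)
      fix f assume f: "f \<in> topspace ?X - stab v"
      have fP: "f \<in> PiE V (\<lambda>_. V)" using f by auto
      then have "f v \<noteq> v \<or> (\<exists>u\<in>V. \<exists>w\<in>V. ((f u, f w) \<in> E \<longleftrightarrow> (u, w) \<notin> E) \<or> (f u = f w \<and> u \<noteq> w))"
        using f unfolding stab_eq(1)[OF v] by blast
      then have "\<exists>F. finite F \<and> F \<subseteq> V \<and> v \<in> F \<and> (f v \<noteq> v \<or>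
          (\<exists>u\<in>F. \<exists>w\<in>F. ((f u, f w) \<in> E \<longleftrightarrow> (u, w) \<notin> E) \<or> (f u = f w \<and> u \<noteq> w)))"
      proof
        assume "f v \<noteq> v"
        then show ?thesis using v by (intro exI[of _ "{v}"]) simp
      next
        assume "\<exists>u\<in>V. \<exists>w\<in>V. ((f u, f w) \<in> E \<longleftrightarrow> (u, w) \<notin> E) \<or> (f u = f w \<and> u \<noteq> w)"
        then obtain u w where uw: "u \<in> V" "w \<in> V"
          "((f u, f w) \<in> E \<longleftrightarrow> (u, w) \<notin> E) \<or> (f u = f w \<and> u \<noteq> w)"
          by blast
        then show ?thesis using v by (intro exI[of _ "{v, u, w}"]) blast
      qed
      then obtain F where F: "finite F" "F \<subseteq> V" "v \<in> F"
        "f v \<noteq> v \<or> (\<exists>u\<in>F. \<exists>w\<in>F. ((f u, f w) \<in> E \<longleftrightarrow> (u, w) \<notin> E) \<or> (f u = f w \<and> u \<noteq> w))"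
        by blast
      have "f' \<in> topspace ?X - stab v" if f': "f' \<in> PiE V (\<lambda>_. V)" "\<forall>v\<in>F. f' v = f v" for f'
      proof -
        have "f' v \<noteq> v \<or> (\<exists>u\<in>F. \<exists>w\<in>F. ((f' u, f' w) \<in> E \<longleftrightarrow> (u, w) \<notin> E) \<or> (f' u = f' w \<and> u \<noteq> w))"
          using F(3,4) f'(2) by metis
        then have "f' \<notin> stab v" using F(2) unfolding stab_eq(1)[OF v] by blast
        then show ?thesis using f'(1) by simp
      qed
      then show "\<exists>F. finite F \<and> F \<subseteq> V \<and> (\<forall>f'\<in>PiE V (\<lambda>_. V). (\<forall>v\<in>F. f' v = f v) \<longrightarrow>
          f' \<in> topspace ?X - stab v)"
        using F(1,2) by blast
    qed simp
  qed
  ultimately have "compactin ?X (stab v)" using stab_eq(2)[OF v] closed_compactin by blast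
  then show ?thesis by (auto simp: aut_topology_def compactin_subtopology stab_def)
qed

lemma transporter_compact:
  assumes v: "v \<in> V"
  shows "compactin T {g \<in> carrier G. g v = w}"
proof (cases "\<exists>g\<in>carrier G. g v = w")
  case True
  then obtain x where x: "x \<in> carrier G" "x v = w" by blast
  have "{g \<in> carrier G. g v = w} = (\<lambda>g. x \<cdot> g) ` stab v"
  proof (intro equalityI subsetI)
    fix g assume "g \<in> {g \<in> carrier G. g v = w}"
    then have g: "g \<in> carrier G" "g v = w" by auto
    have "ginv x \<cdot> g \<in> stab v"
      using g x inv_apply[OF x(1) v] v by (simp add: stab_def mult_apply)
    moreover have "g = x \<cdot> (ginv x \<cdot> g)"
      using g x by (simp add: G.m_assoc[symmetric])
    ultimately show "g \<in> (\<lambda>g. x \<cdot> g) ` stab v" by blast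
  qed (use x v in \<open>auto simp: stab_def mult_apply\<close>)
  then show ?thesis using image_compactin[OF stab_compact[OF v] continuous_left_translation[OF x(1)]] by simp
next
  case False
  then have "{g \<in> carrier G. g v = w} = {}" by blast
  then show ?thesis by (simp only: compactin_empty)
qed

lemma finite_image_compact:
  assumes v: "v \<in> V" and U: "saturated F U" "finite F" "F \<subseteq> V" and fin: "finite ((\<lambda>g. g v) ` U)"
  shows "compactin T U"
proof -
  have "U \<subseteq> (\<Union>w\<in>(\<lambda>g. g v) ` U. {g \<in> carrier G. g v = w})"
    using U by (auto simp: saturated_def)
  moreover have "compactin T (\<Union>w\<in>(\<lambda>g. g v) ` U. {g \<in> carrier G. g v = w})"
    by (rule compactin_Union) (use fin transporter_compact[OF v] in auto)
  ultimately show ?thesis using saturated_closed[OF U] closed_compactin by blast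
qed

lemma compact_finite_image:
  assumes "compactin T Q" "v \<in> V"
  shows "finite ((\<lambda>g. g v) ` Q)"
proof -
  have "continuous_map T (discrete_topology V) (\<lambda>g. g v)"
    using open_vertex_condition[OF assms(2), of "\<lambda>w. w \<in> U" for U] aut_in_V assms(2)
    by (auto simp: continuous_map_def topspace_T)
  from image_compactin[OF assms(1) this] show ?thesis
    by (simp add: compactin_discrete_topology)
qed

lemma locally_compact_group_G: "locally_compact_group G T"
  unfolding locally_compact_group_def
proof (intro conjI)
  obtain v where v: "v \<in> V" using V_nonempty by blast
  show "locally_compact_space T"
    unfolding locally_compact_space_def
  proof
    fix g assume g: "g \<in> topspace T"
    then show "\<exists>U K. openin T U \<and> compactin T K \<and> g \<in> U \<and> U \<subseteq> K"
      using open_vertex_condition[OF v, of "\<lambda>w. w = g v"] transporter_compact[OF v, of "g v"]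
      by (intro exI[of _ "{h \<in> carrier G. h v = g v}"]) (auto simp: topspace_T)
  qed
qed (simp_all add: group_G topspace_T continuous_mult continuous_inv Hausdorff_T)

end

section \<open>Haar measure on the automorphism group\<close>

text \<open>The Haar measure of a compact open set counts restrictions to a large finite set of vertices,
  relative to the number of restrictions of elements of the stabilizer of the base vertex.\<close>

locale based_regular_tree = regular_tree_graph k V E for k :: nat and V :: "'v set" and E +
  fixes base :: 'v
  assumes base: "base \<in> V"
begin

text \<open>\<open>base\<close> is included so that its stabilizer, which normalizes the measure, is
  saturated for every frame.\<close>

definition frame :: "'v set \<Rightarrow> bool" where
  "frame F \<longleftrightarrow> finite F \<and> F \<subseteq> V \<and> base \<in> F"

text \<open>The compact open subsets of \<open>G\<close>, described by finite data so that
  restrictions can be counted.\<close>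

definition compact_open :: "('v \<Rightarrow> 'v) set set" where
  "compact_open = {U. (\<exists>F. frame F \<and> saturated F U) \<and> finite ((\<lambda>g. g base) ` U)}"

definition restrictions :: "'v set \<Rightarrow> ('v \<Rightarrow> 'v) set \<Rightarrow> ('v \<Rightarrow> 'v) set" where
  "restrictions F U = (\<lambda>g. restrict g F) ` U"

definition fixer :: "'v set \<Rightarrow> ('v \<Rightarrow> 'v) set" where
  "fixer F = {g \<in> carrier G. \<forall>v\<in>F. g v = v}"

lemma frame_Un: "frame F \<Longrightarrow> frame F' \<Longrightarrow> frame (F \<union> F')"
  by (auto simp: frame_def)

lemma saturated_mono: "saturated F U \<Longrightarrow> F \<subseteq> F' \<Longrightarrow> saturated F' U"
  unfolding saturated_def by blast

lemma restrict_eq_iff: "restrict g F = restrict g' F \<longleftrightarrow> (\<forall>v\<in>F. g v = g' v)"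
  by (metis restrict_apply' restrict_ext)

lemma compact_openE:
  assumes "U \<in> compact_open"
  obtains F where "frame F" "saturated F U" "finite ((\<lambda>g. g base) ` U)" "U \<subseteq> carrier G"
  using assms saturated_subset by (auto simp: compact_open_def)

lemma compact_open_common:
  assumes "U \<in> compact_open" "W \<in> compact_open"
  obtains F where "frame F" "saturated F U" "saturated F W"
proof -
  obtain F where F: "frame F" "saturated F U" using assms(1) by (rule compact_openE)
  obtain F' where F': "frame F'" "saturated F' W" using assms(2) by (rule compact_openE)
  show thesis
    by (rule that[of "F \<union> F'"])
       (use F F' frame_Un saturated_mono[OF F(2)] saturated_mono[OF F'(2)] in auto)
qed

lemma compact_open_compact: "U \<in> compact_open \<Longrightarrow> compactin T U"
  by (auto elim!: compact_openE simp: frame_def intro: finite_image_compact[OF base])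

lemma compact_open_open: "U \<in> compact_open \<Longrightarrow> openin T U"
  by (auto elim!: compact_openE simp: frame_def intro: saturated_open)

lemma compact_open_closed: "U \<in> compact_open \<Longrightarrow> closedin T U"
  by (auto elim!: compact_openE simp: frame_def intro: saturated_closed)

lemma finite_restrictions:
  assumes U: "U \<in> compact_open" and F: "finite F" "F \<subseteq> V"
  shows "finite (restrictions F U)"
proof (rule finite_subset)
  let ?P = "\<lambda>w. PiE F (\<lambda>u. {x \<in> V. gdist w x \<le> gdist base u})"
  obtain F' where U': "finite ((\<lambda>g. g base) ` U)" "U \<subseteq> carrier G"
    using U by (rule compact_openE)
  show "restrictions F U \<subseteq> (\<Union>w\<in>(\<lambda>g. g base) ` U. ?P w)"
    unfolding restrictions_def
  proof
    fix f assume "f \<in> (\<lambda>g. restrict g F) ` U"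
    then obtain g where g: "g \<in> U" "g \<in> carrier G" "f = restrict g F" using U' by blast
    have "f \<in> ?P (g base)"
      using g F aut_in_V[OF g(2)] aut_dist[OF g(2) base] by (auto simp: PiE_iff)
    then show "f \<in> (\<Union>w\<in>(\<lambda>g. g base) ` U. ?P w)" using g(1) by blast
  qed
  have "w \<in> V" if "w \<in> (\<lambda>g. g base) ` U" for w using that U'(2) aut_in_V base by auto
  then show "finite (\<Union>w\<in>(\<lambda>g. g base) ` U. ?P w)"
    using U'(1) F finite_ball by (intro finite_UN_I finite_PiE) auto
qed

text \<open>Two elements with the same restriction to \<open>F\<close> differ by a right factor that
  fixes \<open>F\<close> pointwise, so every fibre of the restriction from \<open>F'\<close> to
  \<open>F\<close> is a translate of one and the same set.\<close>

lemma restriction_fibre: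
  assumes U: "saturated F U" and F: "F \<subseteq> F'" "F' \<subseteq> V" and g\<^sub>0: "g\<^sub>0 \<in> U"
  shows "bij_betw (compose F' g\<^sub>0) (restrictions F' (fixer F))
           {f \<in> restrictions F' U. restrict f F = restrict g\<^sub>0 F}"
proof -
  have g0: "g\<^sub>0 \<in> carrier G" using g\<^sub>0 saturated_subset[OF U] by blast
  have res: "compose F' g\<^sub>0 (restrict s F') = restrict (g\<^sub>0 \<cdot> s) F'" if "s \<in> carrier G" for s
    using F(2) that g0 by (auto simp: compose_def mult_apply fun_eq_iff)
  have "inj_on (compose F' g\<^sub>0) (restrictions F' (fixer F))"
  proof (rule inj_onI)
    fix f f' assume "f \<in> restrictions F' (fixer F)" "f' \<in> restrictions F' (fixer F)"
      and eq: "compose F' g\<^sub>0 f = compose F' g\<^sub>0 f'"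
    then obtain s s' where s: "s \<in> carrier G" "f = restrict s F'" "s' \<in> carrier G" "f' = restrict s' F'"
      by (auto simp: restrictions_def fixer_def)
    have "s v = s' v" if v: "v \<in> F'" for v
    proof -
      have "g\<^sub>0 (s v) = g\<^sub>0 (s' v)"
        using fun_cong[OF eq, of v] v s by (simp add: compose_def)
      then show ?thesis using aut_inj[OF g0] aut_in_V s(1,3) v F(2) by blast
    qed
    then show "f = f'" using s by (simp add: restrict_eq_iff)
  qed
  moreover have "compose F' g\<^sub>0 ` restrictions F' (fixer F) =
    {f \<in> restrictions F' U. restrict f F = restrict g\<^sub>0 F}"
  proof (intro equalityI subsetI)
    fix f assume "f \<in> compose F' g\<^sub>0 ` restrictions F' (fixer F)"
    then obtain s where s: "s \<in> carrier G" "\<forall>v\<in>F. s v = v" "f = restrict (g\<^sub>0 \<cdot> s) F'"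
      using res by (auto simp: restrictions_def fixer_def)
    have "\<forall>v\<in>F. (g\<^sub>0 \<cdot> s) v = g\<^sub>0 v"
      using s F g0 by (auto simp: mult_apply subset_iff)
    moreover have "g\<^sub>0 \<cdot> s \<in> U"
      using saturatedD[OF U g\<^sub>0, of "g\<^sub>0 \<cdot> s"] calculation s(1) g0 by auto
    ultimately show "f \<in> {f \<in> restrictions F' U. restrict f F = restrict g\<^sub>0 F}"
      using s(3) F(1) by (auto simp: restrictions_def restrict_eq_iff subset_iff)
  next
    fix f assume "f \<in> {f \<in> restrictions F' U. restrict f F = restrict g\<^sub>0 F}"
    then obtain g where g: "g \<in> U" "f = restrict g F'" "\<forall>v\<in>F. g v = g\<^sub>0 v"
      using F(1) by (auto simp: restrictions_def restrict_eq_iff subset_iff)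
    have gc: "g \<in> carrier G" using g(1) saturated_subset[OF U] by blast
    let ?s = "ginv g\<^sub>0 \<cdot> g"
    have "g\<^sub>0 \<cdot> ?s = g" using gc g0 by (simp add: G.m_assoc[symmetric])
    moreover have "?s \<in> fixer F"
      using g(3) gc g0 F inv_apply[OF g0] by (auto simp: fixer_def mult_apply subset_iff)
    ultimately show "f \<in> compose F' g\<^sub>0 ` restrictions F' (fixer F)"
      using res[of ?s] g(2) by (auto simp: restrictions_def fixer_def image_iff intro!: bexI[of _ ?s])
  qed
  ultimately show ?thesis by (simp add: bij_betw_def)
qed

text \<open>The refinement factor depends on \<open>F\<close> and \<open>F'\<close> but not on
  \<open>U\<close>, so it cancels in \<open>rel_index\<close>.\<close>

lemma card_restrictions_refine:
  assumes U: "U \<in> compact_open" "saturated F U" and F: "F \<subseteq> F'" "finite F'" "F' \<subseteq> V"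
  shows "card (restrictions F' U) = card (restrictions F U) * card (restrictions F' (fixer F))"
proof -
  let ?fib = "\<lambda>f. {f' \<in> restrictions F' U. restrict f' F = f}"
  have fin: "finite (restrictions F U)" "finite (restrictions F' U)"
    using finite_restrictions[OF U(1)] F finite_subset[OF F(1,2)] by auto
  have "restrict (restrict g F') F = restrict g F" for g :: "'v \<Rightarrow> 'v"
    using F(1) by (auto simp: restrict_eq_iff subset_iff)
  then have "restrictions F' U = (\<Union>f\<in>restrictions F U. ?fib f)"
    by (auto simp: restrictions_def)
  also have "card \<dots> = (\<Sum>f\<in>restrictions F U. card (?fib f))"
    using fin by (intro card_UN_disjoint) auto
  also have "\<dots> = (\<Sum>f\<in>restrictions F U. card (restrictions F' (fixer F)))"
  proof (rule sum.cong)
    fix f assume "f \<in> restrictions F U"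
    then obtain g where "g \<in> U" "f = restrict g F" by (auto simp: restrictions_def)
    then show "card (?fib f) = card (restrictions F' (fixer F))"
      using bij_betw_same_card[OF restriction_fibre[OF U(2) F(1,3)], of g] by simp
  qed simp
  finally show ?thesis by simp
qed

lemma stab_compact_open: "stab base \<in> compact_open" "frame F \<Longrightarrow> saturated F (stab base)"
proof -
  show sat: "saturated F (stab base)" if "frame F" for F
    using that by (auto simp: saturated_def frame_def stab_def)
  have "(\<lambda>g. g base) ` stab base \<subseteq> {base}" by (auto simp: stab_def)
  moreover have "frame {base}" using base by (simp add: frame_def)
  ultimately show "stab base \<in> compact_open"
    using sat finite_subset unfolding compact_open_def by blast
qed

lemma one_in_fixer: "F \<subseteq> V \<Longrightarrow> \<one>\<^bsub>G\<^esub> \<in> fixer F"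
  using one_apply by (auto simp: fixer_def)

lemma fixer_compact_open:
  assumes "frame F"
  shows "fixer F \<in> compact_open"
proof -
  have "saturated F (fixer F)" by (auto simp: saturated_def fixer_def)
  moreover have "(\<lambda>g. g base) ` fixer F \<subseteq> {base}" using assms by (auto simp: fixer_def frame_def)
  ultimately show ?thesis using assms finite_subset unfolding compact_open_def by blast
qed

lemma card_restrictions_pos:
  assumes "U \<in> compact_open" "U \<noteq> {}" "frame F"
  shows "card (restrictions F U) > 0"
  using finite_restrictions[OF assms(1), of F] assms by (auto simp: card_gt_0_iff restrictions_def frame_def)

definition rel_index :: "'v set \<Rightarrow> ('v \<Rightarrow> 'v) set \<Rightarrow> real" where
  "rel_index F U = real (card (restrictions F U)) / real (card (restrictions F (stab base)))"

definition haar_content :: "('v \<Rightarrow> 'v) set \<Rightarrow> real" where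
  "haar_content U = rel_index (SOME F. frame F \<and> saturated F U) U"

lemma rel_index_refine:
  assumes U: "U \<in> compact_open" "saturated F U" "frame F" and F: "F \<subseteq> F'" "frame F'"
  shows "rel_index F' U = rel_index F U"
proof -
  have F': "finite F'" "F' \<subseteq> V" using F(2) by (auto simp: frame_def)
  have "card (restrictions F' (fixer F)) > 0"
    using card_restrictions_pos[OF fixer_compact_open[OF U(3)] _ F(2)] one_in_fixer[of F] U(3)
    by (auto simp: frame_def)
  then show ?thesis
    unfolding rel_index_def card_restrictions_refine[OF U(1,2) F(1) F']
      card_restrictions_refine[OF stab_compact_open(1) stab_compact_open(2)[OF U(3)] F(1) F']
    by simp
qed

lemma haar_content_eq:
  assumes "U \<in> compact_open" "saturated F U" "frame F"
  shows "haar_content U = rel_index F U"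
proof -
  define F' where "F' = (SOME F. frame F \<and> saturated F U)"
  have F': "frame F'" "saturated F' U"
    using someI_ex[of "\<lambda>F. frame F \<and> saturated F U"] assms unfolding F'_def by auto
  have "rel_index F' U = rel_index (F \<union> F') U"
    by (rule rel_index_refine[symmetric]) (use assms F' frame_Un in auto)
  also have "\<dots> = rel_index F U"
    by (rule rel_index_refine) (use assms F' frame_Un in auto)
  finally show ?thesis by (simp add: haar_content_def F'_def)
qed

lemma haar_content_nonneg: "haar_content U \<ge> 0"
  by (simp add: haar_content_def rel_index_def)

section \<open>From the content on compact open sets to a Borel measure\<close>

lemma ring_compact_open: "ring_of_sets (carrier G) compact_open"
  unfolding ring_of_sets_iff
proof (intro conjI ballI)
  show "compact_open \<subseteq> Pow (carrier G)" by (auto elim: compact_openE)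
  have "frame {base}" using base by (simp add: frame_def)
  then show "{} \<in> compact_open" by (auto simp: compact_open_def saturated_def)
next
  fix U W assume UW: "U \<in> compact_open" "W \<in> compact_open"
  then obtain F where F: "frame F" "saturated F U" "saturated F W" by (rule compact_open_common)
  have fin: "finite ((\<lambda>g. g base) ` U)" "finite ((\<lambda>g. g base) ` W)"
    using UW by (auto simp: compact_open_def)
  have sat: "saturated F (U \<union> W)" using F(2,3) unfolding saturated_def by blast
  have sat': "saturated F (U - W)"
    unfolding saturated_def
  proof (intro conjI ballI impI)
    show "U - W \<subseteq> carrier G" using saturated_subset[OF F(2)] by blast
    fix g g' assume g: "g \<in> U - W" "g' \<in> carrier G" "\<forall>v\<in>F. g' v = g v"
    have "g' \<in> U" using saturatedD[OF F(2), of g g'] g by auto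
    moreover have "g' \<notin> W" using saturatedD[OF F(3), of g' g] saturated_subset[OF F(2)] g by auto
    ultimately show "g' \<in> U - W" by blast
  qed
  have "finite ((\<lambda>g. g base) ` (U \<union> W))" using fin by (simp add: image_Un)
  then show "U \<union> W \<in> compact_open" using F(1) sat unfolding compact_open_def by blast
  have "finite ((\<lambda>g. g base) ` (U - W))" using fin(1) by (rule finite_subset[rotated]) auto
  then show "U - W \<in> compact_open" using F(1) sat' unfolding compact_open_def by blast
qed

lemma haar_content_additive:
  assumes U: "U \<in> compact_open" "W \<in> compact_open" "U \<inter> W = {}"
  shows "haar_content (U \<union> W) = haar_content U + haar_content W"
proof -
  interpret R: ring_of_sets "carrier G" compact_open by (rule ring_compact_open)
  obtain F where F: "frame F" "saturated F U" "saturated F W" using U(1,2) by (rule compact_open_common)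
  have fF: "finite F" "F \<subseteq> V" using F(1) by (auto simp: frame_def)
  have UW: "U \<union> W \<in> compact_open" "saturated F (U \<union> W)"
    using U F(2,3) unfolding saturated_def by (blast intro: R.Un)+
  have "restrictions F U \<inter> restrictions F W = {}"
  proof (rule ccontr)
    assume "restrictions F U \<inter> restrictions F W \<noteq> {}"
    then obtain g g' where g: "g \<in> U" "g' \<in> W" "\<forall>v\<in>F. g v = g' v"
      by (auto simp: restrictions_def restrict_eq_iff)
    then have "g \<in> W" using saturatedD[OF F(3) g(2), of g] saturated_subset[OF F(2)] by auto
    then show False using g U(3) by blast
  qed
  then have "card (restrictions F (U \<union> W)) = card (restrictions F U) + card (restrictions F W)"
    using finite_restrictions[OF U(1) fF] finite_restrictions[OF U(2) fF]
    by (simp add: restrictions_def image_Un card_Un_disjoint)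
  then show ?thesis
    using haar_content_eq[OF U(1) F(2,1)] haar_content_eq[OF U(2) F(3,1)] haar_content_eq[OF UW F(1)]
    by (simp add: rel_index_def add_divide_distrib)
qed

lemma haar_content_empty: "haar_content {} = 0"
proof -
  interpret R: ring_of_sets "carrier G" compact_open by (rule ring_compact_open)
  show ?thesis using haar_content_additive[of "{}" "{}"] by simp
qed

text \<open>Nested nonempty compact closed sets have a common point. This provides the continuity at
  the empty set for the Caratheodory extension.\<close>

lemma decseq_compact_open_empty:
  assumes A: "range A \<subseteq> compact_open" "decseq A" "(\<Inter>i. A i) = {}"
  shows "\<exists>i. A i = {}"
proof (rule ccontr)
  assume ne: "\<nexists>i. A i = {}"
  have "(\<Inter>i. A i) \<noteq> {}"
  proof (rule compact_space_imp_nest)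
    show "compact_space (subtopology T (A 0))"
      using compact_open_compact A(1) by (simp add: compact_space_subtopology image_subset_iff)
    fix n
    have "A n \<subseteq> A 0" using A(2) by (simp add: decseq_def)
    then show "closedin (subtopology T (A 0)) (A n)"
      using compact_open_closed A(1) by (auto simp: closedin_subtopology image_subset_iff)
  qed (use A ne in auto)
  then show False using A(3) by simp
qed

lemma countable_compact_open_base:
  "\<exists>\<B>. countable \<B> \<and> \<B> \<subseteq> compact_open \<and> (\<forall>U. openin T U \<longrightarrow> (\<exists>\<U>\<subseteq>\<B>. U = \<Union>\<U>))"
proof -
  define cyl where "cyl = (\<lambda>(F, f :: 'v \<Rightarrow> 'v). {g \<in> carrier G. \<forall>v\<in>F. g v = f v})"
  define I where "I = (SIGMA F:{F. finite F \<and> F \<subseteq> V}. PiE F (\<lambda>_. V))"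
  define \<B> where "\<B> = cyl ` I \<inter> compact_open"
  have "countable I"
    unfolding I_def
    by (intro countable_SIGMA countable_Collect_finite_subset countable_V countable_PiE) auto
  then have "countable \<B>" by (simp add: \<B>_def)
  moreover have "\<exists>\<U>\<subseteq>\<B>. U = \<Union>\<U>" if U: "openin T U" for U
  proof -
    have Uc: "U \<subseteq> carrier G" using U openin_subset topspace_T by blast
    have "U = \<Union> {C \<in> \<B>. C \<subseteq> U}"
    proof (intro equalityI subsetI)
      fix g assume g: "g \<in> U"
      obtain F where F: "finite F" "F \<subseteq> V" "\<forall>g'\<in>carrier G. (\<forall>v\<in>F. g' v = g v) \<longrightarrow> g' \<in> U"
        using U g unfolding openin_T by blast
      let ?F = "insert base F" let ?C' = "cyl (?F, restrict g ?F)"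
      have C: "?C' = {g' \<in> carrier G. \<forall>v\<in>?F. g' v = g v}" by (auto simp: cyl_def)
      have "(?F, restrict g ?F) \<in> I"
        using F base aut_in_V[of g] g Uc by (auto simp: I_def PiE_iff)
      moreover have "?C' \<subseteq> U" using F(3) by (auto simp: C)
      moreover have "?C' \<in> compact_open"
      proof -
        have "saturated ?F ?C'" unfolding C by (auto simp: saturated_def)
        moreover have "frame ?F" using F base by (simp add: frame_def)
        moreover have "(\<lambda>g. g base) ` ?C' \<subseteq> {g base}" by (auto simp: C)
        ultimately show ?thesis using finite_subset unfolding compact_open_def by blast
      qed
      moreover have "g \<in> ?C'" using g Uc by (auto simp: C)
      ultimately show "g \<in> \<Union> {C \<in> \<B>. C \<subseteq> U}" unfolding \<B>_def by blast
    qed blast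
    then show ?thesis by (intro exI[of _ "{C \<in> \<B>. C \<subseteq> U}"]) blast
  qed
  ultimately show ?thesis unfolding \<B>_def by blast
qed

lemma borel_sets_compact_open: "borel_sets_of T = sigma_sets (carrier G) compact_open"
proof -
  interpret R: ring_of_sets "carrier G" compact_open by (rule ring_compact_open)
  have "U \<in> sigma_sets (carrier G) compact_open" if U: "openin T U" for U
  proof -
    obtain \<B> \<U> where "countable \<B>" "\<B> \<subseteq> compact_open" "\<U> \<subseteq> \<B>" "U = \<Union>\<U>"
      using countable_compact_open_base U by blast
    moreover from this have "countable \<U>" "\<U> \<subseteq> sigma_sets (carrier G) compact_open"
      using countable_subset by auto
    then have "\<Union>\<U> \<in> sigma_sets (carrier G) compact_open"
      by (rule sigma_algebra.countable_Union[OF sigma_algebra_sigma_sets[OF R.space_closed]])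
    ultimately show ?thesis by simp
  qed
  then show ?thesis
    unfolding borel_sets_of_def topspace_T
    using compact_open_open by (intro sigma_sets_eqI) auto
qed

lemma haar_exists:
  "\<exists>M. space M = carrier G \<and> sets M = borel_sets_of T \<and>
     (\<forall>U\<in>compact_open. emeasure M U = ennreal (haar_content U))"
proof -
  interpret R: ring_of_sets "carrier G" compact_open by (rule ring_compact_open)
  obtain \<mu> where \<mu>: "\<forall>U\<in>compact_open. \<mu> U = ennreal (haar_content U)"
    "measure_space (carrier G) (sigma_sets (carrier G) compact_open) \<mu>"
  proof (rule exE[OF R.caratheodory_empty_continuous[of "\<lambda>U. ennreal (haar_content U)"]])
    show "positive compact_open (\<lambda>U. ennreal (haar_content U))"
      by (simp add: positive_def haar_content_empty)
    show "additive compact_open (\<lambda>U. ennreal (haar_content U))"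
      by (simp add: additive_def haar_content_additive ennreal_plus haar_content_nonneg)
    show "(\<lambda>i. ennreal (haar_content (A i))) \<longlonglongrightarrow> 0"
      if A: "range A \<subseteq> compact_open" "decseq A" "(\<Inter>i. A i) = {}" for A
    proof -
      obtain i where "A i = {}" using decseq_compact_open_empty[OF A] by blast
      then have "\<forall>j\<ge>i. ennreal (haar_content (A j)) = 0"
        using A(2) haar_content_empty by (metis decseq_def ennreal_0 subset_empty)
      then show ?thesis by (intro tendsto_eventually) (auto simp: eventually_sequentially)
    qed
  qed (use that in auto)
  have "emeasure (measure_of (carrier G) compact_open \<mu>) U = ennreal (haar_content U)"
    if "U \<in> compact_open" for U
  proof (subst emeasure_measure_of[OF refl R.space_closed])
    show "positive (sets (measure_of (carrier G) compact_open \<mu>)) \<mu>"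
      "countably_additive (sets (measure_of (carrier G) compact_open \<mu>)) \<mu>"
      using \<mu>(2) R.space_closed by (auto simp: measure_space_def sets_measure_of)
    show "U \<in> sets (measure_of (carrier G) compact_open \<mu>)"
      using that R.space_closed by (simp add: sets_measure_of)
  qed (use \<mu>(1) that in auto)
  then show ?thesis
    using R.space_closed borel_sets_compact_open
    by (intro exI[of _ "measure_of (carrier G) compact_open \<mu>"])
       (simp add: space_measure_of sets_measure_of)
qed

definition haar :: "('v \<Rightarrow> 'v) measure" where
  "haar = (SOME M. space M = carrier G \<and> sets M = borel_sets_of T \<and>
     (\<forall>U\<in>compact_open. emeasure M U = ennreal (haar_content U)))"

lemma space_haar: "space haar = carrier G"
  and sets_haar: "sets haar = borel_sets_of T"
  and emeasure_haar: "U \<in> compact_open \<Longrightarrow> emeasure haar U = ennreal (haar_content U)"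
  using someI_ex[OF haar_exists] unfolding haar_def by auto

lemma open_sets_haar: "openin T U \<Longrightarrow> U \<in> sets haar"
  by (auto simp: sets_haar borel_sets_of_def intro: sigma_sets.Basic)

lemma continuous_measurable_haar:
  assumes "continuous_map T T f"
  shows "f \<in> measurable haar haar"
proof (rule measurable_sigma_sets[of _ "carrier G" "{U. openin T U}"])
  show "sets haar = sigma_sets (carrier G) {U. openin T U}"
    by (simp add: sets_haar borel_sets_of_def topspace_T)
  show "f \<in> space haar \<rightarrow> carrier G"
    using assms by (auto simp: space_haar continuous_map_def topspace_T)
  fix U assume "U \<in> {U. openin T U}"
  then have "openin T {g \<in> topspace T. f g \<in> U}" using assms by (simp add: continuous_map_def)
  then show "f -` U \<inter> space haar \<in> sets haar"
    by (intro open_sets_haar) (simp add: space_haar topspace_T vimage_def Int_def conj_commute)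
qed (use openin_subset topspace_T in auto)

lemma transporter_compact_open:
  assumes "w \<in> V"
  shows "{g \<in> carrier G. g base = w} \<in> compact_open"
proof -
  have "frame {base}" using base by (simp add: frame_def)
  moreover have "saturated {base} {g \<in> carrier G. g base = w}" by (auto simp: saturated_def)
  moreover have "(\<lambda>g. g base) ` {g \<in> carrier G. g base = w} \<subseteq> {w}" by auto
  ultimately show ?thesis using finite_subset unfolding compact_open_def by blast
qed

text \<open>The compact open sets are stable under intersection, and countably many of them, of
  finite measure, cover \<open>G\<close>: the sets of elements with a prescribed image of
  \<open>base\<close>.\<close>

lemma measure_eq_haar:
  assumes "sets M = sets haar" "\<And>U. U \<in> compact_open \<Longrightarrow> emeasure M U = emeasure haar U"
  shows "M = haar"
proof (rule measure_eqI_generator_eq_countable[of compact_open "carrier G" _ _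
      "(\<lambda>w. {g \<in> carrier G. g base = w}) ` V"])
  interpret R: ring_of_sets "carrier G" compact_open by (rule ring_compact_open)
  show "Int_stable compact_open" by (auto simp: Int_stable_def)
  show "compact_open \<subseteq> Pow (carrier G)" by (rule R.space_closed)
  show "sets M = sigma_sets (carrier G) compact_open" "sets haar = sigma_sets (carrier G) compact_open"
    using assms(1) sets_haar borel_sets_compact_open by auto
  show "(\<lambda>w. {g \<in> carrier G. g base = w}) ` V \<subseteq> compact_open"
    using transporter_compact_open by auto
  show "\<Union> ((\<lambda>w. {g \<in> carrier G. g base = w}) ` V) = carrier G"
    using aut_in_V base by auto
  show "countable ((\<lambda>w. {g \<in> carrier G. g base = w}) ` V)"
    using countable_V by simp
  show "emeasure M U \<noteq> \<infinity>" if "U \<in> (\<lambda>w. {g \<in> carrier G. g base = w}) ` V" for U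
    using that transporter_compact_open assms(2) emeasure_haar by auto
qed (use assms in auto)

section \<open>Left and right invariance of the Haar measure\<close>

lemma haar_left_invariant:
  assumes x: "x \<in> carrier G"
  shows "distr haar haar (\<lambda>g. x \<cdot> g) = haar"
proof (rule measure_eq_haar)
  fix U assume U: "U \<in> compact_open"
  obtain F where F: "frame F" "saturated F U" using U by (rule compact_openE)
  have Uc: "U \<subseteq> carrier G" using saturated_subset[OF F(2)] .
  have FV: "F \<subseteq> V" using F(1) by (simp add: frame_def)
  let ?W = "{g \<in> carrier G. x \<cdot> g \<in> U}"
  have satW: "saturated F ?W"
    unfolding saturated_def
  proof (intro conjI ballI impI)
    fix g g' assume g: "g \<in> ?W" "g' \<in> carrier G" "\<forall>v\<in>F. g' v = g v"
    then have "x \<cdot> g' \<in> U"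
      using saturatedD[OF F(2), of "x \<cdot> g" "x \<cdot> g'"] x FV by (auto simp: mult_apply subset_iff)
    then show "g' \<in> ?W" using g(2) by simp
  qed auto
  have "(\<lambda>g. g base) ` ?W \<subseteq> (ginv x) ` (\<lambda>g. g base) ` U"
  proof
    fix w assume "w \<in> (\<lambda>g. g base) ` ?W"
    then obtain g where g: "g \<in> carrier G" "x \<cdot> g \<in> U" "w = g base" by auto
    have "w = (ginv x) ((x \<cdot> g) base)"
      using g x inv_apply[OF x] base aut_in_V by (simp add: mult_apply)
    then show "w \<in> (ginv x) ` (\<lambda>g. g base) ` U" using g(2) by blast
  qed
  moreover have "finite ((\<lambda>g. g base) ` U)" using U by (simp add: compact_open_def)
  ultimately have W: "?W \<in> compact_open"
    using F(1) satW finite_subset unfolding compact_open_def by blast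
  have "bij_betw (compose F x) (restrictions F ?W) (restrictions F U)"
    unfolding bij_betw_def
  proof
    have res: "compose F x (restrict g F) = restrict (x \<cdot> g) F" if "g \<in> carrier G" for g
      using FV that x by (auto simp: compose_def mult_apply fun_eq_iff)
    show "inj_on (compose F x) (restrictions F ?W)"
    proof (rule inj_onI)
      fix f f' assume "f \<in> restrictions F ?W" "f' \<in> restrictions F ?W"
        and eq: "compose F x f = compose F x f'"
      then obtain s s' where s: "s \<in> carrier G" "f = restrict s F" "s' \<in> carrier G" "f' = restrict s' F"
        by (auto simp: restrictions_def)
      have "s v = s' v" if v: "v \<in> F" for v
      proof -
        have "x (s v) = x (s' v)"
          using fun_cong[OF eq, of v] v s by (simp add: compose_def)
        then show ?thesis using aut_inj[OF x] aut_in_V s(1,3) v FV by blast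
      qed
      then show "f = f'" using s by (simp add: restrict_eq_iff)
    qed
    show "compose F x ` restrictions F ?W = restrictions F U"
    proof (intro equalityI subsetI)
      fix f assume "f \<in> compose F x ` restrictions F ?W"
      then show "f \<in> restrictions F U" using res by (auto simp: restrictions_def)
    next
      fix f assume "f \<in> restrictions F U"
      then obtain g where g: "g \<in> U" "f = restrict g F" by (auto simp: restrictions_def)
      let ?h = "ginv x \<cdot> g"
      have h: "?h \<in> carrier G" "x \<cdot> ?h = g"
        using g(1) Uc x by (auto simp: G.m_assoc[symmetric])
      then have "f = compose F x (restrict ?h F)" "?h \<in> ?W" using res[OF h(1)] g by auto
      then show "f \<in> compose F x ` restrictions F ?W" unfolding restrictions_def by blast
    qed
  qed
  from bij_betw_same_card[OF this] have "haar_content ?W = haar_content U"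
    using haar_content_eq[OF W satW F(1)] haar_content_eq[OF U F(2,1)] by (simp add: rel_index_def)
  moreover have "(\<lambda>g. x \<cdot> g) -` U \<inter> space haar = ?W" by (auto simp: space_haar)
  ultimately show "emeasure (distr haar haar (\<lambda>g. x \<cdot> g)) U = emeasure haar U"
    using emeasure_haar[OF W] emeasure_haar[OF U] open_sets_haar[OF compact_open_open[OF U]]
    by (simp add: emeasure_distr continuous_measurable_haar continuous_left_translation[OF x])
qed simp

text \<open>Right invariance is immediate for elements preserving arbitrarily large finite sets of
  vertices, such as vertex stabilizers and edge inversions; these generate the group.\<close>

lemma haar_right_invariant_of_preserved:
  assumes x: "x \<in> carrier G"
    and pres: "\<And>F. frame F \<Longrightarrow> \<exists>F'. frame F' \<and> F \<subseteq> F' \<and> x ` F' = F'"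
  shows "distr haar haar (\<lambda>g. g \<cdot> x) = haar"
proof (rule measure_eq_haar)
  fix U assume U: "U \<in> compact_open"
  obtain F0 where F0: "frame F0" "saturated F0 U" using U by (rule compact_openE)
  obtain F where F: "frame F" "F0 \<subseteq> F" "x ` F = F" using pres[OF F0(1)] by blast
  have satU: "saturated F U" using F0(2) F(2) by (rule saturated_mono)
  have Uc: "U \<subseteq> carrier G" using saturated_subset[OF satU] .
  have FV: "F \<subseteq> V" using F(1) by (simp add: frame_def)
  have xF: "x v \<in> F" if "v \<in> F" for v using F(3) that by blast
  let ?W = "{g \<in> carrier G. g \<cdot> x \<in> U}"
  have satW: "saturated F ?W"
    unfolding saturated_def
  proof (intro conjI ballI impI)
    fix g g' assume g: "g \<in> ?W" "g' \<in> carrier G" "\<forall>v\<in>F. g' v = g v"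
    then have "g' \<cdot> x \<in> U"
      using saturatedD[OF satU, of "g \<cdot> x" "g' \<cdot> x"] x FV xF by (auto simp: mult_apply subset_iff)
    then show "g' \<in> ?W" using g(2) by simp
  qed auto
  let ?u = "(ginv x) base"
  have u: "?u \<in> V" "x ?u = base" using aut_in_V base apply_inv[OF x base] x by auto
  have "(\<lambda>g. g base) ` ?W \<subseteq> (\<lambda>g. g ?u) ` U"
  proof
    fix w assume "w \<in> (\<lambda>g. g base) ` ?W"
    then obtain g where g: "g \<in> carrier G" "g \<cdot> x \<in> U" "w = g base" by auto
    have "w = (g \<cdot> x) ?u" using g x u by (simp add: mult_apply)
    then show "w \<in> (\<lambda>g. g ?u) ` U" using g(2) by blast
  qed
  moreover have "finite ((\<lambda>g. g ?u) ` U)"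
    using compact_finite_image[OF compact_open_compact[OF U] u(1)] .
  ultimately have W: "?W \<in> compact_open"
    using F(1) satW finite_subset unfolding compact_open_def by blast
  have "bij_betw (\<lambda>f. compose F f x) (restrictions F ?W) (restrictions F U)"
    unfolding bij_betw_def
  proof
    have res: "compose F (restrict g F) x = restrict (g \<cdot> x) F" if "g \<in> carrier G" for g
      using FV that x xF by (auto simp: compose_def mult_apply fun_eq_iff)
    show "inj_on (\<lambda>f. compose F f x) (restrictions F ?W)"
    proof (rule inj_onI)
      fix f f' assume "f \<in> restrictions F ?W" "f' \<in> restrictions F ?W"
        and eq: "compose F f x = compose F f' x"
      then obtain s s' where s: "f = restrict s F" "f' = restrict s' F"
        by (auto simp: restrictions_def)
      have "s v = s' v" if v: "v \<in> F" for v
      proof -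
        obtain u where "u \<in> F" "v = x u" using F(3) v by blast
        then show ?thesis using fun_cong[OF eq, of u] v s by (simp add: compose_def)
      qed
      then show "f = f'" using s by (simp add: restrict_eq_iff)
    qed
    show "(\<lambda>f. compose F f x) ` restrictions F ?W = restrictions F U"
    proof (intro equalityI subsetI)
      fix f assume "f \<in> (\<lambda>f. compose F f x) ` restrictions F ?W"
      then show "f \<in> restrictions F U" using res by (auto simp: restrictions_def)
    next
      fix f assume "f \<in> restrictions F U"
      then obtain g where g: "g \<in> U" "f = restrict g F" by (auto simp: restrictions_def)
      let ?h = "g \<cdot> ginv x"
      have h: "?h \<in> carrier G" "?h \<cdot> x = g"
        using g(1) Uc x by (auto simp: G.m_assoc)
      then have "f = compose F (restrict ?h F) x" "?h \<in> ?W" using res[OF h(1)] g by auto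
      then show "f \<in> (\<lambda>f. compose F f x) ` restrictions F ?W" unfolding restrictions_def by blast
    qed
  qed
  from bij_betw_same_card[OF this] have "haar_content ?W = haar_content U"
    using haar_content_eq[OF W satW F(1)] haar_content_eq[OF U satU F(1)] by (simp add: rel_index_def)
  moreover have "(\<lambda>g. g \<cdot> x) -` U \<inter> space haar = ?W" by (auto simp: space_haar)
  ultimately show "emeasure (distr haar haar (\<lambda>g. g \<cdot> x)) U = emeasure haar U"
    using emeasure_haar[OF W] emeasure_haar[OF U] open_sets_haar[OF compact_open_open[OF U]]
    by (simp add: emeasure_distr continuous_measurable_haar continuous_right_translation[OF x])
qed simp

lemma haar_right_invariant_mult:
  assumes x: "x \<in> carrier G" "y \<in> carrier G"
    and inv: "distr haar haar (\<lambda>g. g \<cdot> x) = haar" "distr haar haar (\<lambda>g. g \<cdot> y) = haar"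
  shows "distr haar haar (\<lambda>g. g \<cdot> (x \<cdot> y)) = haar"
proof -
  have "distr haar haar (\<lambda>g. g \<cdot> (x \<cdot> y)) = distr haar haar ((\<lambda>g. g \<cdot> y) \<circ> (\<lambda>g. g \<cdot> x))"
    by (rule distr_cong) (use x in \<open>auto simp: space_haar G.m_assoc\<close>)
  also have "\<dots> = distr (distr haar haar (\<lambda>g. g \<cdot> x)) haar (\<lambda>g. g \<cdot> y)"
    using x by (intro distr_distr[symmetric] continuous_measurable_haar continuous_right_translation)
  finally show ?thesis using inv by simp
qed

lemma aut_ball_union:
  assumes x: "x \<in> carrier G" and C: "finite C" "C \<subseteq> V" "x ` C = C"
  shows "x ` {v \<in> V. \<exists>c\<in>C. gdist c v \<le> n} = {v \<in> V. \<exists>c\<in>C. gdist c v \<le> n}" (is "x ` ?B = ?B")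
proof (rule endo_inj_surj)
  have "?B = (\<Union>c\<in>C. {v \<in> V. gdist c v \<le> n})" by auto
  then show "finite ?B" using C finite_ball by auto
  show "x ` ?B \<subseteq> ?B"
  proof
    fix w assume "w \<in> x ` ?B"
    then obtain v c where v: "v \<in> V" "c \<in> C" "gdist c v \<le> n" "w = x v" by blast
    then have "x c \<in> C" "gdist (x c) w \<le> n" using C aut_dist[OF x, of c v] by auto
    then show "w \<in> ?B" using v aut_in_V[OF x] by blast
  qed
  show "inj_on x ?B" using aut_inj[OF x] by (auto simp: inj_on_def)
qed

lemma haar_right_invariant_of_finite_orbit:
  assumes x: "x \<in> carrier G" and C: "finite C" "C \<subseteq> V" "x ` C = C" "base \<in> C"
  shows "distr haar haar (\<lambda>g. g \<cdot> x) = haar"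
proof (rule haar_right_invariant_of_preserved[OF x])
  fix F assume F: "frame F"
  then have fF: "finite F" "F \<subseteq> V" by (auto simp: frame_def)
  define n where "n = Max (gdist base ` F)"
  let ?B = "{v \<in> V. \<exists>c\<in>C. gdist c v \<le> n}"
  have "gdist base v \<le> n" if "v \<in> F" for v using that fF by (simp add: n_def)
  then have "F \<subseteq> ?B" using C(4) fF by blast
  moreover have "?B = (\<Union>c\<in>C. {v \<in> V. gdist c v \<le> n})" by auto
  then have "finite ?B" using C finite_ball by auto
  ultimately have "frame ?B" using F by (auto simp: frame_def)
  then show "\<exists>F'. frame F' \<and> F \<subseteq> F' \<and> x ` F' = F'"
    using \<open>F \<subseteq> ?B\<close> aut_ball_union[OF x C(1-3), of n] by blast
qed

lemma haar_right_invariant: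
  assumes x: "x \<in> carrier G"
  shows "distr haar haar (\<lambda>g. g \<cdot> x) = haar"
proof -
  obtain b where b: "b \<in> nbrs base" using nbr_exists[OF base] by blast
  then obtain s where s: "s \<in> carrier G" "s base = b" "s b = base"
    using arc_transitive[OF b, of base b] nbrs_sym by metis
  have s_inv: "distr haar haar (\<lambda>g. g \<cdot> s) = haar"
    by (rule haar_right_invariant_of_finite_orbit[OF s(1), of "{base, b}"])
       (use s b base nbrs_in_V in auto)
  have K_inv: "distr haar haar (\<lambda>g. g \<cdot> y) = haar" if "y \<in> carrier G" "y base = base" for y
    by (rule haar_right_invariant_of_finite_orbit[OF that(1), of "{base}"]) (use that base in auto)
  have "\<exists>y\<in>carrier G. y base = v \<and> distr haar haar (\<lambda>g. g \<cdot> y) = haar" if "v \<in> V" for v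
    using base that
  proof (induction rule: dist_induct)
    case root
    show ?case using K_inv[of "\<one>\<^bsub>G\<^esub>"] one_apply[OF base] by auto
  next
    case (step v)
    then obtain y where y: "y \<in> carrier G" "y base = parent base v"
      "distr haar haar (\<lambda>g. g \<cdot> y) = haar" by blast
    have "v \<in> nbrs (y base)" using step y nbrs_sym by metis
    then obtain w where w: "w \<in> nbrs base" "v = y w"
      using aut_nbrs[OF y(1) base] by (auto simp: bij_betw_def)
    obtain z where z: "z \<in> carrier G" "z base = base" "z b = w"
      using arc_transitive[OF b w(1)] .
    \<comment> \<open>\<open>s\<close> takes \<open>base\<close> to \<open>b\<close>, the stabilizer
      element \<open>z\<close> takes \<open>b\<close> to \<open>w\<close>, and \<open>y\<close>
      takes \<open>w\<close> to \<open>v\<close>.\<close>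
    let ?t = "y \<cdot> (z \<cdot> s)"
    have "distr haar haar (\<lambda>g. g \<cdot> ?t) = haar"
      by (intro haar_right_invariant_mult y z s G.m_closed K_inv s_inv)
    moreover have "?t base = v"
      using y z s w b base nbrs_in_V by (simp add: mult_apply)
    ultimately show ?case using y z s by (intro bexI[of _ ?t]) auto
  qed
  then obtain y where y: "y \<in> carrier G" "y base = x base" "distr haar haar (\<lambda>g. g \<cdot> y) = haar"
    using aut_in_V[OF x base] by blast
  let ?z = "ginv y \<cdot> x"
  have "?z base = base" using y x base inv_apply[OF y(1) base] by (simp add: mult_apply)
  then have "distr haar haar (\<lambda>g. g \<cdot> (y \<cdot> ?z)) = haar"
    using y(1,3) x K_inv[of ?z] haar_right_invariant_mult[of y ?z] by simp
  moreover have "y \<cdot> ?z = x" using x y by (simp add: G.m_assoc[symmetric])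
  ultimately show ?thesis by simp
qed

text \<open>All these sets are left translates of the stabilizer of \<open>base\<close>, which has
  mass 1 by normalization.\<close>

lemma haar_transporter:
  assumes w: "w \<in> V"
  shows "emeasure haar {g \<in> carrier G. g base = w} = 1"
proof -
  obtain x where x: "x \<in> carrier G" "x base = w" using vertex_transitive[OF base w] .
  have F: "frame {base}" using base by (simp add: frame_def)
  have "haar_content (stab base) = 1"
    using haar_content_eq[OF stab_compact_open(1) stab_compact_open(2)[OF F] F]
      card_restrictions_pos[OF stab_compact_open(1) _ F] one_apply[OF base]
    by (auto simp: rel_index_def stab_def)
  then have "1 = emeasure haar (stab base)" using emeasure_haar[OF stab_compact_open(1)] by simp
  also have "(\<lambda>g. x \<cdot> g) -` {g \<in> carrier G. g base = w} \<inter> space haar = stab base"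
    using x base aut_inj[OF x(1) aut_in_V[OF _ base] base] by (auto simp: stab_def space_haar mult_apply)
  then have "emeasure haar (stab base) = emeasure (distr haar haar (\<lambda>g. x \<cdot> g)) {g \<in> carrier G. g base = w}"
    using open_sets_haar[OF compact_open_open[OF transporter_compact_open[OF w]]]
    by (simp add: emeasure_distr continuous_measurable_haar continuous_left_translation[OF x(1)])
  finally show ?thesis using haar_left_invariant[OF x(1)] by simp
qed

end

section \<open>A discrete group acting on a leveled tree\<close>

locale leveled_lattice = leveled_tree k V E e + based_regular_tree k V E base
  for k :: nat and V :: "'v set" and E and e and base +
  fixes l :: "'v \<Rightarrow> int" and idx :: "'v \<Rightarrow> 'v \<Rightarrow> int"
  assumes leveling: "leveling l idx"
begin

text \<open>The germ is existentially quantified because \<open>g\<close> does not determine it: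
  irrelevant entries and multiples of \<open>q\<close> are free.\<close>

definition \<Gamma> :: "('v \<Rightarrow> 'v) set" where
  "\<Gamma> = {g \<in> carrier G. \<exists>h. leveled_iso l idx l idx g h}"

lemma \<Gamma>_carrier: "g \<in> \<Gamma> \<Longrightarrow> g \<in> carrier G"
  by (simp add: \<Gamma>_def)

lemma \<Gamma>_level: "g \<in> \<Gamma> \<Longrightarrow> v \<in> V \<Longrightarrow> l (g v) = l v"
  by (auto simp: \<Gamma>_def leveled_iso_def)

lemma leveled_isoD:
  assumes "leveled_iso l idx l' idx' g h"
  shows "v \<in> V \<Longrightarrow> l' (g v) = l v"
    and "w \<in> nbrs v \<Longrightarrow> x < ht (l v) (l w) \<Longrightarrow> h v x mod q = h w x mod q"
    and "w \<in> minor l v \<Longrightarrow> idx' (g v) (g w) mod q = (idx v w + h v (low (l v))) mod q"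
  using assms by (auto simp: leveled_iso_def)

section \<open>Group structure, transitivity and rigidity of \<open>\<Gamma>\<close>\<close>

lemma aut_minor:
  assumes g: "g \<in> carrier G" "leveled_iso l idx l idx g h" and w: "w \<in> minor l v"
  shows "g w \<in> minor l (g v)"
  using w leveled_isoD(1)[OF g(2)] aut_nbr_iff[OF g(1)] nbrs_in_V by (auto simp: minor_def)

lemma leveled_iso_one: "leveled_iso l idx l idx (\<one>\<^bsub>G\<^esub>) (\<lambda>_ _. 0)"
  using one_apply nbrs_in_V by (auto simp: leveled_iso_def minor_def)

text \<open>The chain rule for germs, with the vertex groups written additively.\<close>

lemma leveled_iso_mult:
  assumes g: "g \<in> carrier G" "leveled_iso l idx l idx g h"
    and g': "g' \<in> carrier G" "leveled_iso l idx l idx g' h'"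
  shows "leveled_iso l idx l idx (g \<cdot> g') (\<lambda>v x. h (g' v) x + h' v x)"
  unfolding leveled_iso_def
proof (intro conjI ballI allI impI)
  fix v assume "v \<in> V"
  then show "l ((g \<cdot> g') v) = l v"
    using leveled_isoD(1)[OF g(2)] leveled_isoD(1)[OF g'(2)] g g' aut_in_V by (simp add: mult_apply)
next
  fix v w x assume w: "w \<in> nbrs v" and x: "x < ht (l v) (l w)"
  have V: "v \<in> V" "w \<in> V" using w nbrs_in_V by auto
  have "h (g' v) x mod q = h (g' w) x mod q"
    using leveled_isoD(2)[OF g(2), of "g' w" "g' v" x] x w V aut_nbr_iff[OF g'(1)]
      leveled_isoD(1)[OF g'(2)] by simp
  moreover have "h' v x mod q = h' w x mod q" using leveled_isoD(2)[OF g'(2) w x] .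
  ultimately show "(h (g' v) x + h' v x) mod q = (h (g' w) x + h' w x) mod q"
    by (rule mod_add_cong)
next
  fix v w assume w: "w \<in> minor l v"
  have V: "v \<in> V" "w \<in> V" using w nbrs_in_V by (auto simp: minor_def)
  have "idx (g (g' v)) (g (g' w)) mod q = (idx (g' v) (g' w) + h (g' v) (low (l v))) mod q"
    using leveled_isoD(3)[OF g(2) aut_minor[OF g' w]] leveled_isoD(1)[OF g'(2) V(1)] by simp
  also have "\<dots> = (idx v w + h' v (low (l v)) + h (g' v) (low (l v))) mod q"
    using leveled_isoD(3)[OF g'(2) w] by (rule mod_add_cong) simp
  finally show "idx ((g \<cdot> g') v) ((g \<cdot> g') w) mod q =
      (idx v w + (h (g' v) (low (l v)) + h' v (low (l v)))) mod q"
    using V g g' by (simp add: mult_apply algebra_simps)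
qed

lemma leveled_iso_inv:
  assumes g: "g \<in> carrier G" "leveled_iso l idx l idx g h"
  shows "leveled_iso l idx l idx (ginv g) (\<lambda>v x. - h ((ginv g) v) x)"
proof -
  let ?g = "ginv g"
  have gc: "?g \<in> carrier G" using g by simp
  have lev: "l (?g v) = l v" if "v \<in> V" for v
    using leveled_isoD(1)[OF g(2), of "?g v"] apply_inv[OF g(1) that] aut_in_V[OF gc that] by simp
  show ?thesis
    unfolding leveled_iso_def
  proof (intro conjI ballI allI impI)
    fix v w x assume w: "w \<in> nbrs v" and x: "x < ht (l v) (l w)"
    have V: "v \<in> V" "w \<in> V" using w nbrs_in_V by auto
    have "h (?g v) x mod q = h (?g w) x mod q"
      using leveled_isoD(2)[OF g(2), of "?g w" "?g v" x] x w V aut_nbr_iff[OF gc] lev by simp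
    then show "- h (?g v) x mod q = - h (?g w) x mod q" by (rule mod_minus_cong)
  next
    fix v w assume w: "w \<in> minor l v"
    have V: "v \<in> V" "w \<in> V" using w nbrs_in_V by (auto simp: minor_def)
    have "?g w \<in> minor l (?g v)"
      using w lev V aut_nbr_iff[OF gc] by (simp add: minor_def)
    from leveled_isoD(3)[OF g(2) this]
    have "idx v w mod q = (idx (?g v) (?g w) + h (?g v) (low (l v))) mod q"
      using apply_inv[OF g(1)] V lev by simp
    from mod_diff_cong[OF this, of "h (?g v) (low (l v))" "h (?g v) (low (l v))"]
    show "idx (?g v) (?g w) mod q = (idx v w + - h (?g v) (low (l v))) mod q" by simp
  qed (use lev in auto)
qed

lemma subgroup_\<Gamma>: "subgroup \<Gamma> G"
proof (rule G.subgroupI)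
  show "\<Gamma> \<subseteq> carrier G" using \<Gamma>_carrier by blast
  show "\<Gamma> \<noteq> {}" using leveled_iso_one by (auto simp: \<Gamma>_def)
  show "ginv g \<in> \<Gamma>" if "g \<in> \<Gamma>" for g
    using that leveled_iso_inv by (auto simp: \<Gamma>_def)
  show "g \<cdot> g' \<in> \<Gamma>" if "g \<in> \<Gamma>" "g' \<in> \<Gamma>" for g g'
    using that leveled_iso_mult unfolding \<Gamma>_def by blast
qed

lemma \<Gamma>_edge_transitive:
  assumes w: "w \<in> nbrs v" "w' \<in> nbrs v'" "l v = l v'" "l w = l w'"
  obtains g where "g \<in> \<Gamma>" "g v = v'" "g w = w'"
proof -
  have V: "v \<in> V" "v' \<in> V" "w \<in> V" using w nbrs_in_V by auto
  \<comment> \<open>All entries of the germ at \<open>v\<close> are set to the label difference, so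
    that the top one, wherever it sits, rotates \<open>w\<close> to \<open>w'\<close> if
    \<open>w\<close> is a minor neighbour.\<close>
  obtain g h where gh: "leveled_iso l idx l idx g h"
    "\<And>v. v \<in> V \<Longrightarrow> g v \<in> V" "\<And>v. v \<in> V \<Longrightarrow> bij_betw g (nbrs v) (nbrs (g v))"
    "g v = v'" "h v = (\<lambda>_. idx v' w' - idx v w)"
    by (rule leveled_iso_exists[OF leveling leveling V(1,2) w(3)[symmetric],
          of "\<lambda>_. idx v' w' - idx v w"]) blast
  have gw: "g w \<in> nbrs v'" "l (g w) = l w"
    using gh(3)[OF V(1)] gh(4) w(1) leveled_isoD(1)[OF gh(1) V(3)] by (auto simp: bij_betw_def)
  have "g w = w'"
  proof (cases "l w = mnr (l v)")
    case True
    then have "w \<in> minor l v" "g w \<in> minor l v'" "w' \<in> minor l v'" using w gw by (auto simp: minor_def)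
    then show ?thesis
      using idx_cong_imp_eq[OF leveling V(2), of "g w" w'] leveled_isoD(3)[OF gh(1), of w v] gh(4,5)
      by simp
  next
    case False
    then have "l w = maj (l v)" using levelingD(1)[OF leveling w(1)] by blast
    then show ?thesis using levelingD(2)[OF leveling V(2)] gw w by auto
  qed
  moreover have "leveled_iso l idx l idx (restrict g V) h"
    unfolding leveled_iso_def
  proof (intro conjI ballI allI impI)
    fix u t assume t: "t \<in> minor l u"
    then have "u \<in> V" "t \<in> V" using nbrs_in_V by (auto simp: minor_def)
    then show "idx (restrict g V u) (restrict g V t) mod q = (idx u t + h u (low (l u))) mod q"
      using leveled_isoD(3)[OF gh(1) t] by simp
  qed (use leveled_isoD(1,2)[OF gh(1)] in auto)
  ultimately show thesis
    using that[of "restrict g V"] local_bijection_aut[of g, OF gh(2,3)] V gh(4) by (auto simp: \<Gamma>_def)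
qed

lemma \<Gamma>_vertex_transitive:
  assumes v: "v \<in> V" "v' \<in> V" "l v = l v'"
  obtains g where "g \<in> \<Gamma>" "g v = v'"
proof -
  obtain w w' where "w \<in> nbrs v" "w' \<in> nbrs v'" "l w = maj (l v)" "l w' = maj (l v')"
    using levelingD(2)[OF leveling] v by blast
  then show thesis using \<Gamma>_edge_transitive[of w v w' v'] v(3) that by metis
qed

text \<open>Rigidity: the image and the relevant germ entries spread from \<open>v\<close> along
  every edge. Entries below the height of the edge are passed on by compatibility; a further top
  entry arises only over a minor parent and is read off from the rotation that takes this parent to
  its known image.\<close>

lemma leveled_iso_unique:
  assumes g: "g \<in> carrier G" "leveled_iso l idx l idx g h"
    and g': "g' \<in> carrier G" "leveled_iso l idx l idx g' h'"
    and v: "v \<in> V" "g v = g' v" "\<And>x. x \<le> low (l v) \<Longrightarrow> h v x mod q = h' v x mod q"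
  shows "g = g'"
proof (rule aut_ext[OF g(1) g'(1)])
  have "g u = g' u \<and> (\<forall>x\<le>low (l u). h u x mod q = h' u x mod q)" if "u \<in> V" for u
    using v(1) that
  proof (induction rule: dist_induct)
    case (step u)
    let ?p = "parent v u"
    have up: "u \<in> nbrs ?p" "?p \<in> nbrs u" using step nbrs_sym by blast+
    have lev: "l (g u) = l u" "l (g' u) = l u" "l (g ?p) = l ?p" "l (g' ?p) = l ?p"
      using leveled_isoD(1)[OF g(2)] leveled_isoD(1)[OF g'(2)] step by auto
    have nb: "g u \<in> nbrs (g ?p)" "g' u \<in> nbrs (g ?p)"
      using up step aut_nbr_iff[OF g(1), of u ?p] aut_nbr_iff[OF g'(1), of u ?p] by auto
    have gpV: "g ?p \<in> V" using aut_in_V[OF g(1)] step by blast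
    have gu: "g u = g' u"
    proof (cases "l u = mnr (l ?p)")
      case True
      then have m: "u \<in> minor l ?p" "g u \<in> minor l (g ?p)" "g' u \<in> minor l (g ?p)"
        using up lev nb by (auto simp: minor_def)
      have "idx (g ?p) (g u) mod q = (idx ?p u + h ?p (low (l ?p))) mod q"
        by (rule leveled_isoD(3)[OF g(2) m(1)])
      also have "\<dots> = (idx ?p u + h' ?p (low (l ?p))) mod q"
        using step by (intro mod_add_cong) auto
      also have "\<dots> = idx (g ?p) (g' u) mod q"
        using leveled_isoD(3)[OF g'(2) m(1)] step by simp
      finally show ?thesis using idx_cong_imp_eq[OF leveling gpV m(2,3)] by blast
    next
      case False
      then have "l u = maj (l ?p)" using levelingD(1)[OF leveling up(1)] by blast
      then show ?thesis using levelingD(2)[OF leveling gpV] nb lev by auto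
    qed
    have "h u x mod q = h' u x mod q" if x: "x \<le> low (l u)" for x
    proof (cases "x < ht (l u) (l ?p)")
      case True
      have "x \<le> low (l ?p)"
        using True levelingD(1)[OF leveling up(1)] ht_maj[of "l ?p"] ht_mnr[of "l ?p"]
          ht_sym[of "l u" "l ?p"] by auto
      then show ?thesis
        using leveled_isoD(2)[OF g(2) up(2) True] leveled_isoD(2)[OF g'(2) up(2) True] step by simp
    next
      case False
      then have p: "l ?p = mnr (l u)" "x = low (l u)"
        using levelingD(1)[OF leveling up(2)] ht_maj[of "l u"] ht_mnr[of "l u"] x by auto
      then have m: "?p \<in> minor l u" using up by (simp add: minor_def)
      have "(idx u ?p + h u x) mod q = (idx u ?p + h' u x) mod q"
        using leveled_isoD(3)[OF g(2) m] leveled_isoD(3)[OF g'(2) m] gu step p by simp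
      from mod_diff_cong[OF this refl, of "idx u ?p"] show ?thesis by simp
    qed
    then show ?case using gu by blast
  qed (use v in auto)
  then show "g u = g' u" if "u \<in> V" for u using that by blast
qed

definition transporter :: "'v \<Rightarrow> 'v \<Rightarrow> ('v \<Rightarrow> 'v) set" where
  "transporter v w = {g \<in> \<Gamma>. g v = w}"

text \<open>By rigidity an element is determined by the image of \<open>v\<close> and the
  \<open>Suc (low (l v))\<close> relevant germ entries at \<open>v\<close>, each of which has
  \<open>q\<close> possible values.\<close>

lemma finite_transporter:
  assumes v: "v \<in> V"
  shows "finite (transporter v w)"
proof -
  define h where "h = (\<lambda>g. SOME h. leveled_iso l idx l idx g h)"
  have h: "leveled_iso l idx l idx g (h g)" if "g \<in> \<Gamma>" for g
    using that someI_ex[of "leveled_iso l idx l idx g"] by (auto simp: \<Gamma>_def h_def)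
  define f where "f = (\<lambda>g. \<lambda>x\<in>{..low (l v)}. h g v x mod q)"
  have "f ` transporter v w \<subseteq> PiE {..low (l v)} (\<lambda>_. {0..<q})"
    unfolding f_def using q_pos by (intro image_subsetI) (simp only: restrict_PiE_iff, simp)
  then have "finite (f ` transporter v w)"
    by (rule finite_subset) (auto intro: finite_PiE)
  moreover have "inj_on f (transporter v w)"
  proof (rule inj_onI)
    fix g g' assume g: "g \<in> transporter v w" "g' \<in> transporter v w" and eq: "f g = f g'"
    then have g\<Gamma>: "g \<in> \<Gamma>" "g' \<in> \<Gamma>" "g v = g' v" by (auto simp: transporter_def)
    have "h g v x mod q = h g' v x mod q" if "x \<le> low (l v)" for x
      using fun_cong[OF eq, of x] that by (simp add: f_def)
    then show "g = g'"
      using leveled_iso_unique[OF \<Gamma>_carrier[OF g\<Gamma>(1)] h[OF g\<Gamma>(1)] \<Gamma>_carrier[OF g\<Gamma>(2)] h[OF g\<Gamma>(2)] v g\<Gamma>(3)]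
      by blast
  qed
  ultimately show ?thesis by (rule finite_imageD)
qed

section \<open>Orders of stabilizers and the weights of the levels\<close>

lemma \<Gamma>_mult: "g \<in> \<Gamma> \<Longrightarrow> g' \<in> \<Gamma> \<Longrightarrow> g \<cdot> g' \<in> \<Gamma>"
  and \<Gamma>_inv: "g \<in> \<Gamma> \<Longrightarrow> ginv g \<in> \<Gamma>"
  using subgroup.m_closed[OF subgroup_\<Gamma>] subgroup.m_inv_closed[OF subgroup_\<Gamma>] by auto

text \<open>\<open>P\<close> and \<open>Q\<close> let the translation by \<open>g\<close> carry a
  side condition, such as a prescribed image of a neighbour.\<close>

lemma card_transporter_left:
  assumes v: "v \<in> V" and g: "g \<in> \<Gamma>" and P: "\<And>s. s \<in> \<Gamma> \<Longrightarrow> s v = v \<Longrightarrow> P (g \<cdot> s) \<longleftrightarrow> Q s"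
  shows "card {s \<in> transporter v (g v). P s} = card {s \<in> transporter v v. Q s}"
proof -
  have gc: "g \<in> carrier G" using g \<Gamma>_carrier by blast
  have "bij_betw (\<lambda>s. g \<cdot> s) {s \<in> transporter v v. Q s} {s \<in> transporter v (g v). P s}"
  proof (rule bij_betw_byWitness[where f' = "\<lambda>s. ginv g \<cdot> s"])
    show "\<forall>s\<in>{s \<in> transporter v v. Q s}. ginv g \<cdot> (g \<cdot> s) = s"
      using gc \<Gamma>_carrier by (auto simp: transporter_def G.m_assoc[symmetric])
    have r: "g \<cdot> (ginv g \<cdot> s) = s" if "s \<in> \<Gamma>" for s
      using gc \<Gamma>_carrier that by (auto simp: G.m_assoc[symmetric])
    then show "\<forall>s\<in>{s \<in> transporter v (g v). P s}. g \<cdot> (ginv g \<cdot> s) = s"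
      by (auto simp: transporter_def)
    show "(\<lambda>s. g \<cdot> s) ` {s \<in> transporter v v. Q s} \<subseteq> {s \<in> transporter v (g v). P s}"
      using gc \<Gamma>_carrier g v P by (auto simp: transporter_def \<Gamma>_mult mult_apply)
    show "(\<lambda>s. ginv g \<cdot> s) ` {s \<in> transporter v (g v). P s} \<subseteq> {s \<in> transporter v v. Q s}"
    proof
      fix t assume "t \<in> (\<lambda>s. ginv g \<cdot> s) ` {s \<in> transporter v (g v). P s}"
      then obtain s where s: "s \<in> \<Gamma>" "s v = g v" "P s" "t = ginv g \<cdot> s"
        by (auto simp: transporter_def)
      have "t \<in> \<Gamma>" using s g by (simp add: \<Gamma>_mult \<Gamma>_inv)
      moreover have "t v = v"
        using s gc \<Gamma>_carrier[OF s(1)] v inv_apply[OF gc v] by (simp add: mult_apply)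
      moreover have "P (g \<cdot> t)" using r[OF s(1)] s by simp
      ultimately show "t \<in> {s \<in> transporter v v. Q s}" using P by (auto simp: transporter_def)
    qed
  qed
  from bij_betw_same_card[OF this] show ?thesis by simp
qed

lemma card_transporter_right:
  assumes v: "v \<in> V" "v' \<in> V" "l v = l v'"
  shows "card (transporter v v') = card (transporter v' v')"
proof -
  obtain g where g: "g \<in> \<Gamma>" "g v = v'" using \<Gamma>_vertex_transitive[OF v] .
  have gc: "g \<in> carrier G" "ginv g \<in> carrier G" using g \<Gamma>_carrier by auto
  have gi: "(ginv g) v' = v" using inv_apply[OF gc(1) v(1)] g by simp
  have "bij_betw (\<lambda>s. s \<cdot> g) (transporter v' v') (transporter v v')"
    by (rule bij_betw_byWitness[where f' = "\<lambda>s. s \<cdot> ginv g"])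
       (use gc \<Gamma>_carrier g v gi in \<open>auto simp: transporter_def \<Gamma>_mult \<Gamma>_inv mult_apply G.m_assoc\<close>)
  from bij_betw_same_card[OF this] show ?thesis by simp
qed

lemma card_transporter_eq:
  assumes v: "v \<in> V" "v' \<in> V" "l v = l v'"
  shows "card (transporter v v') = card (transporter v v)"
proof -
  obtain g where g: "g \<in> \<Gamma>" "g v = v'" using \<Gamma>_vertex_transitive[OF v] .
  show ?thesis using card_transporter_left[OF v(1) g(1), of "\<lambda>_. True" "\<lambda>_. True"] g(2) by simp
qed

text \<open>The stabilizer of \<open>v\<close> permutes the neighbours at the level of
  \<open>w\<close>, transitively by \<open>\<Gamma>_edge_transitive\<close>, so the parts sending
  \<open>w\<close> to different neighbours are translates of each other.\<close>

lemma orbit_stabilizer: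
  assumes w: "w \<in> nbrs v"
  shows "card (transporter v v) =
    card {g \<in> transporter v v. g w = w} * card {u \<in> nbrs v. l u = l w}"
proof -
  have V: "v \<in> V" "w \<in> V" using w nbrs_in_V by auto
  let ?N = "{u \<in> nbrs v. l u = l w}"
  have "g w \<in> ?N" if "g \<in> transporter v v" for g
  proof -
    have "g \<in> \<Gamma>" "g v = v" using that by (auto simp: transporter_def)
    then show ?thesis
      using w aut_nbr_iff[OF \<Gamma>_carrier, of g w v] \<Gamma>_level[of g w] V by simp
  qed
  then have "transporter v v = (\<Union>u\<in>?N. {g \<in> transporter v v. g w = u})" by blast
  then have "card (transporter v v) = card (\<Union>u\<in>?N. {g \<in> transporter v v. g w = u})"
    by (rule arg_cong)
  also have "\<dots> = (\<Sum>u\<in>?N. card {g \<in> transporter v v. g w = u})"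
    using finite_nbrs[OF V(1)] finite_transporter[OF V(1)] by (intro card_UN_disjoint) auto
  also have "\<dots> = (\<Sum>u\<in>?N. card {g \<in> transporter v v. g w = w})"
  proof (rule sum.cong)
    fix u assume "u \<in> ?N"
    then have u: "u \<in> nbrs v" "l w = l u" by auto
    obtain g where g: "g \<in> \<Gamma>" "g v = v" "g w = u"
      by (rule \<Gamma>_edge_transitive[OF w u(1) refl u(2)])
    have gc: "g \<in> carrier G" using g \<Gamma>_carrier by blast
    have "(g \<cdot> s) w = u \<longleftrightarrow> s w = w" if "s \<in> \<Gamma>" for s
      using aut_inj[OF gc aut_in_V[OF \<Gamma>_carrier[OF that] V(2)] V(2)] \<Gamma>_carrier[OF that] g(3) gc V
      by (simp add: mult_apply)
    then show "card {g \<in> transporter v v. g w = u} = card {g \<in> transporter v v. g w = w}"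
      using card_transporter_left[OF V(1) g(1), of "\<lambda>s. s w = u" "\<lambda>s. s w = w"] g(2) by simp
  qed simp
  finally show ?thesis by simp
qed

text \<open>The number of neighbours at level \<open>j\<close> of a vertex at level
  \<open>i\<close>; meaningful only if \<open>j\<close> is \<open>maj i\<close> or
  \<open>mnr i\<close>.\<close>

definition deg :: "int \<Rightarrow> int \<Rightarrow> nat" where
  "deg i j = (if j = maj i then 1 else k - 1)"

lemma card_level_nbrs:
  assumes v: "v \<in> V" and j: "j = maj (l v) \<or> j = mnr (l v)"
  shows "card {u \<in> nbrs v. l u = j} = deg (l v) j"
proof (cases "j = maj (l v)")
  case True
  then obtain u where "u \<in> nbrs v" "l u = j" "\<And>w. w \<in> nbrs v \<Longrightarrow> l w = j \<Longrightarrow> w = u"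
    using levelingD(2)[OF leveling v] by blast
  then have "{u \<in> nbrs v. l u = j} = {u}" by blast
  then show ?thesis using True by (simp add: deg_def)
next
  case False
  then have "{u \<in> nbrs v. l u = j} = minor l v" using j by (auto simp: minor_def)
  then show ?thesis
    using bij_betw_same_card[OF levelingD(3)[OF leveling v]] False k_gt_2 by (simp add: deg_def)
qed

lemma level_nbr_exists:
  assumes v: "v \<in> V" and j: "j = maj (l v) \<or> j = mnr (l v)"
  shows "\<exists>w\<in>nbrs v. l w = j"
proof -
  have "card {u \<in> nbrs v. l u = j} > 0"
    using card_level_nbrs[OF v j] k_gt_2 by (simp add: deg_def)
  then show ?thesis by (auto simp: card_gt_0_iff)
qed

lemma level_surj: "\<exists>v\<in>V. l v = i"
proof -
  have "\<exists>v\<in>V. l v = l base + d" for d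
  proof (induction d rule: int_induct[of _ 0])
    case base
    then show ?case using based_regular_tree.base[OF based_regular_tree_axioms] by auto
  next
    case (step1 d)
    then obtain v where v: "v \<in> V" "l v = l base + d" by blast
    have "l v + 1 = maj (l v) \<or> l v + 1 = mnr (l v)" by (simp add: maj_or_mnr_iff)
    from level_nbr_exists[OF v(1) this] show ?case using v nbrs_in_V by (auto simp: add.assoc)
  next
    case (step2 d)
    then obtain v where v: "v \<in> V" "l v = l base + d" by blast
    have "l v - 1 = maj (l v) \<or> l v - 1 = mnr (l v)" by (simp add: maj_or_mnr_iff)
    from level_nbr_exists[OF v(1) this] obtain w where "w \<in> nbrs v" "l w = l v - 1" by blast
    then show ?case using v nbrs_in_V by (intro bexI[of _ w]) auto
  qed
  from this[of "i - l base"] show ?thesis by simp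
qed

definition rep :: "int \<Rightarrow> 'v" where
  "rep i = (SOME v. v \<in> V \<and> l v = i)"

lemma rep: "rep i \<in> V" "l (rep i) = i"
  using someI_ex[of "\<lambda>v. v \<in> V \<and> l v = i"] level_surj unfolding rep_def by auto

text \<open>The contribution of one vertex orbit to the covolume; each level is a single orbit of
  \<open>\<Gamma>\<close>, so the choice of representative is immaterial.\<close>

definition weight :: "int \<Rightarrow> real" where
  "weight i = 1 / real (card (transporter (rep i) (rep i)))"

lemma card_transporter_pos:
  assumes "v \<in> V"
  shows "card (transporter v v) > 0"
proof -
  have "\<one>\<^bsub>G\<^esub> \<in> transporter v v"
    using subgroup.one_closed[OF subgroup_\<Gamma>] one_apply[OF assms] by (simp add: transporter_def)
  then show ?thesis using finite_transporter[OF assms] by (auto simp: card_gt_0_iff)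
qed

lemma weight_pos: "weight i > 0"
  using card_transporter_pos[OF rep(1)] by (simp add: weight_def)

lemma card_stab_level:
  assumes "v \<in> V"
  shows "card (transporter v v) = card (transporter (rep (l v)) (rep (l v)))"
  using card_transporter_right[OF assms rep(1)[of "l v"]] card_transporter_eq[OF assms rep(1)[of "l v"]] rep(2)
  by simp

text \<open>Both sides are the reciprocal of the order of the stabilizer of an edge between the two
  levels.\<close>

lemma weight_balance: "weight i * real (deg i (i + 1)) = weight (i + 1) * real (deg (i + 1) i)"
proof -
  define v where "v = rep i"
  have v: "v \<in> V" "l v = i" using rep by (auto simp: v_def)
  have j: "i + 1 = maj (l v) \<or> i + 1 = mnr (l v)" by (simp add: maj_or_mnr_iff v)
  obtain w where w: "w \<in> nbrs v" "l w = i + 1" using level_nbr_exists[OF v(1) j] by blast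
  have wV: "w \<in> V" "v \<in> nbrs w" using w nbrs_in_V nbrs_sym by blast+
  have j': "i = maj (l w) \<or> i = mnr (l w)" by (simp add: maj_or_mnr_iff w)
  let ?c = "card {g \<in> transporter v v. g w = w}"
  have 1: "card (transporter v v) = ?c * deg i (i + 1)"
    using orbit_stabilizer[OF w(1)] card_level_nbrs[OF v(1) j] v w by simp
  have "{g \<in> transporter v v. g w = w} = {g \<in> transporter w w. g v = v}"
    by (auto simp: transporter_def)
  then have 2: "card (transporter w w) = ?c * deg (i + 1) i"
    using orbit_stabilizer[OF wV(2)] card_level_nbrs[OF wV(1) j'] v w by simp
  have W: "weight i = 1 / real (card (transporter v v))" "weight (i + 1) = 1 / real (card (transporter w w))"
    using card_stab_level[OF v(1)] card_stab_level[OF wV(1)] v w by (simp_all add: weight_def)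
  have "card (transporter v v) > 0" "card (transporter w w) > 0"
    using card_transporter_pos v wV by auto
  then have "?c > 0" "deg i (i + 1) > 0" "deg (i + 1) i > 0" using 1 2 by auto
  then show ?thesis unfolding W unfolding 1 2 by (simp add: field_simps)
qed

text \<open>A first-order recurrence, solved once and applied twice: to the weights of
  \<open>\<Gamma>\<close> and to the level masses of an arbitrary invariant measure.\<close>

lemma balanced_weights:
  fixes f :: "int \<Rightarrow> real"
  assumes bal: "\<And>i. f i * real (deg i (i + 1)) = f (i + 1) * real (deg (i + 1) i)"
  shows "f i = f 0 * q ^ Suc (low 0) / q ^ Suc (low i)"
proof -
  have q0: "real_of_int q > 0" using q_pos by simp
  \<comment> \<open>Multiplied by \<open>q ^ e i\<close>, the two degrees become the orders of the
    vertex groups at both ends, and the balance says that \<open>f i * q ^ Suc (low i)\<close> does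
    not depend on \<open>i\<close>.\<close>
  have deg: "real (deg i (i + 1)) * q ^ e i = q ^ Suc (low i)"
    "real (deg (i + 1) i) * q ^ e i = q ^ Suc (low (i + 1))" for i
  proof -
    have k: "real (k - Suc 0) = real k - 1" using k_gt_2 by simp
    show "real (deg i (i + 1)) * q ^ e i = q ^ Suc (low i)"
      using e_step'[of i] by (auto simp: deg_def maj_def low_def k)
    show "real (deg (i + 1) i) * q ^ e i = q ^ Suc (low (i + 1))"
      using e_step[of i] by (auto simp: deg_def maj_def low_def k)
  qed
  have step: "f i * q ^ Suc (low i) = f (i + 1) * q ^ Suc (low (i + 1))" for i
    by (simp only: deg(1)[of i, symmetric] deg(2)[of i, symmetric] mult.assoc[symmetric] bal)
  have "f i * q ^ Suc (low i) = f 0 * q ^ Suc (low 0)"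
  proof (induction i rule: int_induct[of _ 0])
    case (step1 i)
    then show ?case by (simp only: step[of i, symmetric])
  next
    case (step2 i)
    then show ?case using step[of "i - 1"] by (simp only: diff_add_cancel)
  qed (rule refl)
  then show ?thesis using q0 by (simp add: field_simps)
qed

end

section \<open>Regularity of finite Borel measures\<close>

lemma open_in_borel_sets_of: "openin X U \<Longrightarrow> U \<in> borel_sets_of X"
  by (auto simp: borel_sets_of_def intro: sigma_sets.Basic)

lemma closed_in_borel_sets_of:
  assumes "closedin X C"
  shows "C \<in> borel_sets_of X"
proof -
  have "topspace X - C \<in> borel_sets_of X" using assms by (intro open_in_borel_sets_of) auto
  then have "topspace X - (topspace X - C) \<in> borel_sets_of X"
    unfolding borel_sets_of_def by (rule sigma_sets.Compl)
  then show ?thesis using closedin_subset[OF assms] by (simp add: double_diff)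
qed

lemma (in finite_measure) finite_union_exhausts:
  fixes C :: "nat \<Rightarrow> 'a set"
  assumes C: "range C \<subseteq> sets M" and \<epsilon>: "\<epsilon> > 0"
  shows "\<exists>n. measure M ((\<Union>i. C i) - (\<Union>i\<le>n. C i)) < \<epsilon>"
proof -
  define D where "D = (\<lambda>n. (\<Union>i. C i) - (\<Union>i\<le>n. C i))"
  have "(\<Union>i. C i) \<in> sets M" by (rule sets.countable_UN) (use C in auto)
  moreover have "(\<Union>i\<le>n. C i) \<in> sets M" for n by (rule sets.finite_UN) (use C in auto)
  ultimately have "range D \<subseteq> sets M" unfolding D_def by blast
  moreover have "decseq D" by (force simp: D_def decseq_def)
  moreover have "(\<Inter>n. D n) = {}" by (auto simp: D_def)
  ultimately have "(\<lambda>n. measure M (D n)) \<longlonglongrightarrow> 0"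
    using finite_Lim_measure_decseq[of D] by simp
  then have "eventually (\<lambda>n. measure M (D n) < \<epsilon>) sequentially"
    using \<epsilon> by (rule order_tendstoD(2))
  then show ?thesis unfolding D_def by (auto simp: eventually_sequentially)
qed

text \<open>The sets with such approximations form a sigma-algebra. The countable closed family
  makes every open set a countable union of closed sets, and finiteness of the measure allows such a
  union to be cut off.\<close>

lemma (in finite_measure) borel_approximation:
  assumes sp: "space M = topspace X" and st: "sets M = borel_sets_of X"
    and C: "countable \<C>" "\<And>C. C \<in> \<C> \<Longrightarrow> closedin X C"
    and base: "\<And>U. openin X U \<Longrightarrow> \<exists>\<U>\<subseteq>\<C>. U = \<Union>\<U>"
    and A: "A \<in> sets M" and \<epsilon>: "\<epsilon> > 0"
  shows "\<exists>C U. closedin X C \<and> openin X U \<and> C \<subseteq> A \<and> A \<subseteq> U \<and> measure M (U - C) < \<epsilon>"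
proof -
  have op: "U \<in> sets M" if "openin X U" for U using that st open_in_borel_sets_of by blast
  have cl: "C \<in> sets M" if "closedin X C" for C using that st closed_in_borel_sets_of by blast
  have "A \<in> sigma_sets (topspace X) {U. openin X U}" using A st by (simp add: borel_sets_of_def)
  then show ?thesis using \<epsilon>
  proof (induction A arbitrary: \<epsilon>)
    case (Basic U)
    then have U: "openin X U" by simp
    then obtain \<U> where \<U>: "\<U> \<subseteq> \<C>" "U = \<Union>\<U>" using base by blast
    show ?case
    proof (cases "\<U> = {}")
      case True
      then show ?thesis using Basic.prems \<U> by (intro exI[of _ "{}"]) simp
    next
      case False
      have "countable \<U>" using C(1) \<U>(1) countable_subset by blast
      then have rng: "range (from_nat_into \<U>) = \<U>" using False by (rule range_from_nat_into[rotated])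
      have cln: "closedin X (from_nat_into \<U> i)" for i using rng C(2) \<U>(1) by blast
      obtain n where n: "measure M ((\<Union>i. from_nat_into \<U> i) - (\<Union>i\<le>n. from_nat_into \<U> i)) < \<epsilon>"
        using finite_union_exhausts[of "from_nat_into \<U>" \<epsilon>] cln cl Basic.prems by blast
      have UU: "(\<Union>i. from_nat_into \<U> i) = U" using rng \<U>(2) by simp
      have "closedin X (\<Union>i\<le>n. from_nat_into \<U> i)" by (rule closedin_Union) (use cln in auto)
      then show ?thesis using n U UU
        by (intro exI[of _ "\<Union>i\<le>n. from_nat_into \<U> i"] exI[of _ U]) auto
    qed
  next
    case Empty
    then show ?case by (intro exI[of _ "{}"]) simp
  next
    case (Compl A)
    obtain C U where CU: "closedin X C" "openin X U" "C \<subseteq> A" "A \<subseteq> U" "measure M (U - C) < \<epsilon>"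
      using Compl.IH[OF Compl.prems] by blast
    have "(topspace X - C) - (topspace X - U) = U - C"
      using openin_subset[OF CU(2)] by blast
    then show ?case using CU
      by (intro exI[of _ "topspace X - U"] exI[of _ "topspace X - C"]) auto
  next
    case (Union A)
    \<comment> \<open>Half of the error is spread over the \<open>A i\<close> as a geometric series.
      The other half pays for replacing the infinite union of inner closed sets, which may fail to
      be closed, by a finite one.\<close>
    define \<delta> where "\<delta> = (\<lambda>i. (\<epsilon> / 2) * (1 / 2) ^ Suc i)"
    have \<delta>: "\<delta> i > 0" for i using Union.prems by (simp add: \<delta>_def)
    have "\<forall>i. \<exists>CU. closedin X (fst CU) \<and> openin X (snd CU) \<and> fst CU \<subseteq> A i \<and> A i \<subseteq> snd CU \<and>
        measure M (snd CU - fst CU) < \<delta> i"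
    proof
      fix i
      have "\<exists>C U. closedin X C \<and> openin X U \<and> C \<subseteq> A i \<and> A i \<subseteq> U \<and> measure M (U - C) < \<delta> i"
        by (rule Union.IH[OF \<delta>])
      then obtain C U where
        "closedin X C \<and> openin X U \<and> C \<subseteq> A i \<and> A i \<subseteq> U \<and> measure M (U - C) < \<delta> i"
        by (elim exE)
      then show "\<exists>CU. closedin X (fst CU) \<and> openin X (snd CU) \<and> fst CU \<subseteq> A i \<and> A i \<subseteq> snd CU \<and>
          measure M (snd CU - fst CU) < \<delta> i"
        by (intro exI[of _ "(C, U)"]) simp
    qed
    from choice[OF this] obtain CU where CU: "\<And>i. closedin X (fst (CU i))" "\<And>i. openin X (snd (CU i))"
      "\<And>i. fst (CU i) \<subseteq> A i" "\<And>i. A i \<subseteq> snd (CU i)"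
      "\<And>i. measure M (snd (CU i) - fst (CU i)) < \<delta> i"
      by auto
    define C where "C = (\<lambda>i. fst (CU i))"
    define U where "U = (\<lambda>i. snd (CU i))"
    have m: "C i \<in> sets M" "U i \<in> sets M" for i using CU op cl by (auto simp: C_def U_def)
    have s: "\<delta> sums (\<epsilon> / 2)"
      using sums_mult[OF power_half_series, of "\<epsilon> / 2"] by (simp add: \<delta>_def)
    have smm: "summable (\<lambda>i. measure M (U i - C i))"
      by (rule summable_comparison_test'[OF sums_summable[OF s], of 0])
         (use CU(5) in \<open>auto simp: C_def U_def less_imp_le\<close>)
    obtain n where n: "measure M ((\<Union>i. C i) - (\<Union>i\<le>n. C i)) < \<epsilon> / 2"
      using finite_union_exhausts[of C "\<epsilon> / 2"] m Union.prems by auto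
    have "measure M ((\<Union>i. U i) - (\<Union>i\<le>n. C i)) \<le>
        measure M ((\<Union>i. U i - C i) \<union> ((\<Union>i. C i) - (\<Union>i\<le>n. C i)))"
      using m by (intro finite_measure_mono) auto
    also have "\<dots> \<le> measure M (\<Union>i. U i - C i) + measure M ((\<Union>i. C i) - (\<Union>i\<le>n. C i))"
      using m by (intro measure_Un_le) auto
    also have "measure M (\<Union>i. U i - C i) \<le> (\<Sum>i. measure M (U i - C i))"
      using m smm by (intro finite_measure_subadditive_countably) auto
    also have "(\<Sum>i. measure M (U i - C i)) \<le> \<epsilon> / 2"
      using suminf_le[OF _ smm sums_summable[OF s]] sums_unique[OF s] CU(5)
      by (simp add: C_def U_def less_imp_le)
    finally have "measure M ((\<Union>i. U i) - (\<Union>i\<le>n. C i)) < \<epsilon>" using n by simp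
    moreover have "closedin X (\<Union>i\<le>n. C i)" by (rule closedin_Union) (use CU in \<open>auto simp: C_def\<close>)
    moreover have "openin X (\<Union>i. U i)" using CU(2) by (auto simp: U_def)
    moreover have "(\<Union>i\<le>n. C i) \<subseteq> (\<Union>i. A i)" "(\<Union>i. A i) \<subseteq> (\<Union>i. U i)"
      using CU(3,4) by (fastforce simp: C_def U_def)+
    ultimately show ?case by blast
  qed
qed

text \<open>Inner approximation by closed sets is upgraded to compact ones, because the space itself
  is a countable union of compact members of \<open>\<C>\<close>.\<close>

lemma regular_borel_measure_of_compact_base:
  assumes sp: "space M = topspace X" and st: "sets M = borel_sets_of X" and fin: "finite_measure M"
    and C: "countable \<C>" "\<And>C. C \<in> \<C> \<Longrightarrow> compactin X C \<and> closedin X C"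
    and base: "\<And>U. openin X U \<Longrightarrow> \<exists>\<U>\<subseteq>\<C>. U = \<Union>\<U>"
  shows "regular_borel_measure X M"
proof -
  interpret finite_measure M by (rule fin)
  have op: "U \<in> sets M" if "openin X U" for U using that st open_in_borel_sets_of by blast
  have cl: "C \<in> sets M" if "closedin X C" for C using that st closed_in_borel_sets_of by blast
  have approx: "\<exists>K U. compactin X K \<and> closedin X K \<and> openin X U \<and> K \<subseteq> A \<and> A \<subseteq> U \<and> measure M (U - K) < \<epsilon>"
    if A: "A \<in> sets M" and \<epsilon>: "\<epsilon> > 0" for A \<epsilon>
  proof -
    obtain D U where DU: "closedin X D" "openin X U" "D \<subseteq> A" "A \<subseteq> U" "measure M (U - D) < \<epsilon> / 2"
      using borel_approximation[OF sp st C(1) _ base A, of "\<epsilon> / 2"] C(2) \<epsilon> by auto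
    obtain \<U> where \<U>: "\<U> \<subseteq> \<C>" "topspace X = \<Union>\<U>" using base[of "topspace X"] by auto
    \<comment> \<open>The empty set is added to make the enumerated family nonempty.\<close>
    define W where "W = (\<lambda>i. D \<inter> from_nat_into (insert {} \<U>) i)"
    have "countable (insert {} \<U>)" using C(1) \<U>(1) countable_subset by blast
    then have rng: "range (from_nat_into (insert {} \<U>)) = insert {} \<U>"
      by (intro range_from_nat_into) auto
    have W: "compactin X (from_nat_into (insert {} \<U>) i)" "closedin X (from_nat_into (insert {} \<U>) i)" for i
    proof -
      have "from_nat_into (insert {} \<U>) i \<in> insert {} \<U>" using rng by blast
      then show "compactin X (from_nat_into (insert {} \<U>) i)" "closedin X (from_nat_into (insert {} \<U>) i)"
        using C(2) \<U>(1) by auto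
    qed
    have Wc: "compactin X (W i)" "closedin X (W i)" for i
      unfolding W_def using closed_Int_compactin[OF DU(1) W(1)] closedin_Int[OF DU(1) W(2)] by auto
    have UW: "(\<Union>i. W i) = D"
    proof -
      have "(\<Union>i. W i) = D \<inter> \<Union>(insert {} \<U>)" using rng unfolding W_def by (metis Int_UN_distrib)
      then show ?thesis using closedin_subset[OF DU(1)] \<U>(2) by auto
    qed
    obtain n where n: "measure M ((\<Union>i. W i) - (\<Union>i\<le>n. W i)) < \<epsilon> / 2"
      using finite_union_exhausts[of W "\<epsilon> / 2"] Wc cl \<epsilon> by auto
    let ?K = "\<Union>i\<le>n. W i"
    have K: "compactin X ?K" "closedin X ?K"
      using Wc by (auto intro!: compactin_Union closedin_Union)
    have "measure M (U - ?K) \<le> measure M ((U - D) \<union> (D - ?K))"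
      using op[OF DU(2)] cl[OF DU(1)] cl[OF K(2)] by (intro finite_measure_mono) auto
    also have "\<dots> \<le> measure M (U - D) + measure M (D - ?K)"
      using op[OF DU(2)] cl[OF DU(1)] cl[OF K(2)] by (intro measure_Un_le) auto
    also have "\<dots> < \<epsilon>" using n DU(5) UW by simp
    finally have "measure M (U - ?K) < \<epsilon>" .
    moreover have "?K \<subseteq> A" using UW DU(3) by blast
    ultimately show ?thesis using K DU by blast
  qed
  show ?thesis
    unfolding regular_borel_measure_def
  proof (intro conjI ballI sp st)
    fix A assume A: "A \<in> sets M"
    have close: "emeasure M U \<le> emeasure M K + ennreal \<epsilon>"
      if "closedin X K" "openin X U" "K \<subseteq> U" "measure M (U - K) < \<epsilon>" for K U \<epsilon>
    proof -
      have "measure M U = measure M K + measure M (U - K)"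
        using finite_measure_Diff[OF op[OF that(2)] cl[OF that(1)] that(3)] by simp
      also have "\<dots> \<le> measure M K + \<epsilon>" using that(4) by simp
      finally have "ennreal (measure M U) \<le> ennreal (measure M K + \<epsilon>)" by (rule ennreal_leI)
      also have "\<dots> = ennreal (measure M K) + ennreal \<epsilon>"
        by (intro ennreal_plus measure_nonneg order_trans[OF measure_nonneg less_imp_le[OF that(4)]])
      finally show ?thesis by (simp add: emeasure_eq_measure)
    qed
    show "emeasure M A = (SUP K\<in>{K. compactin X K \<and> K \<subseteq> A}. emeasure M K)"
    proof (rule antisym)
      show "emeasure M A \<le> (SUP K\<in>{K. compactin X K \<and> K \<subseteq> A}. emeasure M K)"
      proof (rule ennreal_le_epsilon)
        fix \<epsilon> :: real assume "\<epsilon> > 0"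
        then obtain K U where KU: "compactin X K" "closedin X K" "openin X U" "K \<subseteq> A" "A \<subseteq> U"
          "measure M (U - K) < \<epsilon>" using approx[OF A] by blast
        have "emeasure M A \<le> emeasure M U" using KU op by (intro emeasure_mono) auto
        also have "\<dots> \<le> emeasure M K + ennreal \<epsilon>" using KU by (intro close) auto
        also have "emeasure M K \<le> (SUP K\<in>{K. compactin X K \<and> K \<subseteq> A}. emeasure M K)"
          using KU by (intro SUP_upper) auto
        finally show "emeasure M A \<le> (SUP K\<in>{K. compactin X K \<and> K \<subseteq> A}. emeasure M K) + ennreal \<epsilon>"
          by simp
      qed
      show "(SUP K\<in>{K. compactin X K \<and> K \<subseteq> A}. emeasure M K) \<le> emeasure M A"
        using A by (intro SUP_least emeasure_mono) auto
    qed
    show "emeasure M A = (INF U\<in>{U. openin X U \<and> A \<subseteq> U}. emeasure M U)"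
    proof (rule antisym)
      show "emeasure M A \<le> (INF U\<in>{U. openin X U \<and> A \<subseteq> U}. emeasure M U)"
        using op by (intro INF_greatest emeasure_mono) auto
      show "(INF U\<in>{U. openin X U \<and> A \<subseteq> U}. emeasure M U) \<le> emeasure M A"
      proof (rule ennreal_le_epsilon)
        fix \<epsilon> :: real assume "\<epsilon> > 0"
        then obtain K U where KU: "compactin X K" "closedin X K" "openin X U" "K \<subseteq> A" "A \<subseteq> U"
          "measure M (U - K) < \<epsilon>" using approx[OF A] by blast
        have "(INF U\<in>{U. openin X U \<and> A \<subseteq> U}. emeasure M U) \<le> emeasure M U"
          using KU by (intro INF_lower) auto
        also have "\<dots> \<le> emeasure M K + ennreal \<epsilon>" using KU by (intro close) auto
        also have "emeasure M K \<le> emeasure M A" using KU A by (intro emeasure_mono) auto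
        finally show "(INF U\<in>{U. openin X U \<and> A \<subseteq> U}. emeasure M U) \<le> emeasure M A + ennreal \<epsilon>"
          by simp
      qed
    qed
  qed
qed

section \<open>The invariant measure on the coset space\<close>

context leveled_lattice
begin

abbreviation X :: "('v \<Rightarrow> 'v) set topology" where "X \<equiv> coset_topology G T \<Gamma>"
abbreviation proj :: "('v \<Rightarrow> 'v) \<Rightarrow> ('v \<Rightarrow> 'v) set" where "proj g \<equiv> \<Gamma> #>\<^bsub>G\<^esub> g"

lemma \<Gamma>_subset: "\<Gamma> \<subseteq> carrier G"
  using \<Gamma>_carrier by blast

lemma quotient_map_proj: "quotient_map T X proj"
  by (rule quotient_map_coset_topology) (rule topspace_T)

lemma topspace_X: "topspace X = proj ` carrier G"
  using quotient_imp_surjective_map[OF quotient_map_proj] topspace_T by simp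

lemma continuous_proj: "continuous_map T X proj"
  by (rule quotient_imp_continuous_map[OF quotient_map_proj])

lemma openin_X: "openin X U \<longleftrightarrow> U \<subseteq> proj ` carrier G \<and> openin T {g \<in> carrier G. proj g \<in> U}"
  unfolding openin_coset_topology by (simp add: RCOSETS_def UNION_singleton_eq_range)

lemma proj_eq_iff:
  assumes "g \<in> carrier G" "g' \<in> carrier G"
  shows "proj g = proj g' \<longleftrightarrow> (\<exists>\<gamma>\<in>\<Gamma>. g' = \<gamma> \<cdot> g)"
proof
  assume "proj g = proj g'"
  then have "g' \<in> proj g" using G.rcos_self[OF assms(2) subgroup_\<Gamma>] by simp
  then show "\<exists>\<gamma>\<in>\<Gamma>. g' = \<gamma> \<cdot> g" by (auto simp: r_coset_def)
next
  assume "\<exists>\<gamma>\<in>\<Gamma>. g' = \<gamma> \<cdot> g"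
  then have "g' \<in> proj g" by (auto simp: r_coset_def)
  then show "proj g = proj g'" using G.repr_independence[OF _ assms(1) subgroup_\<Gamma>] by blast
qed

lemma proj_mult: "g \<in> carrier G \<Longrightarrow> x \<in> carrier G \<Longrightarrow> proj g #>\<^bsub>G\<^esub> x = proj (g \<cdot> x)"
  by (rule G.coset_mult_assoc[OF \<Gamma>_subset])

lemma proj_\<Gamma>: "\<gamma> \<in> \<Gamma> \<Longrightarrow> g \<in> carrier G \<Longrightarrow> proj (\<gamma> \<cdot> g) = proj g"
  using proj_eq_iff[of g "\<gamma> \<cdot> g"] \<Gamma>_carrier[of \<gamma>] by auto

text \<open>Only finitely many elements of \<open>\<Gamma>\<close> agree with
  \<open>\<gamma>\<close> at \<open>base\<close>, and each of the others among them is told apart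
  from \<open>\<gamma>\<close> by its value at one vertex.\<close>

lemma discrete_\<Gamma>: "subtopology T \<Gamma> = discrete_topology \<Gamma>"
proof -
  have "openin (subtopology T \<Gamma>) {\<gamma>}" if \<gamma>: "\<gamma> \<in> \<Gamma>" for \<gamma>
  proof -
    let ?S = "transporter base (\<gamma> base) - {\<gamma>}"
    define f where "f = (\<lambda>\<gamma>'. SOME v. v \<in> V \<and> \<gamma>' v \<noteq> \<gamma> v)"
    have f: "f \<gamma>' \<in> V" "\<gamma>' (f \<gamma>') \<noteq> \<gamma> (f \<gamma>')" if "\<gamma>' \<in> ?S" for \<gamma>'
    proof -
      have "\<exists>v. v \<in> V \<and> \<gamma>' v \<noteq> \<gamma> v"
        using that \<gamma> aut_ext[of \<gamma>' \<gamma>] \<Gamma>_carrier by (auto simp: transporter_def)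
      from someI_ex[OF this] show "f \<gamma>' \<in> V" "\<gamma>' (f \<gamma>') \<noteq> \<gamma> (f \<gamma>')" by (auto simp: f_def)
    qed
    let ?F = "insert base (f ` ?S)"
    let ?W = "{g \<in> carrier G. \<forall>v\<in>?F. g v = \<gamma> v}"
    have "finite ?F" using finite_transporter[OF base] by simp
    moreover have "?F \<subseteq> V" using f base by auto
    moreover have "saturated ?F ?W" by (auto simp: saturated_def)
    ultimately have "openin T ?W" using saturated_open by blast
    moreover have "?W \<inter> \<Gamma> = {\<gamma>}"
    proof (intro equalityI subsetI)
      fix g assume g: "g \<in> ?W \<inter> \<Gamma>"
      then have "g \<in> transporter base (\<gamma> base)" by (auto simp: transporter_def)
      moreover have "g \<notin> ?S" using f(2)[of g] g by auto
      ultimately show "g \<in> {\<gamma>}" by simp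
    qed (use \<gamma> \<Gamma>_carrier in auto)
    ultimately show ?thesis by (auto simp: openin_subtopology)
  qed
  moreover have "topspace (subtopology T \<Gamma>) = \<Gamma>"
    using \<Gamma>_subset by (auto simp: topspace_T)
  ultimately show ?thesis using discrete_topology_unique[of \<Gamma> "subtopology T \<Gamma>"] by simp
qed

lemma countable_\<Gamma>: "countable \<Gamma>"
proof -
  have "\<Gamma> = (\<Union>w\<in>V. transporter base w)"
    using aut_in_V[OF \<Gamma>_carrier base] by (auto simp: transporter_def)
  moreover have "countable (\<Union>w\<in>V. transporter base w)"
    using countable_V finite_transporter[OF base] by (intro countable_UN) (auto intro: countable_finite)
  ultimately show ?thesis by simp
qed

text \<open>The function \<open>orbit_density\<close> has total sum \<open>1\<close> over each orbit of \<open>\<Gamma>\<close> (counted with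
  multiplicities), so that integrating it against the Haar measure amounts to integrating over a
  fundamental domain of \<open>\<Gamma>\<close>.\<close>

definition orbit_density :: "'v \<Rightarrow> ennreal" where
  "orbit_density v = (if v = rep (l v) then ennreal (weight (l v)) else 0)"

text \<open>The elements of \<open>\<Gamma>\<close> taking \<open>v\<close> to the representative of
  its level are as many as those fixing the representative, and \<open>weight\<close> is the
  reciprocal of this number.\<close>

lemma orbit_density_sum:
  assumes v: "v \<in> V"
  shows "(\<integral>\<^sup>+\<gamma>. orbit_density (\<gamma> v) \<partial>count_space \<Gamma>) = 1"
proof -
  let ?S = "transporter v (rep (l v))"
  have S: "card ?S = card (transporter (rep (l v)) (rep (l v)))"
    using card_transporter_right[OF v rep(1)[of "l v"]] rep(2) by simp
  have "(\<integral>\<^sup>+\<gamma>. orbit_density (\<gamma> v) \<partial>count_space \<Gamma>) =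
      (\<integral>\<^sup>+\<gamma>. ennreal (weight (l v)) * indicator ?S \<gamma> \<partial>count_space \<Gamma>)"
    using \<Gamma>_level[OF _ v] rep(2)
    by (intro nn_integral_cong) (auto simp: orbit_density_def transporter_def split: split_indicator)
  also have "\<dots> = ennreal (weight (l v)) * emeasure (count_space \<Gamma>) ?S"
    by (intro nn_integral_cmult_indicator) (auto simp: transporter_def)
  also have "emeasure (count_space \<Gamma>) ?S = ennreal (real (card ?S))"
    using finite_transporter[OF v] by (subst emeasure_count_space) (auto simp: transporter_def ennreal_of_nat_eq_real_of_nat)
  also have "ennreal (weight (l v)) * ennreal (real (card ?S)) = 1"
    unfolding S weight_def using card_transporter_pos[OF rep(1)[of "l v"]]
    by (subst ennreal_mult[symmetric]) auto
  finally show ?thesis .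
qed

lemma orbit_density_sum_inv:
  assumes v: "v \<in> V"
  shows "(\<integral>\<^sup>+\<gamma>. orbit_density ((ginv \<gamma>) v) \<partial>count_space \<Gamma>) = 1"
proof -
  have "bij_betw (\<lambda>\<gamma>. ginv \<gamma>) \<Gamma> \<Gamma>"
    by (rule bij_betw_byWitness[where f' = "\<lambda>\<gamma>. ginv \<gamma>"]) (use \<Gamma>_inv \<Gamma>_carrier in auto)
  from nn_integral_bij_count_space[OF this, of "\<lambda>\<gamma>. orbit_density (\<gamma> v)"]
  show ?thesis using orbit_density_sum[OF v] by simp
qed

lemma measurable_vertex_function:
  assumes v: "v \<in> V"
  shows "(\<lambda>g. f (g v)) \<in> borel_measurable haar"
proof (rule measurableI)
  fix A
  have "openin T {g \<in> carrier G. f (g v) \<in> A}"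
    using open_vertex_condition[OF v, of "\<lambda>w. f w \<in> A"] .
  then show "(\<lambda>g. f (g v)) -` A \<inter> space haar \<in> sets haar"
    by (intro open_sets_haar) (simp add: space_haar vimage_def Int_def conj_commute)
qed simp

lemma haar_left_integral:
  assumes "x \<in> carrier G" "f \<in> borel_measurable haar"
  shows "(\<integral>\<^sup>+g. f (x \<cdot> g) \<partial>haar) = (\<integral>\<^sup>+g. f g \<partial>haar)"
  using nn_integral_distr[of "\<lambda>g. x \<cdot> g" haar haar f] assms haar_left_invariant[OF assms(1)]
    continuous_measurable_haar[OF continuous_left_translation[OF assms(1)]] by simp

lemma haar_right_integral:
  assumes "x \<in> carrier G" "f \<in> borel_measurable haar"
  shows "(\<integral>\<^sup>+g. f (g \<cdot> x) \<partial>haar) = (\<integral>\<^sup>+g. f g \<partial>haar)"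
  using nn_integral_distr[of "\<lambda>g. g \<cdot> x" haar haar f] assms haar_right_invariant[OF assms(1)]
    continuous_measurable_haar[OF continuous_right_translation[OF assms(1)]] by simp

text \<open>Unfolding: insert the orbit sum at \<open>base\<close>, which is 1, exchange sum and
  integral, translate each summand on the left by \<open>\<gamma>\<close>, and sum the factor at
  \<open>y\<close> to 1. The change of base vertex is what right translation amounts to in the
  density.\<close>

lemma unfolding_base_change:
  assumes y: "y \<in> V" and b[measurable]: "b \<in> borel_measurable haar"
    and inv: "\<And>\<gamma> g. \<gamma> \<in> \<Gamma> \<Longrightarrow> g \<in> carrier G \<Longrightarrow> b (\<gamma> \<cdot> g) = b g"
  shows "(\<integral>\<^sup>+g. orbit_density (g y) * b g \<partial>haar) = (\<integral>\<^sup>+g. orbit_density (g base) * b g \<partial>haar)"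
proof -
  note [measurable] = measurable_vertex_function[OF y] measurable_vertex_function[OF base]
  have m: "(\<lambda>g. orbit_density (g base) * orbit_density ((ginv \<gamma>) (g y)) * b g) \<in> borel_measurable haar" for \<gamma>
    using measurable_vertex_function[OF y, of "\<lambda>v. orbit_density ((ginv \<gamma>) v)"] by simp
  have m': "(\<lambda>g. orbit_density (\<gamma> (g base)) * (orbit_density (g y) * b g)) \<in> borel_measurable haar" for \<gamma>
    using measurable_vertex_function[OF base, of "\<lambda>v. orbit_density (\<gamma> v)"] by simp
  have "(\<integral>\<^sup>+g. orbit_density (g y) * b g \<partial>haar) =
      (\<integral>\<^sup>+g. (\<integral>\<^sup>+\<gamma>. orbit_density (\<gamma> (g base)) * (orbit_density (g y) * b g) \<partial>count_space \<Gamma>) \<partial>haar)"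
    using orbit_density_sum aut_in_V[OF _ base]
    by (intro nn_integral_cong) (simp add: nn_integral_multc space_haar)
  also have "\<dots> = (\<integral>\<^sup>+\<gamma>. (\<integral>\<^sup>+g. orbit_density (\<gamma> (g base)) * (orbit_density (g y) * b g) \<partial>haar) \<partial>count_space \<Gamma>)"
    by (rule nn_integral_count_space_nn_integral[OF countable_\<Gamma> m'])
  also have "\<dots> = (\<integral>\<^sup>+\<gamma>. (\<integral>\<^sup>+g. orbit_density (g base) * orbit_density ((ginv \<gamma>) (g y)) * b g \<partial>haar) \<partial>count_space \<Gamma>)"
  proof (rule nn_integral_cong)
    fix \<gamma> assume "\<gamma> \<in> space (count_space \<Gamma>)"
    then have \<gamma>: "\<gamma> \<in> \<Gamma>" "\<gamma> \<in> carrier G" using \<Gamma>_carrier by auto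
    have "(\<integral>\<^sup>+g. orbit_density (\<gamma> (g base)) * (orbit_density (g y) * b g) \<partial>haar) =
      (\<integral>\<^sup>+g. orbit_density ((\<gamma> \<cdot> g) base) * orbit_density ((ginv \<gamma>) ((\<gamma> \<cdot> g) y)) * b (\<gamma> \<cdot> g) \<partial>haar)"
      using \<gamma> inv[OF \<gamma>(1)] y base aut_in_V inv_apply[OF \<gamma>(2)]
      by (intro nn_integral_cong) (simp add: space_haar mult_apply mult.assoc)
    also have "\<dots> = (\<integral>\<^sup>+g. orbit_density (g base) * orbit_density ((ginv \<gamma>) (g y)) * b g \<partial>haar)"
      by (rule haar_left_integral[OF \<gamma>(2) m])
    finally show "(\<integral>\<^sup>+g. orbit_density (\<gamma> (g base)) * (orbit_density (g y) * b g) \<partial>haar) =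
      (\<integral>\<^sup>+g. orbit_density (g base) * orbit_density ((ginv \<gamma>) (g y)) * b g \<partial>haar)" .
  qed
  also have "\<dots> = (\<integral>\<^sup>+g. (\<integral>\<^sup>+\<gamma>. orbit_density (g base) * orbit_density ((ginv \<gamma>) (g y)) * b g \<partial>count_space \<Gamma>) \<partial>haar)"
    by (rule nn_integral_count_space_nn_integral[OF countable_\<Gamma> m, symmetric])
  also have "\<dots> = (\<integral>\<^sup>+g. orbit_density (g base) * b g \<partial>haar)"
    using orbit_density_sum_inv aut_in_V[OF _ y]
    by (intro nn_integral_cong) (simp add: nn_integral_multc nn_integral_cmult space_haar)
  finally show ?thesis .
qed

section \<open>The quotient measure, its invariance and total mass\<close>

definition quotient_measure :: "('v \<Rightarrow> 'v) set measure" where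
  "quotient_measure =
     distr (density haar (\<lambda>g. orbit_density (g base))) (sigma (topspace X) {U. openin X U}) proj"

lemma sets_borel_X: "sets (sigma (topspace X) {U. openin X U}) = borel_sets_of X"
  unfolding borel_sets_of_def by (rule sets_measure_of) (use openin_subset in auto)

lemma space_quotient_measure: "space quotient_measure = topspace X"
  and sets_quotient_measure: "sets quotient_measure = borel_sets_of X"
  by (simp_all add: quotient_measure_def space_measure_of_conv sets_borel_X)

lemma measurable_proj: "proj \<in> measurable haar (sigma (topspace X) {U. openin X U})"
proof (rule measurable_sigma_sets[of _ "topspace X" "{U. openin X U}"])
  show "sets (sigma (topspace X) {U. openin X U}) = sigma_sets (topspace X) {U. openin X U}"
    by (simp add: sets_borel_X borel_sets_of_def)
  show "proj \<in> space haar \<rightarrow> topspace X" by (auto simp: space_haar topspace_X)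
  fix U assume "U \<in> {U. openin X U}"
  then have "openin T {g \<in> carrier G. proj g \<in> U}" by (simp add: openin_X)
  then show "proj -` U \<inter> space haar \<in> sets haar"
    by (intro open_sets_haar) (simp add: space_haar vimage_def Int_def conj_commute)
qed (use openin_subset in auto)

lemma emeasure_quotient_measure:
  assumes A: "A \<in> borel_sets_of X"
  shows "emeasure quotient_measure A = (\<integral>\<^sup>+g. orbit_density (g base) * indicator A (proj g) \<partial>haar)"
proof -
  let ?B = "sigma (topspace X) {U. openin X U}"
  have A': "A \<in> sets ?B" using A sets_borel_X by simp
  have "proj \<in> measurable (density haar (\<lambda>g. orbit_density (g base))) ?B"
    using measurable_proj by simp
  then have "emeasure quotient_measure A =
      emeasure (density haar (\<lambda>g. orbit_density (g base))) (proj -` A \<inter> space haar)"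
    unfolding quotient_measure_def using A' by (subst emeasure_distr) auto
  also have "\<dots> = (\<integral>\<^sup>+g. orbit_density (g base) * indicator (proj -` A \<inter> space haar) g \<partial>haar)"
    using measurable_sets[OF measurable_proj A'] measurable_vertex_function[OF base]
    by (subst emeasure_density) auto
  also have "\<dots> = (\<integral>\<^sup>+g. orbit_density (g base) * indicator A (proj g) \<partial>haar)"
    by (intro nn_integral_cong) (auto split: split_indicator)
  finally show ?thesis .
qed

lemma indicator_proj_measurable:
  assumes A: "A \<in> borel_sets_of X"
  shows "(\<lambda>g. indicator A (proj g) :: ennreal) \<in> borel_measurable haar"
  using measurable_compose[OF measurable_proj borel_measurable_indicator] A sets_borel_X by blast

lemma translate_borel:
  assumes A: "A \<in> borel_sets_of X" and x: "x \<in> carrier G"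
  shows "(\<lambda>C. C #>\<^bsub>G\<^esub> x) ` A = {C \<in> topspace X. C #>\<^bsub>G\<^esub> ginv x \<in> A}" (is "?L = ?R")
    and "(\<lambda>C. C #>\<^bsub>G\<^esub> x) ` A \<in> borel_sets_of X"
proof -
  have sub: "A \<subseteq> topspace X"
    using A sigma_sets_into_sp[of "{U. openin X U}" "topspace X"] openin_subset
    unfolding borel_sets_of_def by blast
  show eq: "?L = ?R"
  proof (intro equalityI subsetI)
    fix C assume "C \<in> ?L"
    then obtain g where g: "g \<in> carrier G" "proj g \<in> A" "C = proj g #>\<^bsub>G\<^esub> x"
      using sub unfolding topspace_X by auto
    then show "C \<in> ?R"
      using x by (auto simp: proj_mult topspace_X G.m_assoc)
  next
    fix C assume "C \<in> ?R"
    then obtain g where g: "g \<in> carrier G" "C = proj g" "proj g #>\<^bsub>G\<^esub> ginv x \<in> A"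
      unfolding topspace_X by auto
    have "(proj g #>\<^bsub>G\<^esub> ginv x) #>\<^bsub>G\<^esub> x = C"
      using g x by (simp add: proj_mult G.m_assoc)
    then show "C \<in> ?L" using g(3) by blast
  qed
  let ?B = "sigma (topspace X) {U. openin X U}"
  have "(\<lambda>C. C #>\<^bsub>G\<^esub> ginv x) \<in> measurable ?B ?B"
  proof (rule measurable_sigma_sets[of _ "topspace X" "{U. openin X U}"])
    show "sets ?B = sigma_sets (topspace X) {U. openin X U}"
      by (simp add: sets_borel_X borel_sets_of_def)
    show "(\<lambda>C. C #>\<^bsub>G\<^esub> ginv x) \<in> space ?B \<rightarrow> topspace X"
      using x by (auto simp: space_measure_of_conv topspace_X proj_mult)
    fix U assume "U \<in> {U. openin X U}"
    then have U: "openin T {g \<in> carrier G. proj g \<in> U}" by (simp add: openin_X)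
    let ?U = "{C \<in> topspace X. C #>\<^bsub>G\<^esub> ginv x \<in> U}"
    have "{g \<in> carrier G. proj g \<in> ?U} =
        {g \<in> topspace T. g \<cdot> ginv x \<in> {g \<in> carrier G. proj g \<in> U}}"
      using x by (auto simp: topspace_X topspace_T proj_mult)
    then have "openin X ?U"
      using openin_continuous_map_preimage[OF continuous_right_translation U, of "ginv x"] x
      by (auto simp: openin_X topspace_X)
    then have "?U \<in> sets ?B" by (simp add: sets_borel_X open_in_borel_sets_of)
    then show "(\<lambda>C. C #>\<^bsub>G\<^esub> ginv x) -` U \<inter> space ?B \<in> sets ?B"
      by (simp add: space_measure_of_conv vimage_def Int_def conj_commute)
  qed (use openin_subset in auto)
  from measurable_sets[OF this, of A] show "?L \<in> borel_sets_of X"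
    unfolding eq using A by (simp add: sets_borel_X space_measure_of_conv vimage_def Int_def conj_commute)
qed

text \<open>Right invariance of the Haar measure moves the translation into the density, where it
  turns \<open>base\<close> into \<open>x base\<close>; unfolding undoes this change.\<close>

lemma quotient_measure_invariant:
  assumes A: "A \<in> borel_sets_of X" and x: "x \<in> carrier G"
  shows "emeasure quotient_measure ((\<lambda>C. C #>\<^bsub>G\<^esub> x) ` A) = emeasure quotient_measure A"
proof -
  note tb = translate_borel[OF A x]
  let ?b = "\<lambda>g. indicator A (proj g) :: ennreal"
  have xb: "x base \<in> V" using aut_in_V[OF x base] .
  have "emeasure quotient_measure ((\<lambda>C. C #>\<^bsub>G\<^esub> x) ` A) =
      (\<integral>\<^sup>+g. orbit_density (g base) * indicator ((\<lambda>C. C #>\<^bsub>G\<^esub> x) ` A) (proj g) \<partial>haar)"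
    by (rule emeasure_quotient_measure[OF tb(2)])
  also have "\<dots> = (\<integral>\<^sup>+g. orbit_density ((g \<cdot> x) base) *
      indicator ((\<lambda>C. C #>\<^bsub>G\<^esub> x) ` A) (proj (g \<cdot> x)) \<partial>haar)"
    by (intro haar_right_integral[OF x, symmetric] borel_measurable_times_ennreal
        measurable_vertex_function[OF base] indicator_proj_measurable[OF tb(2)])
  also have "\<dots> = (\<integral>\<^sup>+g. orbit_density (g (x base)) * ?b g \<partial>haar)"
    using x base
    by (intro nn_integral_cong)
       (auto simp: space_haar mult_apply tb(1) topspace_X proj_mult G.m_assoc split: split_indicator)
  also have "\<dots> = (\<integral>\<^sup>+g. orbit_density (g base) * ?b g \<partial>haar)"
    by (rule unfolding_base_change[OF xb indicator_proj_measurable[OF A]]) (simp add: proj_\<Gamma>)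
  also have "\<dots> = emeasure quotient_measure A" by (rule emeasure_quotient_measure[OF A, symmetric])
  finally show ?thesis .
qed

text \<open>The density is supported where \<open>base\<close> goes to some \<open>rep i\<close>;
  each of these sets has Haar measure 1 and contributes \<open>weight i\<close>.\<close>

lemma emeasure_quotient_space:
  "emeasure quotient_measure (topspace X) = (\<integral>\<^sup>+i. ennreal (weight i) \<partial>count_space UNIV)"
proof -
  have top: "topspace X \<in> borel_sets_of X" by (rule open_in_borel_sets_of) simp
  let ?D = "\<lambda>i. {g \<in> carrier G. g base = rep i}"
  have D: "?D i \<in> sets haar" for i
    by (rule open_sets_haar[OF open_vertex_condition[OF base]])
  have "emeasure quotient_measure (topspace X) = (\<integral>\<^sup>+g. orbit_density (g base) \<partial>haar)"
    unfolding emeasure_quotient_measure[OF top]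
    by (intro nn_integral_cong) (auto simp: space_haar topspace_X)
  also have "\<dots> = (\<integral>\<^sup>+g. (\<integral>\<^sup>+i. ennreal (weight i) * indicator (?D i) g \<partial>count_space UNIV) \<partial>haar)"
  proof (rule nn_integral_cong)
    fix g assume "g \<in> space haar"
    then have g: "g \<in> carrier G" by (simp add: space_haar)
    let ?i = "l (g base)"
    have "(\<integral>\<^sup>+i. ennreal (weight i) * indicator (?D i) g \<partial>count_space UNIV) =
        (\<integral>\<^sup>+i. orbit_density (g base) * indicator {?i} i \<partial>count_space UNIV)"
      using g rep(2) by (intro nn_integral_cong) (auto simp: orbit_density_def split: split_indicator)
    also have "\<dots> = orbit_density (g base)" by (subst nn_integral_cmult_indicator) auto
    finally show "orbit_density (g base) = (\<integral>\<^sup>+i. ennreal (weight i) * indicator (?D i) g \<partial>count_space UNIV)"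
      by simp
  qed
  also have "\<dots> = (\<integral>\<^sup>+i. (\<integral>\<^sup>+g. ennreal (weight i) * indicator (?D i) g \<partial>haar) \<partial>count_space UNIV)"
    by (rule nn_integral_count_space_nn_integral) (use D in auto)
  also have "\<dots> = (\<integral>\<^sup>+i. ennreal (weight i) \<partial>count_space UNIV)"
    using D haar_transporter[OF rep(1)] by (intro nn_integral_cong) (simp add: nn_integral_cmult_indicator)
  finally show ?thesis .
qed

lemma countable_base_X:
  obtains \<C> where "countable \<C>" "\<And>C. C \<in> \<C> \<Longrightarrow> compactin X C \<and> closedin X C"
    "\<And>U. openin X U \<Longrightarrow> \<exists>\<U>\<subseteq>\<C>. U = \<Union>\<U>"
proof -
  from countable_compact_open_base obtain \<B> where \<B>: "countable \<B>" "\<B> \<subseteq> compact_open"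
    "\<forall>U. openin T U \<longrightarrow> (\<exists>\<U>\<subseteq>\<B>. U = \<Union>\<U>)"
    by (elim exE conjE)
  show thesis
  proof (rule that[of "(\<lambda>B. proj ` B) ` \<B>"])
    show "countable ((\<lambda>B. proj ` B) ` \<B>)" using \<B>(1) by simp
  next
    fix C assume "C \<in> (\<lambda>B. proj ` B) ` \<B>"
    then obtain B where B: "B \<in> compact_open" "C = proj ` B" using \<B>(2) by blast
    obtain F where F: "frame F" "saturated F B" "B \<subseteq> carrier G"
      using B(1) by (rule compact_openE)
    \<comment> \<open>Left multiplication by \<open>\<gamma>\<close> preserves agreement on
      \<open>F\<close>, so the full preimage of \<open>C\<close> is saturated for the same finite
      \<open>F\<close> as \<open>B\<close>. This is what makes \<open>C\<close> closed.\<close>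
    have "saturated F {g \<in> carrier G. proj g \<in> C}"
      unfolding saturated_def
    proof (intro conjI ballI impI)
      fix g g' assume g: "g \<in> {g \<in> carrier G. proj g \<in> C}" "g' \<in> carrier G" "\<forall>v\<in>F. g' v = g v"
      then obtain b where b: "b \<in> B" "proj g = proj b" "g \<in> carrier G" using B(2) by auto
      then obtain \<gamma> where \<gamma>: "\<gamma> \<in> \<Gamma>" "b = \<gamma> \<cdot> g" using proj_eq_iff[of g b] F(3) by blast
      have "\<gamma> \<cdot> g' \<in> B"
        using saturatedD[OF F(2) b(1), of "\<gamma> \<cdot> g'"] \<gamma> \<Gamma>_carrier[OF \<gamma>(1)] g b(3) F(1)
        by (auto simp: mult_apply frame_def subset_iff)
      moreover have "proj g' = proj (\<gamma> \<cdot> g')" using proj_\<Gamma>[OF \<gamma>(1) g(2)] by simp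
      ultimately show "g' \<in> {g \<in> carrier G. proj g \<in> C}" using g(2) B(2) by auto
    qed auto
    then have "saturated F (carrier G - {g \<in> carrier G. proj g \<in> C})" by (rule saturated_compl)
    then have "openin T (carrier G - {g \<in> carrier G. proj g \<in> C})"
      using F(1) by (intro saturated_open) (auto simp: frame_def)
    moreover have "carrier G - {g \<in> carrier G. proj g \<in> C} = {g \<in> carrier G. proj g \<in> topspace X - C}"
      by (auto simp: topspace_X)
    ultimately have "closedin X C"
      using B(2) F(3) by (auto simp: closedin_def openin_X topspace_X)
    moreover have "compactin X C"
      unfolding B(2) by (rule image_compactin[OF compact_open_compact[OF B(1)] continuous_proj])
    ultimately show "compactin X C \<and> closedin X C" by blast
  next
    fix U assume U: "openin X U"
    then have "openin T {g \<in> carrier G. proj g \<in> U}" by (simp add: openin_X)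
    then have "\<exists>\<U>\<subseteq>\<B>. {g \<in> carrier G. proj g \<in> U} = \<Union>\<U>" using \<B>(3) by simp
    then obtain \<U> where \<U>: "\<U> \<subseteq> \<B>" "{g \<in> carrier G. proj g \<in> U} = \<Union>\<U>"
      by (elim exE conjE)
    have "U = proj ` {g \<in> carrier G. proj g \<in> U}" using U unfolding openin_X by blast
    also have "\<dots> = \<Union> ((\<lambda>B. proj ` B) ` \<U>)" unfolding \<U>(2) by blast
    finally have "U = \<Union> ((\<lambda>B. proj ` B) ` \<U>)" .
    moreover have "(\<lambda>B. proj ` B) ` \<U> \<subseteq> (\<lambda>B. proj ` B) ` \<B>" using \<U>(1) by (rule image_mono)
    ultimately show "\<exists>\<U>\<subseteq>(\<lambda>B. proj ` B) ` \<B>. U = \<Union>\<U>" by (intro exI conjI)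
  qed
qed

lemma finite_invariant_quotient_measure:
  assumes fin: "(\<integral>\<^sup>+i. ennreal (weight i) \<partial>count_space UNIV) \<noteq> \<infinity>"
  shows "finite_invariant_measure G T \<Gamma> quotient_measure"
  unfolding finite_invariant_measure_def
proof (intro conjI ballI)
  show fm: "finite_measure quotient_measure"
    by (rule finite_measureI) (use fin in \<open>simp add: space_quotient_measure emeasure_quotient_space\<close>)
  show "regular_borel_measure X quotient_measure"
  proof (rule countable_base_X)
    fix \<C>
    assume "countable \<C>" "\<And>C. C \<in> \<C> \<Longrightarrow> compactin X C \<and> closedin X C"
      "\<And>U. openin X U \<Longrightarrow> \<exists>\<U>\<subseteq>\<C>. U = \<Union>\<U>"
    then show ?thesis
      by (rule regular_borel_measure_of_compact_base[OF space_quotient_measure sets_quotient_measure fm])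
  qed
  have "0 < ennreal (weight 0) * emeasure (count_space UNIV) {0 :: int}"
    using weight_pos[of 0] by simp
  also have "\<dots> = (\<integral>\<^sup>+i. ennreal (weight 0) * indicator {0} i \<partial>count_space (UNIV :: int set))"
    by (rule nn_integral_cmult_indicator[symmetric]) simp
  also have "\<dots> \<le> (\<integral>\<^sup>+i. ennreal (weight i) \<partial>count_space UNIV)"
    by (intro nn_integral_mono) (auto split: split_indicator)
  finally show "emeasure quotient_measure (space quotient_measure) \<noteq> 0"
    by (simp add: space_quotient_measure emeasure_quotient_space)
  show "emeasure quotient_measure ((\<lambda>C. C #>\<^bsub>G\<^esub> g) ` A) = emeasure quotient_measure A"
    if "g \<in> carrier G" "A \<in> sets quotient_measure" for g A
    using quotient_measure_invariant[OF _ that(1)] that(2) by (simp add: sets_quotient_measure)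
qed

lemma is_lattice_\<Gamma>:
  assumes "(\<integral>\<^sup>+i. ennreal (weight i) \<partial>count_space UNIV) \<noteq> \<infinity>"
  shows "is_lattice G T \<Gamma>"
  unfolding is_lattice_def
  using locally_compact_group_G subgroup_\<Gamma> discrete_\<Gamma> finite_invariant_quotient_measure[OF assms] by blast

end

section \<open>Almost invariant vectors\<close>

context leveled_lattice
begin

text \<open>Independent of the chosen representative because \<open>\<Gamma>\<close> preserves
  levels. The vertex is kept as an argument so that right translation becomes a change of
  vertex.\<close>

definition level_at :: "'v \<Rightarrow> ('v \<Rightarrow> 'v) set \<Rightarrow> int" where
  "level_at v C = l ((SOME g. g \<in> carrier G \<and> proj g = C) v)"

abbreviation level_set :: "int \<Rightarrow> ('v \<Rightarrow> 'v) set set" where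
  "level_set i \<equiv> {C \<in> topspace X. level_at base C = i}"

lemma level_at_proj:
  assumes g: "g \<in> carrier G" and v: "v \<in> V"
  shows "level_at v (proj g) = l (g v)"
proof -
  define g' where "g' = (SOME g'. g' \<in> carrier G \<and> proj g' = proj g)"
  have g': "g' \<in> carrier G" "proj g' = proj g"
    using someI_ex[of "\<lambda>g'. g' \<in> carrier G \<and> proj g' = proj g"] g by (auto simp: g'_def)
  then obtain \<gamma> where \<gamma>: "\<gamma> \<in> \<Gamma>" "g = \<gamma> \<cdot> g'" using proj_eq_iff[OF g'(1) g] by blast
  then have "l (g v) = l (g' v)"
    using \<Gamma>_level[OF \<gamma>(1) aut_in_V[OF g'(1) v]] g' v \<Gamma>_carrier[OF \<gamma>(1)] by (simp add: mult_apply)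
  then show ?thesis by (simp add: level_at_def g'_def)
qed

lemma level_at_translate:
  assumes C: "C \<in> topspace X" and x: "x \<in> carrier G" and v: "v \<in> V"
  shows "level_at v (C #>\<^bsub>G\<^esub> x) = level_at (x v) C"
proof -
  obtain g where g: "g \<in> carrier G" "C = proj g" using C unfolding topspace_X by blast
  then show ?thesis
    using x v aut_in_V[OF x v] by (simp add: proj_mult level_at_proj mult_apply)
qed

lemma translate_topspace: "C \<in> topspace X \<Longrightarrow> x \<in> carrier G \<Longrightarrow> C #>\<^bsub>G\<^esub> x \<in> topspace X"
  unfolding topspace_X by (auto simp: proj_mult)

lemma open_level_condition:
  assumes v: "v \<in> V" "w \<in> V"
  shows "openin X {C \<in> topspace X. P (level_at v C) (level_at w C)}"
proof -
  have eq: "{g \<in> carrier G. proj g \<in> {C \<in> topspace X. P (level_at v C) (level_at w C)}} =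
      {g \<in> carrier G. P (l (g v)) (l (g w))}"
    using v by (auto simp: level_at_proj topspace_X)
  have "saturated {v, w} {g \<in> carrier G. P (l (g v)) (l (g w))}" by (auto simp: saturated_def)
  then have "openin T {g \<in> carrier G. P (l (g v)) (l (g w))}"
    using v by (intro saturated_open) auto
  then show ?thesis unfolding openin_X eq by (auto simp: topspace_X)
qed

text \<open>A representative of the coset maps a geodesic to a walk, and every edge changes the
  level by one.\<close>

lemma level_at_lipschitz:
  assumes C: "C \<in> topspace X" and v: "v \<in> V" and w: "w \<in> V"
  shows "\<bar>level_at v C - level_at w C\<bar> \<le> int (gdist v w)"
proof -
  obtain g where g: "g \<in> carrier G" "C = proj g" using C unfolding topspace_X by blast
  have "\<bar>l (g v) - l (g w)\<bar> \<le> int (gdist v w)"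
    using v w
  proof (induction rule: dist_induct)
    case (step w)
    have "\<bar>l (g (parent v w)) - l (g w)\<bar> = 1"
      using leveling_step[OF leveling] aut_nbr_iff[OF g(1)] step nbrs_sym by metis
    then show ?case using step parent(2)[OF v step(1,2)] by linarith
  qed simp
  then show ?thesis using g v w by (simp add: level_at_proj)
qed

text \<open>The masses are derived from invariance alone, so that every invariant measure is covered
  and not just \<open>quotient_measure\<close>. The constant is positive, since otherwise countably
  many null levels would exhaust the space.\<close>

lemma level_masses:
  assumes \<mu>: "finite_invariant_measure G T \<Gamma> \<mu>"
  shows "\<exists>c>0. \<forall>i. measure \<mu> (level_set i) = c / q ^ Suc (low i)"
proof -
  interpret finite_measure \<mu> using \<mu> by (simp add: finite_invariant_measure_def)
  have sp: "space \<mu> = topspace X" and st: "sets \<mu> = borel_sets_of X"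
    using \<mu> by (auto simp: finite_invariant_measure_def regular_borel_measure_def)
  \<comment> \<open>The cosets whose elements send the pair \<open>v\<close>, \<open>w\<close> to
    the levels \<open>i\<close>, \<open>j\<close>. By invariance the mass depends only on the orbit
    of the pair under \<open>G\<close>.\<close>
  define P where "P = (\<lambda>v w i j. {C \<in> topspace X. level_at v C = i \<and> level_at w C = j})"
  define m where "m = (\<lambda>i. measure \<mu> (level_set i))"
  have P_sets: "P v w i j \<in> sets \<mu>" if "v \<in> V" "w \<in> V" for v w i j
    unfolding P_def st by (intro open_in_borel_sets_of open_level_condition that)
  have m_sets: "level_set i \<in> sets \<mu>" for i
    using open_level_condition[OF base base, of "\<lambda>j _. j = i"] st open_in_borel_sets_of by blast
  have translate: "measure \<mu> (P (x v) (x w) i j) = measure \<mu> (P v w i j)"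
    if x: "x \<in> carrier G" and v: "v \<in> V" "w \<in> V" for x v w i j
  proof -
    have xV: "x v \<in> V" "x w \<in> V" using aut_in_V[OF x] v by auto
    have "(\<lambda>C. C #>\<^bsub>G\<^esub> x) ` P (x v) (x w) i j = P v w i j"
    proof -
      have "P (x v) (x w) i j \<in> borel_sets_of X" using P_sets[OF xV] st by simp
      from translate_borel(1)[OF this x]
      show ?thesis
        using xV v x inv_apply[OF x] translate_topspace[of _ "ginv x"]
        by (auto simp: P_def level_at_translate)
    qed
    then have "emeasure \<mu> (P v w i j) = emeasure \<mu> (P (x v) (x w) i j)"
      using \<mu> x P_sets[OF xV] unfolding finite_invariant_measure_def by metis
    then show ?thesis by (simp add: measure_def)
  qed
  obtain b where b: "b \<in> nbrs base" using nbr_exists[OF base] by blast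
  have bV: "b \<in> V" using b nbrs_in_V by blast
  have nbr: "measure \<mu> (P base w i j) = measure \<mu> (P base b i j)" if w: "w \<in> nbrs base" for w i j
  proof -
    obtain x where "x \<in> carrier G" "x base = base" "x b = w" using arc_transitive[OF b w] .
    then show ?thesis using translate[of x base b i j] base bV by simp
  qed
  \<comment> \<open>An automorphism inverting the edge exchanges the roles of the two
    levels.\<close>
  have flip: "measure \<mu> (P base b i j) = measure \<mu> (P base b j i)" for i j
  proof -
    have "base \<in> nbrs b" using b nbrs_sym by blast
    from arc_transitive[OF b this] obtain x where "x \<in> carrier G" "x base = b" "x b = base" .
    then have "measure \<mu> (P b base i j) = measure \<mu> (P base b i j)"
      using translate[of x base b i j] base bV by simp
    moreover have "P b base i j = P base b j i" by (auto simp: P_def)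
    ultimately show ?thesis by simp
  qed
  \<comment> \<open>Double counting over the star of \<open>base\<close>: all \<open>k\<close>
    neighbours give the same mass, while a coset that sends \<open>base\<close> to level
    \<open>i\<close> sends exactly \<open>deg i j\<close> of them to level \<open>j\<close>.\<close>
  have balance: "real k * measure \<mu> (P base b i j) = m i * real (deg i j)"
    if ij: "j = maj i \<or> j = mnr i" for i j
  proof -
    have cnt: "(\<Sum>w\<in>nbrs base. indicator (P base w i j) C) = real (deg i j) * indicator (level_set i) C"
      if C: "C \<in> space \<mu>" for C
    proof -
      obtain g where g: "g \<in> carrier G" "C = proj g" using C sp unfolding topspace_X by blast
      have gb: "g base \<in> V" using aut_in_V[OF g(1) base] .
      have PC: "C \<in> P base w i j \<longleftrightarrow> l (g base) = i \<and> l (g w) = j" if "w \<in> nbrs base" for w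
        using that g base nbrs_in_V C sp by (auto simp: P_def level_at_proj)
      have DC: "C \<in> level_set i \<longleftrightarrow> l (g base) = i" using g base C sp by (auto simp: level_at_proj)
      show ?thesis
      proof (cases "l (g base) = i")
        case True
        have "(\<Sum>w\<in>nbrs base. indicator (P base w i j) C :: real) = real (card {w \<in> nbrs base. l (g w) = j})"
          using finite_nbrs[OF base] PC True
          by (simp add: indicator_def sum.If_cases Int_def conj_commute cong: sum.cong conj_cong)
        also have "card {w \<in> nbrs base. l (g w) = j} = card {u \<in> nbrs (g base). l u = j}"
        proof (rule bij_betw_same_card)
          show "bij_betw g {w \<in> nbrs base. l (g w) = j} {u \<in> nbrs (g base). l u = j}"
            using aut_nbrs[OF g(1) base] unfolding bij_betw_def inj_on_def by blast
        qed
        also have "\<dots> = deg i j" using card_level_nbrs[OF gb] ij True by simp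
        finally show ?thesis using DC True by simp
      next
        case False
        then have "indicator (P base w i j) C = (0 :: real)" if "w \<in> nbrs base" for w
          using PC[OF that] by simp
        then show ?thesis using DC False by simp
      qed
    qed
    have "real k * measure \<mu> (P base b i j) = (\<Sum>w\<in>nbrs base. measure \<mu> (P base w i j))"
      using nbr card_nbrs[OF base] by simp
    also have "\<dots> = (\<Sum>w\<in>nbrs base. LINT C|\<mu>. indicator (P base w i j) C)"
      by (intro sum.cong) (auto simp: sp P_def Int_def conj_commute cong: conj_cong)
    also have "\<dots> = (LINT C|\<mu>. (\<Sum>w\<in>nbrs base. indicator (P base w i j) C))"
      using P_sets[OF base] nbrs_in_V
      by (intro Bochner_Integration.integral_sum[symmetric] integrable_real_indicator)
         (auto simp: emeasure_eq_measure)
    also have "\<dots> = (LINT C|\<mu>. real (deg i j) * indicator (level_set i) C)"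
      using cnt by (rule Bochner_Integration.integral_cong[OF refl])
    also have "\<dots> = real (deg i j) * m i"
      by (simp add: m_def sp Int_def conj_commute cong: conj_cong)
    finally show ?thesis by simp
  qed
  have m_eq: "m i = m 0 * q ^ Suc (low 0) / q ^ Suc (low i)" for i
  proof (rule balanced_weights)
    fix i
    have "i + 1 = maj i \<or> i + 1 = mnr i" "i = maj (i + 1) \<or> i = mnr (i + 1)"
      by (simp_all add: maj_or_mnr_iff)
    then show "m i * real (deg i (i + 1)) = m (i + 1) * real (deg (i + 1) i)"
      using balance[of "i + 1" i] balance[of i "i + 1"] flip[of i "i + 1"] by simp
  qed
  have "m 0 \<noteq> 0"
  proof
    assume "m 0 = 0"
    then have "m i = 0" for i using m_eq[of i] by simp
    then have null: "emeasure \<mu> (level_set i) = 0" for i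
      by (simp add: m_def emeasure_eq_measure)
    have "level_set i \<in> null_sets \<mu>" for i
      using null m_sets by (intro null_setsI)
    then have "emeasure \<mu> (\<Union>i. level_set i) = 0"
      by (intro null_setsD1 null_sets_UN)
    moreover have "(\<Union>i. level_set i) = space \<mu>" using sp by auto
    ultimately show False using \<mu> by (simp add: finite_invariant_measure_def)
  qed
  moreover have "m 0 \<ge> 0" by (simp add: m_def)
  ultimately have "m 0 > 0" by simp
  moreover have "real_of_int (q ^ Suc (low 0)) > 0" using q_pos by simp
  ultimately have "m 0 * q ^ Suc (low 0) > 0" by (rule mult_pos_pos)
  moreover have "\<forall>i. measure \<mu> (level_set i) = m 0 * q ^ Suc (low 0) / q ^ Suc (low i)"
  proof
    fix i
    show "measure \<mu> (level_set i) = m 0 * q ^ Suc (low 0) / q ^ Suc (low i)"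
      using m_eq[of i] unfolding m_def .
  qed
  ultimately show ?thesis by (intro exI conjI)
qed

section \<open>From test functions on the levels to almost invariant vectors\<close>

lemma integral_level_function:
  fixes f :: "int \<Rightarrow> real"
  assumes "finite_measure \<mu>" "space \<mu> = topspace X" "sets \<mu> = borel_sets_of X"
    and fin: "finite S" "\<And>i. i \<notin> S \<Longrightarrow> f i = 0"
  shows "integrable \<mu> (\<lambda>C. f (level_at base C))"
    and "(LINT C|\<mu>. f (level_at base C)) =
      (\<Sum>i\<in>S. f i * measure \<mu> (level_set i))"
proof -
  interpret finite_measure \<mu> by fact
  have D: "level_set i \<in> sets \<mu>" for i
    using open_level_condition[OF base base, of "\<lambda>j _. j = i"] assms(3) open_in_borel_sets_of by blast
  have eq: "f (level_at base C) = (\<Sum>i\<in>S. f i * indicator (level_set i) C)" if "C \<in> space \<mu>" for C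
  proof -
    have "(\<Sum>i\<in>S. f i * indicator (level_set i) C) = (\<Sum>i\<in>S. if i = level_at base C then f i else 0)"
      using that assms(2) by (intro sum.cong) (auto simp: indicator_def)
    also have "\<dots> = f (level_at base C)" using fin by (simp add: sum.delta)
    finally show ?thesis by simp
  qed
  have int: "integrable \<mu> (\<lambda>C. f i * indicator (level_set i) C)" for i
    using D by (intro integrable_mult_right integrable_real_indicator) (auto simp: emeasure_eq_measure)
  then have "integrable \<mu> (\<lambda>C. \<Sum>i\<in>S. f i * indicator (level_set i) C)" by simp
  then show "integrable \<mu> (\<lambda>C. f (level_at base C))"
    by (subst Bochner_Integration.integrable_cong[OF refl eq])
  have "(LINT C|\<mu>. f (level_at base C)) = (LINT C|\<mu>. (\<Sum>i\<in>S. f i * indicator (level_set i) C))"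
    using eq by (rule Bochner_Integration.integral_cong[OF refl])
  also have "\<dots> = (\<Sum>i\<in>S. LINT C|\<mu>. f i * indicator (level_set i) C)"
    using int by (rule Bochner_Integration.integral_sum)
  also have "\<dots> = (\<Sum>i\<in>S. f i * measure \<mu> (level_set i))"
    using assms(2) by (simp add: Int_def conj_commute cong: conj_cong)
  finally show "(LINT C|\<mu>. f (level_at base C)) =
      (\<Sum>i\<in>S. f i * measure \<mu> (level_set i))" .
qed

text \<open>A test function that is balanced and whose \<open>n\<close>-boundary carries little mass gives a unit
  vector moved only slightly by the elements that move the base vertex by at most \<open>n\<close>.\<close>

lemma no_spectral_gap:
  assumes \<mu>: "finite_invariant_measure G T \<Gamma> \<mu>"
    and flat: "\<And>n \<delta>. \<delta> > 0 \<Longrightarrow> \<exists>(f :: int \<Rightarrow> real) S B. finite S \<and> finite B \<and> (\<forall>i. i \<notin> S \<longrightarrow> f i = 0) \<and>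
        (\<forall>i. \<bar>f i\<bar> \<le> 1) \<and> (\<forall>i j. \<bar>i - j\<bar> \<le> int n \<and> f i \<noteq> f j \<longrightarrow> i \<in> B) \<and>
        (\<Sum>i\<in>S. f i / q ^ Suc (low i)) = 0 \<and> (\<Sum>i\<in>S. (f i)\<^sup>2 / q ^ Suc (low i)) > 0 \<and>
        (\<Sum>i\<in>B. 1 / q ^ Suc (low i)) \<le> \<delta> * (\<Sum>i\<in>S. (f i)\<^sup>2 / q ^ Suc (low i))"
  shows "\<not> spectral_gap G T \<mu>"
  unfolding spectral_gap_def almost_invariant_vectors_def not_not
proof (intro allI impI)
  fix Q and \<epsilon> :: real assume Q\<epsilon>: "compactin T Q \<and> \<epsilon> > 0"
  have fm: "finite_measure \<mu>" using \<mu> by (simp add: finite_invariant_measure_def)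
  interpret finite_measure \<mu> by (rule fm)
  have sp: "space \<mu> = topspace X" and st: "sets \<mu> = borel_sets_of X"
    using \<mu> by (auto simp: finite_invariant_measure_def regular_borel_measure_def)
  obtain c where c: "c > 0"
    "\<And>i. measure \<mu> (level_set i) = c / q ^ Suc (low i)"
    using level_masses[OF \<mu>] by blast
  have Qc: "Q \<subseteq> carrier G" using Q\<epsilon> compactin_subset_topspace topspace_T by metis
  \<comment> \<open>By compactness \<open>Q\<close> moves \<open>base\<close> to finitely many
    vertices only; 0 is inserted to cover an empty \<open>Q\<close>.\<close>
  define n where "n = Max (insert 0 ((\<lambda>w. gdist base w) ` (\<lambda>x. x base) ` Q))"
  have n: "gdist base (x base) \<le> n" if "x \<in> Q" for x
    unfolding n_def using compact_finite_image[OF _ base, of Q] Q\<epsilon> that by (intro Max_ge) auto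
  \<comment> \<open>Values of \<open>f\<close> differ by at most 2, so the squared norm of the
    difference is at most four times the square of \<open>\<epsilon> / 4\<close>, which is the
    square of \<open>\<epsilon> / 2\<close>. Half of \<open>\<epsilon>\<close> keeps the supremum
    strictly below \<open>\<epsilon>\<close>.\<close>
  have "(\<epsilon> / 4)\<^sup>2 > 0" using Q\<epsilon> by simp
  from flat[OF this, of n] obtain f :: "int \<Rightarrow> real" and S B where f: "finite S" "finite B"
    "\<And>i. i \<notin> S \<Longrightarrow> f i = 0" "\<And>i. \<bar>f i\<bar> \<le> 1"
    "\<And>i j. \<bar>i - j\<bar> \<le> int n \<Longrightarrow> f i \<noteq> f j \<Longrightarrow> i \<in> B"
    "(\<Sum>i\<in>S. f i / q ^ Suc (low i)) = 0" "(\<Sum>i\<in>S. (f i)\<^sup>2 / q ^ Suc (low i)) > 0"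
    "(\<Sum>i\<in>B. 1 / q ^ Suc (low i)) \<le> (\<epsilon> / 4)\<^sup>2 * (\<Sum>i\<in>S. (f i)\<^sup>2 / q ^ Suc (low i))"
    by blast
  define Z where "Z = c * (\<Sum>i\<in>S. (f i)\<^sup>2 / q ^ Suc (low i))"
  have Z: "Z > 0" using c f(7) by (simp add: Z_def)
  define \<xi> where "\<xi> = (\<lambda>C. complex_of_real (f (level_at base C) / sqrt Z))"
  note lf = integral_level_function[OF fm sp st]
  have int_f: "(LINT C|\<mu>. f (level_at base C)) = 0" "integrable \<mu> (\<lambda>C. f (level_at base C))"
  proof -
    have "(LINT C|\<mu>. f (level_at base C)) = c * (\<Sum>i\<in>S. f i / q ^ Suc (low i))"
      using lf(2)[OF f(1,3)] c(2) by (simp add: sum_distrib_left mult.commute)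
    then show "(LINT C|\<mu>. f (level_at base C)) = 0" using f(6) by simp
    show "integrable \<mu> (\<lambda>C. f (level_at base C))" by (rule lf(1)[OF f(1,3)])
  qed
  have int_f2: "(LINT C|\<mu>. (f (level_at base C))\<^sup>2) = Z" "integrable \<mu> (\<lambda>C. (f (level_at base C))\<^sup>2)"
  proof -
    have "(LINT C|\<mu>. (f (level_at base C))\<^sup>2) = (\<Sum>i\<in>S. (f i)\<^sup>2 * (c / q ^ Suc (low i)))"
      using lf(2)[of S "\<lambda>i. (f i)\<^sup>2"] f(1,3) c(2) by simp
    then show "(LINT C|\<mu>. (f (level_at base C))\<^sup>2) = Z"
      by (simp add: Z_def sum_distrib_left mult.commute)
    show "integrable \<mu> (\<lambda>C. (f (level_at base C))\<^sup>2)" using lf(1)[of S "\<lambda>i. (f i)\<^sup>2"] f(1,3) by simp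
  qed
  have sq: "(cmod (\<xi> C))\<^sup>2 = (f (level_at base C))\<^sup>2 / Z" for C
    using Z by (simp add: \<xi>_def power_divide norm_divide)
  have "\<xi> \<in> L2_zero_space \<mu>"
  proof -
    have "\<xi> \<in> borel_measurable \<mu>"
      unfolding \<xi>_def using borel_measurable_integrable[OF int_f(2)] by measurable
    moreover have "integrable \<mu> (\<lambda>C. (cmod (\<xi> C))\<^sup>2)" unfolding sq using int_f2(2) by simp
    moreover have "(LINT C|\<mu>. \<xi> C) = 0"
      unfolding \<xi>_def integral_complex_of_real using int_f(1) by simp
    ultimately show ?thesis by (simp add: L2_zero_space_def L2_space_def)
  qed
  moreover have "L2_seminorm \<mu> \<xi> = 1"
    unfolding L2_seminorm_def sq using int_f2(1) Z by simp
  moreover have "L2_seminorm \<mu> (right_translation G x \<xi> - \<xi>) \<le> \<epsilon> / 2" if x: "x \<in> Q" for x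
  proof -
    let ?ind = "\<lambda>i. if i \<in> B then 4 else (0 :: real)"
    have xc: "x \<in> carrier G" "x base \<in> V" using x Qc aut_in_V base by auto
    \<comment> \<open>Translation by \<open>x\<close> replaces the level of \<open>base\<close> by
      that of \<open>x base\<close>, at most \<open>n\<close> away. The difference therefore lives
      on the levels in \<open>B\<close>.\<close>
    have bound: "(cmod ((right_translation G x \<xi> - \<xi>) C))\<^sup>2 \<le> ?ind (level_at base C) / Z"
      if C: "C \<in> space \<mu>" for C
    proof -
      let ?i = "level_at base C" and ?j = "level_at (x base) C"
      have "(right_translation G x \<xi> - \<xi>) C = complex_of_real ((f ?j - f ?i) / sqrt Z)"
        using C sp level_at_translate[OF _ xc(1) base, of C]
        by (simp add: right_translation_def \<xi>_def diff_divide_distrib)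
      then have eq: "(cmod ((right_translation G x \<xi> - \<xi>) C))\<^sup>2 = (f ?j - f ?i)\<^sup>2 / Z"
        using Z by (simp only: norm_of_real power2_abs power_divide) simp
      have "(f ?j - f ?i)\<^sup>2 \<le> ?ind ?i"
      proof (cases "f ?i = f ?j")
        case False
        have "\<bar>?i - ?j\<bar> \<le> int (gdist base (x base))"
          using level_at_lipschitz[of C base "x base"] C sp base xc by simp
        then have "?i \<in> B" using f(5)[of ?i ?j] False n[OF x] by linarith
        moreover have "\<bar>f ?j - f ?i\<bar> \<le> 2" using f(4)[of ?i] f(4)[of ?j] by linarith
        then have "(f ?j - f ?i)\<^sup>2 \<le> 2\<^sup>2" by (metis abs_ge_zero power2_abs power_mono)
        ultimately show ?thesis by simp
      qed simp
      then show ?thesis unfolding eq using Z by (simp add: divide_right_mono)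
    qed
    have "(LINT C|\<mu>. ?ind (level_at base C)) = (\<Sum>i\<in>B. ?ind i * (c / q ^ Suc (low i)))"
      using lf(2)[of B ?ind] f(2) c(2) by simp
    also have "\<dots> = 4 * c * (\<Sum>i\<in>B. 1 / q ^ Suc (low i))"
      unfolding sum_distrib_left by (intro sum.cong) auto
    also have "\<dots> \<le> 4 * c * ((\<epsilon> / 4)\<^sup>2 * (\<Sum>i\<in>S. (f i)\<^sup>2 / q ^ Suc (low i)))"
      using f(8) c(1) by (intro mult_left_mono) auto
    also have "\<dots> = (\<epsilon> / 2)\<^sup>2 * Z" by (simp add: Z_def power2_eq_square)
    finally have I: "(LINT C|\<mu>. ?ind (level_at base C)) \<le> (\<epsilon> / 2)\<^sup>2 * Z" .
    have "(LINT C|\<mu>. (cmod ((right_translation G x \<xi> - \<xi>) C))\<^sup>2) \<le> (LINT C|\<mu>. ?ind (level_at base C) / Z)"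
    proof (rule Bochner_Integration.integral_mono')
      show "integrable \<mu> (\<lambda>C. ?ind (level_at base C) / Z)"
        using lf(1)[of B ?ind] f(2) by simp
    qed (use bound Z in auto)
    also have "\<dots> = (LINT C|\<mu>. ?ind (level_at base C)) / Z" by simp
    also have "\<dots> \<le> (\<epsilon> / 2)\<^sup>2" using I Z by (simp add: divide_le_eq)
    finally have "L2_seminorm \<mu> (right_translation G x \<xi> - \<xi>) \<le> sqrt ((\<epsilon> / 2)\<^sup>2)"
      unfolding L2_seminorm_def by (rule real_sqrt_le_mono)
    then show ?thesis using Q\<epsilon> by simp
  qed
  then have le: "(SUP x\<in>Q. ennreal (L2_seminorm \<mu> (right_translation G x \<xi> - \<xi>))) \<le> ennreal (\<epsilon> / 2)"
    by (intro SUP_least ennreal_leI)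
  have "ennreal (\<epsilon> / 2) < ennreal \<epsilon>" using Q\<epsilon> by (simp add: ennreal_less_iff)
  from le_less_trans[OF le this]
  have "(SUP x\<in>Q. ennreal (L2_seminorm \<mu> (right_translation G x \<xi> - \<xi>))) < ennreal \<epsilon>" .
  ultimately show "\<exists>\<xi>\<in>L2_zero_space \<mu>. L2_seminorm \<mu> \<xi> = 1 \<and>
      (SUP x\<in>Q. ennreal (L2_seminorm \<mu> (right_translation G x \<xi> - \<xi>))) < ennreal \<epsilon>"
    by (intro bexI[of _ \<xi>] conjI)
qed

end

section \<open>Slowly growing heights\<close>

text \<open>The height oscillates between \<open>r\<close> and \<open>r + 1\<close> on the levels \<open>i\<close> with
  \<open>r\<^sup>2 \<le> \<bar>i\<bar> < (r + 1)\<^sup>2\<close>: long flat stretches, yet growing fast enough for finite covolume.\<close>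

definition sqrt_height :: "int \<Rightarrow> nat" where
  "sqrt_height i = (let r = floor_sqrt (nat \<bar>i\<bar>) in if even (int r + i) then r else Suc r)"

lemma sqrt_height_uminus: "sqrt_height (- i) = sqrt_height i"
  by (simp add: sqrt_height_def)

lemma sqrt_height_bounds: "floor_sqrt (nat \<bar>i\<bar>) \<le> sqrt_height i" "sqrt_height i \<le> Suc (floor_sqrt (nat \<bar>i\<bar>))"
  by (auto simp: sqrt_height_def Let_def)

lemma floor_sqrt_Suc_cases: "floor_sqrt (Suc n) = floor_sqrt n \<or> floor_sqrt (Suc n) = Suc (floor_sqrt n)"
  by (auto simp: floor_sqrt_Suc)

lemma parity_sqrt_height: "even (int (sqrt_height i) + i)"
  by (auto simp: sqrt_height_def Let_def)

text \<open>The increment is odd by parity and lies between -1 and 2, hence is 1 or -1.\<close>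

lemma sqrt_height_step_nonneg:
  assumes "i \<ge> 0"
  shows "sqrt_height (i + 1) = Suc (sqrt_height i) \<or> sqrt_height i = Suc (sqrt_height (i + 1))"
proof -
  have i: "nat \<bar>i + 1\<bar> = Suc (nat \<bar>i\<bar>)" using assms by simp
  have "odd (int (sqrt_height (i + 1)) + int (sqrt_height i))"
    using parity_sqrt_height[of i] parity_sqrt_height[of "i + 1"] by presburger
  moreover have "sqrt_height (i + 1) \<le> sqrt_height i + 2" "sqrt_height i \<le> sqrt_height (i + 1) + 1"
    using sqrt_height_bounds[of i] sqrt_height_bounds[of "i + 1"] floor_sqrt_Suc_cases[of "nat \<bar>i\<bar>"]
    unfolding i by linarith+
  ultimately show ?thesis by presburger
qed

lemma sqrt_height_step:
  "sqrt_height (i + 1) = Suc (sqrt_height i) \<or> sqrt_height i = Suc (sqrt_height (i + 1))"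
proof (cases "i \<ge> 0")
  case False
  then show ?thesis
    using sqrt_height_step_nonneg[of "- i - 1"] sqrt_height_uminus[of i] sqrt_height_uminus[of "i + 1"]
    by auto
qed (rule sqrt_height_step_nonneg)

text \<open>The quotient of \<open>(r + 1) ^ 4\<close> by \<open>2 ^ r\<close> peaks at
  \<open>r = 5\<close> with value 40.5, whence the constant 41. From there on, the fourth power at
  most doubles at each step.\<close>

lemma fourth_power_le: "(real r + 1) ^ 4 \<le> 41 * 2 ^ r"
proof (cases "r \<le> 5")
  case True
  then have "r \<in> {0, 1, 2, 3, 4, 5}" by auto
  then show ?thesis by auto
next
  case False
  then have "5 \<le> r" by simp
  then show ?thesis
  proof (induction r rule: dec_induct)
    case (step r)
    define s where "s = real r + 1"
    have s: "s \<ge> 6" using step by (simp add: s_def)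
    have "6 * s ^ 3 \<le> s * s ^ 3" using s by (intro mult_right_mono) auto
    then have "6 * s ^ 3 \<le> s ^ 4" by (simp add: eval_nat_numeral)
    moreover have "6 * s ^ 2 \<le> s * s ^ 2" using s by (intro mult_right_mono) auto
    then have "6 * s ^ 2 \<le> s ^ 3" by (simp add: eval_nat_numeral)
    moreover have "6 * s \<le> s * s" using s by (intro mult_right_mono) auto
    then have "6 * s \<le> s ^ 2" by (simp add: power2_eq_square)
    moreover have "(s + 1) ^ 4 = s ^ 4 + 4 * s ^ 3 + 6 * s ^ 2 + 4 * s + 1"
      by (simp add: eval_nat_numeral algebra_simps)
    ultimately have "(s + 1) ^ 4 \<le> 2 * s ^ 4" using s by linarith
    then show ?case using step.IH by (simp add: s_def add.commute)
  qed simp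
qed

text \<open>Along the enumeration \<open>int_decode\<close> of the levels, \<open>n + 1\<close> is
  at most \<open>2 * (r + 1)^2\<close> for the root \<open>r\<close>, so
  \<open>fourth_power_le\<close> gives a comparison with the series of inverse squares; the constant
  164 is \<open>4 * 41\<close>.\<close>

lemma sqrt_weights_summable:
  fixes w :: "int \<Rightarrow> real"
  assumes w: "\<And>i. 0 \<le> w i" "\<And>i. w i \<le> c / 2 ^ floor_sqrt (nat \<bar>i\<bar>)"
  shows "(\<integral>\<^sup>+i. ennreal (w i) \<partial>count_space UNIV) \<noteq> \<infinity>"
proof -
  have c: "c \<ge> 0" using order_trans[OF w(1) w(2), of 0] by simp
  have bound: "w (int_decode n) \<le> 164 * c * inverse (real (Suc n) ^ 2)" for n
  proof -
    let ?r = "floor_sqrt (nat \<bar>int_decode n\<bar>)"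
    have "n div 2 \<le> nat \<bar>int_decode n\<bar>" by (auto simp: int_decode_def sum_decode_def)
    also have "nat \<bar>int_decode n\<bar> < (Suc ?r)\<^sup>2" by (rule Suc_floor_sqrt_power2_gt)
    finally have "Suc n \<le> 2 * (Suc ?r)\<^sup>2" by linarith
    then have "real (Suc n) \<le> real (2 * (Suc ?r)\<^sup>2)" by (rule of_nat_mono)
    then have "real (Suc n) \<le> 2 * (real ?r + 1)\<^sup>2" by (simp add: add.commute)
    then have "real (Suc n) ^ 2 \<le> (2 * (real ?r + 1)\<^sup>2) ^ 2" by (rule power_mono) simp
    also have "\<dots> = 4 * (real ?r + 1) ^ 4" by (simp add: power_mult_distrib)
    also have "\<dots> \<le> 164 * 2 ^ ?r" using fourth_power_le[of ?r] by simp
    finally have "1 / 2 ^ ?r \<le> 164 * inverse (real (Suc n) ^ 2)"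
      by (simp add: field_simps)
    then have "c * (1 / 2 ^ ?r) \<le> c * (164 * inverse (real (Suc n) ^ 2))"
      using c by (rule mult_left_mono)
    then show ?thesis using w(2)[of "int_decode n"] by simp
  qed
  have "summable (\<lambda>n. inverse (real n ^ 2))" by (rule inverse_power_summable) simp
  then have sm: "summable (\<lambda>n. 164 * c * inverse (real (Suc n) ^ 2))"
    by (intro summable_mult) (subst summable_Suc_iff)
  have "(\<integral>\<^sup>+i. ennreal (w i) \<partial>count_space UNIV) = (\<integral>\<^sup>+n. ennreal (w (int_decode n)) \<partial>count_space UNIV)"
    by (rule nn_integral_bij_count_space[symmetric]) (rule bij_int_decode)
  also have "\<dots> \<le> (\<integral>\<^sup>+n. ennreal (164 * c * inverse (real (Suc n) ^ 2)) \<partial>count_space UNIV)"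
    using bound by (intro nn_integral_mono ennreal_leI)
  also have "\<dots> = (\<Sum>n. ennreal (164 * c * inverse (real (Suc n) ^ 2)))"
    by (rule nn_integral_count_space_nat)
  also have "\<dots> = ennreal (\<Sum>n. 164 * c * inverse (real (Suc n) ^ 2))"
    using c sm by (intro suminf_ennreal2) auto
  finally show ?thesis by (auto simp: top_unique)
qed

text \<open>\<open>f\<close> is 1 on a stretch of constant weight and -1 on its mirror image, so the
  weighted sum vanishes. The boundary consists of neighbourhoods of four ends, of a size independent
  of the length of the stretch.\<close>

lemma flat_test_function:
  fixes q :: int and low :: "int \<Rightarrow> nat"
  assumes q: "q \<ge> 2" and low: "\<And>i. low i = min (sqrt_height (i - 1)) (sqrt_height i)" and \<delta>: "\<delta> > 0"
  shows "\<exists>(f :: int \<Rightarrow> real) S B. finite S \<and> finite B \<and> (\<forall>i. i \<notin> S \<longrightarrow> f i = 0) \<and>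
        (\<forall>i. \<bar>f i\<bar> \<le> 1) \<and> (\<forall>i j. \<bar>i - j\<bar> \<le> int n \<and> f i \<noteq> f j \<longrightarrow> i \<in> B) \<and>
        (\<Sum>i\<in>S. f i / q ^ Suc (low i)) = 0 \<and> (\<Sum>i\<in>S. (f i)\<^sup>2 / q ^ Suc (low i)) > 0 \<and>
        (\<Sum>i\<in>B. 1 / q ^ Suc (low i)) \<le> \<delta> * (\<Sum>i\<in>S. (f i)\<^sup>2 / q ^ Suc (low i))"
proof -
  \<comment> \<open>The boundary has at most \<open>4 * (2 * n + 1)\<close> levels of weight at most
    \<open>1 / q ^ r\<close>, against \<open>4 * r\<close> levels of weight
    \<open>1 / q ^ Suc r\<close> in the two stretches. Comparing the two yields this bound.\<close>
  obtain r0 :: nat where r0: "real (2 * n + 1) * q / \<delta> \<le> real r0" using real_arch_simple by blast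
  \<comment> \<open>The lower bound \<open>Suc n\<close> keeps the levels within \<open>n\<close> of
    the ends at heights at least \<open>r - 1\<close>.\<close>
  define r where "r = max r0 (Suc n)"
  have r: "r \<ge> Suc n" "real (2 * n + 1) * q \<le> \<delta> * real r"
  proof -
    show "r \<ge> Suc n" by (simp add: r_def)
    have "real (2 * n + 1) * q / \<delta> \<le> real r" using r0 by (simp add: r_def)
    then show "real (2 * n + 1) * q \<le> \<delta> * real r" using \<delta> by (simp add: field_simps)
  qed
  \<comment> \<open>The stretch starts at \<open>r^2 + 1\<close> because \<open>low i\<close> also
    looks at level \<open>i - 1\<close>; its length is \<open>2 * r\<close>.\<close>
  define a b where "a = (int r)\<^sup>2 + 1" and "b = (int r + 1)\<^sup>2"
  define I where "I = {a..<b}"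
  \<comment> \<open>\<open>low i\<close> refers to the two edges at level \<open>i\<close>, indexed
    by \<open>i - 1\<close> and \<open>i\<close>, so its symmetry is the reflection
    \<open>1 - i\<close> and not negation.\<close>
  define J where "J = (\<lambda>i. 1 - i) ` I"
  define f :: "int \<Rightarrow> real" where "f = (\<lambda>i. indicator I i - indicator J i)"
  \<comment> \<open>The four centres are the ends of \<open>I\<close> and of \<open>J\<close>, the
    latter being the interval from \<open>2 - b\<close> up to but excluding
    \<open>2 - a\<close>.\<close>
  define B where "B = (\<Union>c\<in>{a, b, 2 - a, 2 - b}. {c - int n..c + int n})"
  have ba: "b - a = 2 * int r" by (simp add: a_def b_def power2_eq_square algebra_simps)
  have a1: "a \<ge> 1" by (simp add: a_def)
  have memJ: "i \<in> J \<longleftrightarrow> 2 - b \<le> i \<and> i < 2 - a" for i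
  proof
    assume "2 - b \<le> i \<and> i < 2 - a"
    then have "1 - i \<in> I" by (auto simp: I_def)
    then show "i \<in> J" unfolding J_def by (intro image_eqI[of _ _ "1 - i"]) auto
  qed (auto simp: J_def I_def)
  have disj: "I \<inter> J = {}"
  proof -
    have "i \<notin> J" if "i \<in> I" for i using that a1 unfolding memJ by (auto simp: I_def)
    then show ?thesis by blast
  qed
  have finIJ: "finite I" "finite J" by (auto simp: I_def J_def)
  have lowI: "low i = r" if "i \<in> I" for i
  proof -
    have i: "(int r)\<^sup>2 \<le> i - 1" "i < (int r + 1)\<^sup>2" using that by (auto simp: I_def a_def b_def)
    have "0 \<le> (int r)\<^sup>2" by simp
    then have i1: "i \<ge> 1" using i(1) by linarith
    have fs: "floor_sqrt (nat \<bar>j\<bar>) = r" if "(int r)\<^sup>2 \<le> j" "j < (int r + 1)\<^sup>2" "j \<ge> 0" for j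
    proof (rule floor_sqrt_unique)
      have "int (r\<^sup>2) \<le> int (nat \<bar>j\<bar>)" using that by simp
      then show "r\<^sup>2 \<le> nat \<bar>j\<bar>" by (simp only: of_nat_le_iff)
      have "int (nat \<bar>j\<bar>) < int ((Suc r)\<^sup>2)" using that by (simp add: add.commute)
      then show "nat \<bar>j\<bar> < (Suc r)\<^sup>2" by (simp only: of_nat_less_iff)
    qed
    have min: "min x y = r" if "y \<in> {r, Suc r}" "x \<in> {r, Suc r}" "y = Suc x \<or> x = Suc y" for x y
      using that by auto
    have "sqrt_height i \<in> {r, Suc r}" "sqrt_height (i - 1) \<in> {r, Suc r}"
      using sqrt_height_bounds[of i] sqrt_height_bounds[of "i - 1"] fs[of i] fs[of "i - 1"] i i1 by auto
    moreover have "sqrt_height i = Suc (sqrt_height (i - 1)) \<or> sqrt_height (i - 1) = Suc (sqrt_height i)"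
      using sqrt_height_step[of "i - 1"] by simp
    ultimately show ?thesis unfolding low by (rule min)
  qed
  have low_refl: "low (1 - i) = low i" for i
    using sqrt_height_uminus[of i] sqrt_height_uminus[of "i - 1"] by (simp add: low min.commute)
  have q0: "real_of_int q > 0" using q by simp
  have sumJ: "(\<Sum>i\<in>J. 1 / q ^ Suc (low i)) = (\<Sum>i\<in>I. 1 / q ^ Suc (low i))"
    unfolding J_def by (subst sum.reindex) (auto simp: inj_on_def low_refl)
  have sumI: "(\<Sum>i\<in>I. 1 / q ^ Suc (low i)) = 2 * real r / q ^ Suc r"
  proof -
    have "(\<Sum>i\<in>I. 1 / q ^ Suc (low i)) = (\<Sum>i\<in>I. 1 / q ^ Suc r)"
      using lowI by (intro sum.cong) auto
    also have "\<dots> = real (card I) * (1 / q ^ Suc r)" by simp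
    also have "real (card I) = 2 * real r" using ba by (simp add: I_def)
    finally show ?thesis by simp
  qed
  have sum2: "(\<Sum>i\<in>I \<union> J. (f i)\<^sup>2 / q ^ Suc (low i)) = 4 * real r / q ^ Suc r"
  proof -
    have "(\<Sum>i\<in>I \<union> J. (f i)\<^sup>2 / q ^ Suc (low i)) = (\<Sum>i\<in>I \<union> J. 1 / q ^ Suc (low i))"
      using disj by (intro sum.cong) (auto simp: f_def indicator_def)
    also have "\<dots> = 4 * real r / q ^ Suc r"
      using disj finIJ sumI sumJ by (simp add: sum.union_disjoint)
    finally show ?thesis .
  qed
  have sum1: "(\<Sum>i\<in>I \<union> J. f i / q ^ Suc (low i)) = 0"
  proof -
    have "(\<Sum>i\<in>I \<union> J. f i / q ^ Suc (low i)) =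
        (\<Sum>i\<in>I. f i / q ^ Suc (low i)) + (\<Sum>i\<in>J. f i / q ^ Suc (low i))"
      using disj finIJ by (intro sum.union_disjoint)
    also have "(\<Sum>i\<in>I. f i / q ^ Suc (low i)) = (\<Sum>i\<in>I. 1 / q ^ Suc (low i))"
      using disj by (intro sum.cong) (auto simp: f_def indicator_def)
    also have "(\<Sum>i\<in>J. f i / q ^ Suc (low i)) = - (\<Sum>i\<in>J. 1 / q ^ Suc (low i))"
      unfolding sum_negf[symmetric]
      using disj by (intro sum.cong) (auto simp: f_def indicator_def)
    finally show ?thesis using sumJ by simp
  qed
  have lowB: "Suc (low i) \<ge> r" if "i \<in> B" for i
  proof -
    have n: "int n \<le> int r - 1" using r(1) by linarith
    have big: "\<bar>i\<bar> \<ge> (int r - 1)\<^sup>2" "\<bar>i - 1\<bar> \<ge> (int r - 1)\<^sup>2"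
    proof -
      have "(int r - 1)\<^sup>2 = (int r)\<^sup>2 - 2 * int r + 1" by (simp add: power2_eq_square algebra_simps)
      moreover have "i \<ge> a - int n \<or> i \<le> 2 - a + int n"
        using that ba by (auto simp: B_def)
      ultimately show "\<bar>i\<bar> \<ge> (int r - 1)\<^sup>2" "\<bar>i - 1\<bar> \<ge> (int r - 1)\<^sup>2"
        using n r(1) by (auto simp: a_def)
    qed
    have "r - 1 \<le> floor_sqrt (nat \<bar>j\<bar>)" if "\<bar>j\<bar> \<ge> (int r - 1)\<^sup>2" for j
    proof (rule le_floor_sqrtI)
      have "int ((r - 1)\<^sup>2) \<le> int (nat \<bar>j\<bar>)" using that r(1) by (simp add: of_nat_diff)
      then show "(r - 1)\<^sup>2 \<le> nat \<bar>j\<bar>" by (simp only: of_nat_le_iff)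
    qed
    from this[OF big(1)] this[OF big(2)] show ?thesis
      using sqrt_height_bounds(1)[of i] sqrt_height_bounds(1)[of "i - 1"] unfolding low by linarith
  qed
  have finB: "finite B" by (simp add: B_def)
  have cardB: "card B \<le> 4 * (2 * n + 1)"
  proof -
    have "card B \<le> (\<Sum>c\<in>{a, b, 2 - a, 2 - b}. card {c - int n..c + int n})"
      unfolding B_def by (rule card_UN_le) simp
    also have "\<dots> = card {a, b, 2 - a, 2 - b} * (2 * n + 1)"
      by (simp add: nat_add_distrib mult.commute)
    also have "\<dots> \<le> 4 * (2 * n + 1)"
      by (intro mult_right_mono) (simp_all add: card_insert_if)
    finally show ?thesis .
  qed
  have sumB: "(\<Sum>i\<in>B. 1 / q ^ Suc (low i)) \<le> \<delta> * (4 * real r / q ^ Suc r)"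
  proof -
    have "(\<Sum>i\<in>B. 1 / q ^ Suc (low i)) \<le> (\<Sum>i\<in>B. 1 / real_of_int q ^ r)"
    proof (rule sum_mono)
      fix i assume "i \<in> B"
      then have "real_of_int q ^ r \<le> real_of_int q ^ Suc (low i)"
        using lowB q by (intro power_increasing) auto
      then show "1 / real_of_int (q ^ Suc (low i)) \<le> 1 / real_of_int q ^ r"
        using q0 by (simp add: frac_le)
    qed
    also have "\<dots> = real (card B) * (1 / real_of_int q ^ r)" by simp
    also have "\<dots> \<le> real (4 * (2 * n + 1)) * (1 / real_of_int q ^ r)"
      using cardB q0 by (intro mult_right_mono of_nat_mono) auto
    also have "\<dots> = 4 * (real (2 * n + 1) * q) / q ^ Suc r" using q0 by (simp add: field_simps)
    also have "\<dots> \<le> 4 * (\<delta> * real r) / q ^ Suc r"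
      using r(2) q0 by (intro divide_right_mono mult_left_mono) auto
    finally show ?thesis by (simp add: mult_ac)
  qed
  \<comment> \<open>If \<open>f\<close> differs at \<open>i\<close> and \<open>j\<close>, one of the
    four ends separates them and lies within \<open>n\<close> of \<open>i\<close>.\<close>
  have boundary: "i \<in> B" if ij: "\<bar>i - j\<bar> \<le> int n" "f i \<noteq> f j" for i j
  proof -
    have "(i \<in> I \<longleftrightarrow> j \<notin> I) \<or> (i \<in> J \<longleftrightarrow> j \<notin> J)"
      using ij(2) by (auto simp: f_def indicator_def split: if_splits)
    then show ?thesis
      using ij(1) unfolding memJ I_def B_def by auto
  qed
  have "(\<Sum>i\<in>I \<union> J. (f i)\<^sup>2 / q ^ Suc (low i)) > 0" unfolding sum2 using r(1) q0 by simp
  moreover have "f i = 0" if "i \<notin> I \<union> J" for i using that by (simp add: f_def)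
  moreover have "\<bar>f i\<bar> \<le> 1" for i by (simp add: f_def indicator_def)
  moreover have "(\<Sum>i\<in>B. 1 / q ^ Suc (low i)) \<le> \<delta> * (\<Sum>i\<in>I \<union> J. (f i)\<^sup>2 / q ^ Suc (low i))"
    unfolding sum2 by (rule sumB)
  moreover have "finite (I \<union> J)" using finIJ by simp
  ultimately have "finite (I \<union> J) \<and> finite B \<and> (\<forall>i. i \<notin> I \<union> J \<longrightarrow> f i = 0) \<and>
      (\<forall>i. \<bar>f i\<bar> \<le> 1) \<and> (\<forall>i j. \<bar>i - j\<bar> \<le> int n \<and> f i \<noteq> f j \<longrightarrow> i \<in> B) \<and>
      (\<Sum>i\<in>I \<union> J. f i / q ^ Suc (low i)) = 0 \<and> (\<Sum>i\<in>I \<union> J. (f i)\<^sup>2 / q ^ Suc (low i)) > 0 \<and>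
      (\<Sum>i\<in>B. 1 / q ^ Suc (low i)) \<le> \<delta> * (\<Sum>i\<in>I \<union> J. (f i)\<^sup>2 / q ^ Suc (low i))"
    using finB boundary sum1 by blast
  then show ?thesis by (rule exI[of _ f, OF exI[of _ "I \<union> J", OF exI[of _ B]]])
qed

theorem theorem2:
  fixes k :: nat and V :: "'v set" and E :: "('v \<times> 'v) set"
  assumes "k > 2"
    and "regular_tree k V E"
  shows "\<exists>\<Gamma>. is_lattice (aut_group V E) (aut_topology V E) \<Gamma> \<and>
           (\<forall>\<mu>. finite_invariant_measure (aut_group V E) (aut_topology V E) \<Gamma> \<mu> \<longrightarrow>
                \<not> spectral_gap (aut_group V E) (aut_topology V E) \<mu>)"
proof -
  interpret R: regular_tree_graph k V E by unfold_locales (fact assms)+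
  interpret L: leveled_tree k V E sqrt_height by unfold_locales (rule sqrt_height_step)
  obtain base where base: "base \<in> V" using R.V_nonempty by blast
  obtain b where b: "b \<in> R.nbrs base" using R.nbr_exists[OF base] by blast
  obtain l idx where lev: "L.leveling l idx" using L.leveling_exists[OF b] .
  interpret A: leveled_lattice k V E sqrt_height base l idx
    by unfold_locales (fact base lev)+
  have q: "int k - 1 \<ge> 2" using assms(1) by simp
  have "(\<integral>\<^sup>+i. ennreal (A.weight i) \<partial>count_space UNIV) \<noteq> \<infinity>"
  proof (rule sqrt_weights_summable)
    \<comment> \<open>The constant in the closed form of the weights. As \<open>k - 1\<close> is at
      least 2 and \<open>Suc (low i)\<close> is at least the root of \<open>\<bar>i\<bar>\<close>,
      powers of 2 in the root bound the weights.\<close>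
    define c where "c = A.weight 0 * (int k - 1) ^ Suc (L.low 0)"
    show "0 \<le> A.weight i" for i using A.weight_pos[of i] by simp
    have c: "c \<ge> 0" unfolding c_def using A.weight_pos[of 0] q by simp
    show "A.weight i \<le> c / 2 ^ floor_sqrt (nat \<bar>i\<bar>)" for i
    proof -
      have "floor_sqrt (nat \<bar>i\<bar>) \<le> Suc (floor_sqrt (nat \<bar>i - 1\<bar>))"
      proof -
        have "floor_sqrt (nat \<bar>i\<bar>) \<le> floor_sqrt (Suc (nat \<bar>i - 1\<bar>))" by (rule mono_floor_sqrt') simp
        then show ?thesis using floor_sqrt_Suc_cases[of "nat \<bar>i - 1\<bar>"] by linarith
      qed
      then have "floor_sqrt (nat \<bar>i\<bar>) \<le> Suc (L.low i)"
        using sqrt_height_bounds(1)[of i] sqrt_height_bounds(1)[of "i - 1"] unfolding L.low_def by linarith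
      then have "(2 :: real) ^ floor_sqrt (nat \<bar>i\<bar>) \<le> 2 ^ Suc (L.low i)" by (intro power_increasing) auto
      also have "\<dots> \<le> real_of_int (int k - 1) ^ Suc (L.low i)" using q by (intro power_mono) auto
      finally have le: "(2 :: real) ^ floor_sqrt (nat \<bar>i\<bar>) \<le> real_of_int (int k - 1) ^ Suc (L.low i)" .
      have "real_of_int (int k - 1) ^ Suc (L.low i) * 2 ^ floor_sqrt (nat \<bar>i\<bar>) > 0"
        by (intro mult_pos_pos zero_less_power) (use q in auto)
      then have "c / real_of_int (int k - 1) ^ Suc (L.low i) \<le> c / 2 ^ floor_sqrt (nat \<bar>i\<bar>)"
        by (rule divide_left_mono[OF le c])
      moreover have "A.weight i = c / real_of_int (int k - 1) ^ Suc (L.low i)"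
        unfolding c_def using A.balanced_weights[OF A.weight_balance, of i] by simp
      ultimately show ?thesis by simp
    qed
  qed
  then have "is_lattice (aut_group V E) (aut_topology V E) A.\<Gamma>" by (rule A.is_lattice_\<Gamma>)
  moreover have "\<not> spectral_gap (aut_group V E) (aut_topology V E) \<mu>"
    if "finite_invariant_measure (aut_group V E) (aut_topology V E) A.\<Gamma> \<mu>" for \<mu>
    by (rule A.no_spectral_gap[OF that]) (rule flat_test_function[OF q L.low_def])
  ultimately show ?thesis by blast
qed

end
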